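(* Let $k\geq 2$ be an integer. The problem $\textsc{LHom}(C_{2k+1})$ can be solved in time $\exp\left(\mathcal{O}\left((n\log n)^{\frac{k+1}{k+2}}\right)\right)$ on $n$-vertex input graphs of diameter at most $k+2$.
   Context: All graphs are finite and simple. $C_{2k+1}$ is the cycle on $2k+1$ vertices. For a fixed graph $H$, in the list homomorphism problem $\textsc{LHom}(H)$ the input is a graph $G$ together with lists $L: V(G)\to 2^{V(H)}$, and the question is whether there is a mapping $\varphi: V(G)\to V(H)$ with $\varphi(v)\in L(v)$ for all $v\in V(G)$ and $\varphi(u)\varphi(v)\in E(H)$ for every edge $uv\in E(G)$. The diameter of $G$ is the maximum over pairs $u,v\in V(G)$ of the number of edges of a shortest $u$-$v$ path. *)

theory Defs
  imports Complex_Main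
    "HOL-Library.Extended_Nat"
    "HOL-Library.Landau_Symbols"
    "Graph_Theory.Graph_Theory"
begin

section \<open>Graphs, diameter and list homomorphisms\<close>

text \<open>
  A finite simple graph is a \<^locale>\<open>pair_graph\<close>: a finite, loop-free, symmetric digraph without
  parallel arcs, the edge \<open>uv\<close> being represented by the two arcs \<open>(u, v)\<close> and \<open>(v, u)\<close>.
\<close>

definition cycle_graph :: "nat \<Rightarrow> nat pair_pre_digraph" where
  "cycle_graph m =
     \<lparr>pverts = {0..<m},
      parcs = {(i, j). i < m \<and> j < m \<and> (j = Suc i mod m \<or> i = Suc j mod m)}\<rparr>"

lemma pair_graph_cycle_graph:
  assumes "m \<ge> 3"
  shows "pair_graph (cycle_graph m)"
proof
  fix e assume e: "e \<in> parcs (cycle_graph m)"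
  then show "fst e \<in> pverts (cycle_graph m)" "snd e \<in> pverts (cycle_graph m)"
    by (auto simp: cycle_graph_def)
  show "fst e \<noteq> snd e"
  proof
    assume eq: "fst e = snd e"
    with e have "fst e < m" "fst e = Suc (fst e) mod m"
      by (auto simp: cycle_graph_def)
    then show False
      using assms by (cases "Suc (fst e) = m") auto
  qed
next
  show "finite (pverts (cycle_graph m))"
    by (simp add: cycle_graph_def)
  show "finite (parcs (cycle_graph m))"
    by (rule finite_subset[of _ "{0..<m} \<times> {0..<m}"]) (auto simp: cycle_graph_def)
  show "symmetric (with_proj (cycle_graph m))"
    by (auto simp: symmetric_def sym_def cycle_graph_def)
qed

text \<open>The distance of two vertices not joined by any path is \<open>\<infinity>\<close>.\<close>

definition graph_dist :: "'a pair_pre_digraph \<Rightarrow> 'a \<Rightarrow> 'a \<Rightarrow> enat" where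
  "graph_dist G u v = (INF p \<in> {p. pre_digraph.apath (with_proj G) u p v}. enat (length p))"

definition graph_diameter :: "'a pair_pre_digraph \<Rightarrow> enat" where
  "graph_diameter G = (SUP u \<in> pverts G. SUP v \<in> pverts G. graph_dist G u v)"

definition list_homomorphism ::
  "'a pair_pre_digraph \<Rightarrow> ('a \<Rightarrow> 'b set) \<Rightarrow> 'b pair_pre_digraph \<Rightarrow> ('a \<Rightarrow> 'b) \<Rightarrow> bool" where
  "list_homomorphism G L H \<phi> \<longleftrightarrow>
     (\<forall>v \<in> pverts G. \<phi> v \<in> pverts H \<and> \<phi> v \<in> L v) \<and>
     (\<forall>(u, v) \<in> parcs G. (\<phi> u, \<phi> v) \<in> parcs H)"

section \<open>Model of computation\<close>

text \<open>
  Algorithms are first-order recursive programs over binary trees (pure Lisp with the single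
  atom nil). A program is a list of function bodies; a body refers to its arguments by position,
  and functions call each other by their index in the program. The only primitives are nil, cons,
  head, tail and a test against nil, and every evaluation step has cost 1.
  As the primitives act on pointers to shared cells, a step takes constant time on a random access
  machine; conversely, programs simulate Turing machines with constant-factor slowdown.
  Running times thus agree with those on Turing machines up to a polynomial.
\<close>

datatype tree = TNil | TCons tree tree

datatype expr =
    Arg nat
  | Nil_Expr
  | Cons_Expr expr expr
  | Hd expr
  | Tl expr
  | If_Expr expr expr expr
  | Call nat "expr list"

type_synonym program = "expr list"

fun tree_hd :: "tree \<Rightarrow> tree" where
  "tree_hd TNil = TNil"
| "tree_hd (TCons x y) = x"

fun tree_tl :: "tree \<Rightarrow> tree" where
  "tree_tl TNil = TNil"
| "tree_tl (TCons x y) = y"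

text \<open>
  \<open>evaluates p env e v t\<close>: with argument values \<open>env\<close>, the expression \<open>e\<close> evaluates to \<open>v\<close>
  in \<open>t\<close> steps. Diverging and ill-formed computations have no value.
\<close>

inductive
  evaluates :: "program \<Rightarrow> tree list \<Rightarrow> expr \<Rightarrow> tree \<Rightarrow> nat \<Rightarrow> bool" and
  evaluates_list :: "program \<Rightarrow> tree list \<Rightarrow> expr list \<Rightarrow> tree list \<Rightarrow> nat \<Rightarrow> bool"
  for p :: program
where
  ev_Arg: "i < length env \<Longrightarrow> evaluates p env (Arg i) (env ! i) 1"
| ev_Nil: "evaluates p env Nil_Expr TNil 1"
| ev_Cons: "evaluates p env a u s \<Longrightarrow> evaluates p env b v t \<Longrightarrow>
    evaluates p env (Cons_Expr a b) (TCons u v) (s + t + 1)"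
| ev_Hd: "evaluates p env a v t \<Longrightarrow> evaluates p env (Hd a) (tree_hd v) (t + 1)"
| ev_Tl: "evaluates p env a v t \<Longrightarrow> evaluates p env (Tl a) (tree_tl v) (t + 1)"
| ev_If_true: "evaluates p env c (TCons x y) s \<Longrightarrow> evaluates p env a v t \<Longrightarrow>
    evaluates p env (If_Expr c a b) v (s + t + 1)"
| ev_If_false: "evaluates p env c TNil s \<Longrightarrow> evaluates p env b v t \<Longrightarrow>
    evaluates p env (If_Expr c a b) v (s + t + 1)"
| ev_Call: "evaluates_list p env es vs s \<Longrightarrow> f < length p \<Longrightarrow> evaluates p vs (p ! f) v t \<Longrightarrow>
    evaluates p env (Call f es) v (s + t + 1)"
| evs_Nil: "evaluates_list p env [] [] 0"
| evs_Cons: "evaluates p env e v s \<Longrightarrow> evaluates_list p env es vs t \<Longrightarrow>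
    evaluates_list p env (e # es) (v # vs) (s + t)"

inductive_cases evaluates_elims:
  "evaluates p env (Arg i) v t"
  "evaluates p env Nil_Expr v t"
  "evaluates p env (Cons_Expr a b) v t"
  "evaluates p env (Hd a) v t"
  "evaluates p env (Tl a) v t"
  "evaluates p env (If_Expr c a b) v t"
  "evaluates p env (Call f es) v t"
  "evaluates_list p env [] vs t"
  "evaluates_list p env (e # es) vs t"

lemma evaluates_deterministic:
  "evaluates p env e v t \<Longrightarrow> evaluates p env e v' t' \<Longrightarrow> v' = v \<and> t' = t"
  "evaluates_list p env es vs t \<Longrightarrow> evaluates_list p env es vs' t' \<Longrightarrow> vs' = vs \<and> t' = t"
proof (induction arbitrary: v' t' and vs' t' rule: evaluates_evaluates_list.inducts)
  case (ev_Arg i env)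
  then show ?case by (auto elim: evaluates_elims(1))
next
  case (ev_Nil env)
  then show ?case by (auto elim: evaluates_elims(2))
next
  case (ev_Cons env a u s b v t)
  from ev_Cons.prems show ?case
    by (rule evaluates_elims(3)) (drule ev_Cons.IH(2), drule ev_Cons.IH(4), simp)
next
  case (ev_Hd env a v t)
  from ev_Hd.prems show ?case
    by (rule evaluates_elims(4)) (drule ev_Hd.IH(2), simp)
next
  case (ev_Tl env a v t)
  from ev_Tl.prems show ?case
    by (rule evaluates_elims(5)) (drule ev_Tl.IH(2), simp)
next
  case (ev_If_true env c x y s a v t b)
  from ev_If_true.prems show ?case
  proof (rule evaluates_elims(6))
    fix x' y' s'' t''
    assume "evaluates p env c (TCons x' y') s''" "evaluates p env a v' t''" "t' = Suc (s'' + t'')"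
    then show ?thesis using ev_If_true.IH(2)[of "TCons x' y'" s''] ev_If_true.IH(4)[of v' t''] by simp
  next
    fix s'' assume "evaluates p env c TNil s''"
    then show ?thesis using ev_If_true.IH(2)[of TNil s''] by simp
  qed
next
  case (ev_If_false env c s b v t a)
  from ev_If_false.prems show ?case
  proof (rule evaluates_elims(6))
    fix x' y' s'' assume "evaluates p env c (TCons x' y') s''"
    then show ?thesis using ev_If_false.IH(2)[of "TCons x' y'" s''] by simp
  next
    fix s'' t''
    assume "evaluates p env c TNil s''" "evaluates p env b v' t''" "t' = Suc (s'' + t'')"
    then show ?thesis using ev_If_false.IH(2)[of TNil s''] ev_If_false.IH(4)[of v' t''] by simp
  qed
next
  case (ev_Call env es vs s f v t)
  from ev_Call.prems show ?case
  proof (rule evaluates_elims(7))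
    fix vs' s'' t''
    assume "evaluates_list p env es vs' s''" "evaluates p vs' (p ! f) v' t''" "t' = Suc (s'' + t'')"
    then show ?thesis using ev_Call.IH(2)[of vs' s''] ev_Call.IH(5)[of v' t''] by simp
  qed
next
  case (evs_Nil env)
  then show ?case by (auto elim: evaluates_elims(8))
next
  case (evs_Cons env e v s es vs t)
  from evs_Cons.prems show ?case
    by (rule evaluates_elims(9)) (drule evs_Cons.IH(2), drule evs_Cons.IH(4), simp)
qed

text \<open>Function 0 is the entry point.\<close>

definition computes_in_time :: "program \<Rightarrow> tree \<Rightarrow> tree \<Rightarrow> real \<Rightarrow> bool" where
  "computes_in_time p x y T \<longleftrightarrow>
     (\<exists>t. evaluates p [x] (Call 0 [Arg 0]) y t \<and> real t \<le> T)"

section \<open>The list homomorphism problem\<close>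

fun encode_list :: "tree list \<Rightarrow> tree" where
  "encode_list [] = TNil"
| "encode_list (x # xs) = TCons x (encode_list xs)"

fun encode_bool :: "bool \<Rightarrow> tree" where
  "encode_bool False = TNil"
| "encode_bool True = TCons TNil TNil"

definition encode_bits :: "bool list \<Rightarrow> tree" where
  "encode_bits bs = encode_list (map encode_bool bs)"

text \<open>
  An instance of \<open>LHom(H)\<close>. For the purpose of encoding, the vertices of an \<open>n\<close>-vertex input
  graph are numbered \<open>0, \<dots>, n - 1\<close>.
\<close>

definition lhom_instance :: "nat pair_pre_digraph \<Rightarrow> nat pair_pre_digraph \<Rightarrow> (nat \<Rightarrow> nat set) \<Rightarrow> bool" where
  "lhom_instance H G L \<longleftrightarrow>
     pair_graph G \<and> pverts G = {0..<card (pverts G)} \<and> (\<forall>v \<in> pverts G. L v \<subseteq> pverts H)"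

text \<open>
  Each vertex contributes the characteristic vector of its list and its row of the adjacency matrix.
\<close>

definition encode_instance :: "nat pair_pre_digraph \<Rightarrow> nat pair_pre_digraph \<Rightarrow> (nat \<Rightarrow> nat set) \<Rightarrow> tree" where
  "encode_instance H G L =
     encode_list
       (map (\<lambda>v. TCons
                  (encode_bits (map (\<lambda>a. a \<in> L v) (sorted_list_of_set (pverts H))))
                  (encode_bits (map (\<lambda>u. (v, u) \<in> parcs G) (sorted_list_of_set (pverts G)))))
         (sorted_list_of_set (pverts G)))"

text \<open>
  The program \<open>p\<close> solves \<open>LHom(H)\<close> in time \<open>T(n)\<close> on \<open>n\<close>-vertex input graphs satisfying \<open>P\<close>;
  nothing is required of its behaviour on other inputs.
\<close>

definition solves_LHom_in_time ::
  "program \<Rightarrow> nat pair_pre_digraph \<Rightarrow> (nat pair_pre_digraph \<Rightarrow> bool) \<Rightarrow> (nat \<Rightarrow> real) \<Rightarrow> bool" where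
  "solves_LHom_in_time p H P T \<longleftrightarrow>
     (\<forall>G L. lhom_instance H G L \<longrightarrow> P G \<longrightarrow>
        computes_in_time p (encode_instance H G L)
          (encode_bool (\<exists>\<phi>. list_homomorphism G L H \<phi>)) (T (card (pverts G))))"

end

theory Submission
  imports Defs
begin

text \<open>
  Let \<open>m = 2 k + 1\<close>. Call a list good if it is contained in \<open>{c, c + 2, \<dots>, c + 2 k}\<close> for some colour \<open>c\<close>.
  In the coordinate \<open>s\<close> of \<open>c + 2 s\<close>, adjacency of two good lists is preserved by the median of three
  values. Hence, if all lists are arc consistent and good, assigning a vertex any colour that does not
  empty a list after propagation keeps the instance solvable: clamp a solution to the ranges of the
  propagated lists. So instances with good lists are solved greedily in polynomial time.

  A vertex at distance at most \<open>k\<close> from a vertex with a single colour has a good list. If the diameter is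
  at most \<open>k + 2\<close> and \<open>v\<close> has a bad list, then fixing the colours of all vertices within distance \<open>k + 1\<close> of
  \<open>v\<close> in the graph of unfixed vertices leaves every vertex fixed or adjacent to a fixed one, so all lists
  become good.

  Two colours have at most one common neighbour. So when the colour of an unfixed vertex with \<open>c\<close> unfixed
  neighbours is guessed, all choices but one shrink at least \<open>c / 2\<close> lists. Branching on all vertices with
  \<open>c \<ge> d\<close>, where \<open>d\<close> is about \<open>(n log n) powr (1 / (k + 2))\<close>, costs \<open>exp (O (n log n / d))\<close>, and
  afterwards the ball above has at most \<open>d ^ (k + 1)\<close> vertices; both exponents are
  \<open>(n log n) powr ((k + 1) / (k + 2))\<close>.
\<close>

section \<open>Colours of the odd cycle\<close>

text \<open>The exponent comes from a balance. The sum \<open>mu\<close> of all list sizes is at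
  most n m. In a branching step all children but one lose at least about d / 2 of it, so a branch
  contains O (n / d) such losses; each is charged a factor polynomial in n, which gives exp (O (n
  log n / d)). The exceptional child still loses at least 1 because the chosen vertex becomes fixed,
  so long runs of exceptional choices contribute only the linear factor in \<open>leaves\<close>.
  Guessing on the ball costs a factor m + 1 per vertex, hence exp (O (d ^ (k + 1))). The two
  exponents agree when d ^ (k + 2) = n log n.

  The result speaks of a concrete program in a language without arithmetic. For fixed k this is
  harmless: colour operations become tables, the comparison with d becomes a comparison of unary
  powers, and every polynomial cost is measured in powers of one number \<open>N\<close>.\<close>

locale odd_cycle =
  fixes k :: nat
  assumes k_ge_2: "2 \<le> k"
begin

definition m :: nat where "m = 2 * k + 1"

definition cadj :: "nat \<Rightarrow> nat \<Rightarrow> bool" where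
  "cadj i j \<longleftrightarrow> i < m \<and> j < m \<and> (j = Suc i mod m \<or> i = Suc j mod m)"

definition nbs :: "nat set \<Rightarrow> nat set" where
  "nbs S = {j. \<exists>i\<in>S. cadj i j}"

definition good :: "nat set \<Rightarrow> bool" where
  "good S \<longleftrightarrow> (\<exists>c. S \<subseteq> {(c + 2 * s) mod m |s. s \<le> k})"

lemma m_ge: "5 \<le> m" "0 < m"
  using k_ge_2 by (auto simp: m_def)

lemma cadj_sym: "cadj i j \<longleftrightarrow> cadj j i"
  by (auto simp: cadj_def)

lemma cadj_less: "cadj i j \<Longrightarrow> i < m \<and> j < m"
  by (auto simp: cadj_def)

lemma Suc_mod_eq: "i < m \<Longrightarrow> Suc i mod m = (if Suc i = m then 0 else Suc i)"
  by auto

text \<open>Over the integers the wrap-around at \<open>m\<close> becomes a divisibility condition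
  that is linear in both colours, so later changes of coordinates are plain additions.\<close>

lemma dvd_eq_mod_int:
  assumes "i < m" "j < m"
  shows "j = Suc i mod m \<longleftrightarrow> int m dvd int j - int i - 1"
proof -
  have "j = Suc i mod m \<longleftrightarrow> int j mod int m = (int i + 1) mod int m"
    using assms
    by (metis Suc_eq_plus1 mod_less of_nat_1 of_nat_add of_nat_eq_iff zmod_int)
  also have "\<dots> \<longleftrightarrow> int m dvd int j - (int i + 1)"
    by (rule mod_eq_dvd_iff)
  finally show ?thesis by (simp add: algebra_simps)
qed

lemma cadj_iff_dvd:
  "cadj i j \<longleftrightarrow> i < m \<and> j < m \<and> (int m dvd int j - int i - 1 \<or> int m dvd int i - int j - 1)"
  unfolding cadj_def using dvd_eq_mod_int by blast

text \<open>Two colours with two common neighbours would span a four-cycle, which a cycle on at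
  least five vertices does not contain.\<close>

lemma cadj_common_unique:
  assumes "a \<noteq> b" "cadj a x" "cadj b x" "cadj a y" "cadj b y"
  shows "x = y"
  using assms m_ge
  by (auto simp: cadj_def Suc_mod_eq split: if_splits)

lemma good_subset: "good S \<Longrightarrow> T \<subseteq> S \<Longrightarrow> good T"
  unfolding good_def by blast

lemma int_mod_m: "int m dvd int (x mod m) - int x"
  by (metis mod_eq_dvd_iff mod_mod_trivial zmod_int)

lemma eq_mod_mI:
  assumes "x < m" "int m dvd int x - int y"
  shows "x = y mod m"
proof -
  have "int x mod int m = int y mod int m"
    using assms(2) by (simp add: mod_eq_dvd_iff)
  then show ?thesis using assms(1)
    by (metis mod_less of_nat_eq_iff zmod_int)
qed

text \<open>The colours joined to \<open>a\<close> by walks of length \<open>j\<close>: since \<open>- 1 = 2 k\<close> modulo \<open>m\<close>, these are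
  \<open>a - j, a - j + 2, \<dots>, a + j\<close>.\<close>

definition pattern :: "nat \<Rightarrow> nat \<Rightarrow> nat set" where
  "pattern a j = {(a + 2 * k * j + 2 * s) mod m |s. s \<le> j}"

lemma good_pattern: "j \<le> k \<Longrightarrow> good (pattern a j)"
  unfolding good_def pattern_def by (rule exI[of _ "a + 2 * k * j"]) auto

lemma pattern_0: "a < m \<Longrightarrow> pattern a 0 = {a}"
  by (auto simp: pattern_def)

lemma nbs_mono: "S \<subseteq> T \<Longrightarrow> nbs S \<subseteq> nbs T"
  by (auto simp: nbs_def)

text \<open>The base point of the pattern moves by 2 k, which is - 1 modulo \<open>m\<close>. Hence
  a step down keeps \<open>s\<close> and a step up raises it by one; subtracting
  \<open>int m\<close> in both cases brings the step into this form.\<close>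

lemma nbs_pattern: "nbs (pattern a j) \<subseteq> pattern a (Suc j)"
proof
  fix y assume "y \<in> nbs (pattern a j)"
  then obtain s where s: "s \<le> j" and adj: "cadj ((a + 2 * k * j + 2 * s) mod m) y"
    by (auto simp: nbs_def pattern_def)
  define x where "x = a + 2 * k * j + 2 * s"
  have y: "y < m" using adj by (auto simp: cadj_def)
  have mm: "int m dvd int (x mod m) - int x" by (rule int_mod_m)
  from adj have "int m dvd int y - int (x mod m) - 1 \<or> int m dvd int (x mod m) - int y - 1"
    by (simp add: cadj_iff_dvd x_def)
  then show "y \<in> pattern a (Suc j)"
  proof
    assume "int m dvd int y - int (x mod m) - 1"
    then have "int m dvd (int y - int (x mod m) - 1) + (int (x mod m) - int x) - int m"
      by (rule dvd_diff[OF dvd_add[OF _ mm] dvd_refl])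
    then have "int m dvd int y - int (a + 2 * k * Suc j + 2 * Suc s)"
      by (simp add: x_def m_def algebra_simps)
    then have "y = (a + 2 * k * Suc j + 2 * Suc s) mod m" by (rule eq_mod_mI[OF y])
    then show ?thesis unfolding pattern_def using s by blast
  next
    assume "int m dvd int (x mod m) - int y - 1"
    then have "int m dvd - (int (x mod m) - int y - 1) + (int (x mod m) - int x) - int m"
      by (intro dvd_diff[OF dvd_add[OF _ mm] dvd_refl]) (simp only: dvd_minus_iff)
    then have "int m dvd int y - int (a + 2 * k * Suc j + 2 * s)"
      by (simp add: x_def m_def algebra_simps)
    then have "y = (a + 2 * k * Suc j + 2 * s) mod m" by (rule eq_mod_mI[OF y])
    then show ?thesis unfolding pattern_def using s by (auto intro!: exI[of _ s])
  qed
qed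

lemma good_nbs_singleton: "card S \<le> 1 \<Longrightarrow> finite S \<Longrightarrow> S \<subseteq> {..<m} \<Longrightarrow> good (nbs S)"
proof -
  assume S: "card S \<le> 1" "finite S" "S \<subseteq> {..<m}"
  show ?thesis
  proof (cases "S = {}")
    case True
    then show ?thesis by (simp add: nbs_def good_def)
  next
    case False
    with S obtain a where "S = {a}" by (metis card_1_singletonE card_0_eq le_neq_implies_less less_one)
    then show ?thesis
      using nbs_pattern[of a 0] good_pattern[of 1 a] pattern_0[of a] S k_ge_2
      by (auto intro: good_subset)
  qed
qed

lemma good_singleton: "card S \<le> 1 \<Longrightarrow> finite S \<Longrightarrow> S \<subseteq> {..<m} \<Longrightarrow> good S"
  by (metis card_0_eq card_1_singletonE empty_subsetI good_pattern good_subset insert_subset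
      le_neq_implies_less lessThan_iff less_one pattern_0 zero_le order_refl)

section \<open>Coordinates on good lists, and clamping\<close>

lemma offset_exists:
  fixes c d :: int
  obtains \<delta> where "- int k \<le> \<delta>" "\<delta> \<le> int k" "int m dvd d - c + 1 - 2 * \<delta>"
proof -
  \<comment> \<open>Since 2 (k + 1) = m + 1, multiplication by \<open>k + 1\<close> halves modulo
    \<open>m\<close>. One of \<open>z\<close> and \<open>z - m\<close> is the half of
    \<open>d - c + 1\<close> of absolute value at most \<open>k\<close>.\<close>
  define z where "z = ((d - c + 1) * (int k + 1)) mod int m"
  have z: "0 \<le> z" "z < int m" using m_ge by (auto simp: z_def)
  have "int m dvd (d - c + 1) * (int k + 1) - z"
    unfolding z_def by (simp add: dvd_minus_mod)
  then have "int m dvd 2 * ((d - c + 1) * (int k + 1) - z) - int m * (d - c + 1)"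
    by (rule dvd_diff[OF dvd_mult dvd_triv_left])
  moreover have "2 * ((d - c + 1) * (int k + 1) - z) - int m * (d - c + 1) = d - c + 1 - 2 * z"
    by (simp add: m_def algebra_simps)
  ultimately have dz: "int m dvd d - c + 1 - 2 * z" by (simp only:)
  show ?thesis
  proof (cases "z \<le> int k")
    case True
    then show ?thesis using that[of z] z dz by simp
  next
    case False
    have "int m dvd (d - c + 1 - 2 * z) + 2 * int m" using dz by (rule dvd_add) simp
    then have "int m dvd d - c + 1 - 2 * (z - int m)" by (simp add: algebra_simps)
    then show ?thesis using that[of "z - int m"] z False by (simp add: m_def)
  qed
qed

text \<open>The combination m q - k (2 q) = q cancels the 2 modulo the odd number
  \<open>m\<close>.\<close>

lemma m_dvd_double: "int m dvd 2 * q \<longleftrightarrow> int m dvd q"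
proof
  assume "int m dvd 2 * q"
  then have "int m dvd int m * q - int k * (2 * q)" by (rule dvd_diff[OF dvd_triv_left dvd_mult])
  then show "int m dvd q" by (simp add: m_def algebra_simps)
qed simp

text \<open>In the coordinate \<open>s\<close> given by \<open>x = c + 2 s\<close>, adjacency of two arcs of \<open>k + 1\<close> colours becomes
  \<open>r + \<delta> - s \<in> {0, 1}\<close>, except for the wrap-around value \<open>- 2 k\<close>.\<close>

lemma cadj_coordinates:
  assumes \<delta>: "- int k \<le> \<delta>" "\<delta> \<le> int k" "int m dvd int d - int c + 1 - 2 * \<delta>"
    and sr: "s \<le> k" "r \<le> k"
  shows "cadj ((c + 2 * s) mod m) ((d + 2 * r) mod m) \<longleftrightarrow>
    int r + \<delta> - int s \<in> {0, 1, - 2 * int k}"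
proof -
  define q where "q = int r + \<delta> - int s"
  define x y where "x = (c + 2 * s) mod m" and "y = (d + 2 * r) mod m"
  have xy: "int m dvd int x - int (c + 2 * s)" "int m dvd int y - int (d + 2 * r)"
    unfolding x_def y_def by (rule int_mod_m)+
  have q: "- 2 * int k \<le> q" "q \<le> 2 * int k" using \<delta> sr by (auto simp: q_def)
  have 1: "int m dvd (int y - int x - 1) - 2 * (q - 1)"
  proof -
    have "(int y - int x - 1) - 2 * (q - 1) =
      (int y - int (d + 2 * r)) - (int x - int (c + 2 * s)) + (int d - int c + 1 - 2 * \<delta>)"
      by (simp add: q_def)
    then show ?thesis using xy \<delta>(3) by (metis dvd_add dvd_diff)
  qed
  have 2: "int m dvd (int x - int y - 1) - 2 * (- q)"
  proof -
    have "(int x - int y - 1) - 2 * (- q) =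
      (int x - int (c + 2 * s)) - (int y - int (d + 2 * r)) - (int d - int c + 1 - 2 * \<delta>)"
      by (simp add: q_def)
    then show ?thesis using xy \<delta>(3) by (metis dvd_diff)
  qed
  have "int m dvd int y - int x - 1 \<longleftrightarrow> int m dvd 2 * (q - 1)"
    using 1 by (metis diff_add_cancel dvd_add_right_iff dvd_add_left_iff)
  also have "\<dots> \<longleftrightarrow> int m dvd q - 1" by (rule m_dvd_double)
  \<comment> \<open>The bounds on \<open>q\<close> leave 0 and - m as the only multiples of
    \<open>m\<close> among the values of \<open>q - 1\<close>, but only 0 among those of
    \<open>q\<close>. So the wrap-around appears at one end only.\<close>
  also have "\<dots> \<longleftrightarrow> q = 1 \<or> q = - 2 * int k"
  proof
    assume "int m dvd q - 1"
    then obtain l where l: "q - 1 = int m * l" by (auto simp: dvd_def)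
    have "l = 0 \<or> l = -1"
    proof (rule ccontr)
      assume "\<not> (l = 0 \<or> l = -1)"
      then have "l \<ge> 1 \<or> l \<le> -2" by linarith
      then have "int m * l \<ge> int m * 1 \<or> int m * l \<le> int m * (-2)"
        by (metis mult_left_mono of_nat_0_le_iff)
      moreover have "int m = 2 * int k + 1" by (simp add: m_def)
      ultimately show False using q l by linarith
    qed
    then show "q = 1 \<or> q = - 2 * int k" using l by (auto simp: m_def)
  next
    assume "q = 1 \<or> q = - 2 * int k"
    then have "q - 1 = 0 \<or> q - 1 = - int m" by (auto simp: m_def)
    then show "int m dvd q - 1" by auto
  qed
  finally have A: "int m dvd int y - int x - 1 \<longleftrightarrow> q = 1 \<or> q = - 2 * int k" .
  have "int m dvd int x - int y - 1 \<longleftrightarrow> int m dvd 2 * (- q)"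
    using 2 by (metis diff_add_cancel dvd_add_right_iff dvd_add_left_iff)
  also have "\<dots> \<longleftrightarrow> int m dvd q" by (simp only: m_dvd_double dvd_minus_iff)
  also have "\<dots> \<longleftrightarrow> q = 0"
  proof
    assume "int m dvd q"
    moreover have "int m = 2 * int k + 1" by (simp add: m_def)
    ultimately show "q = 0" using q dvd_imp_le_int[of q "int m"] by linarith
  qed simp
  finally have B: "int m dvd int x - int y - 1 \<longleftrightarrow> q = 0" .
  have "x < m" "y < m" using m_ge by (auto simp: x_def y_def)
  then show ?thesis
    unfolding cadj_iff_dvd x_def[symmetric] y_def[symmetric] q_def[symmetric] using A B by auto
qed

text \<open>\<open>clamp A x\<close> is the median of \<open>Min A\<close>, \<open>x\<close> and
  \<open>Max A\<close>. The condition r + \<delta> - s \<in> {0, 1} is preserved by componentwise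
  minima and maxima of related pairs, and mutual support relates the two lower ends and the two
  upper ends. The wrap-around value can occur only for \<delta> = - k; then only (0, k) and (k, 0)
  are related, and clamping either keeps a pair or sends it to the only pair available.\<close>

lemma clamp_preserves:
  fixes S T :: "nat set" and \<delta> :: int
  defines "rel \<equiv> \<lambda>s r. int r + \<delta> - int s \<in> {0, 1, - 2 * int k}"
  defines "clamp \<equiv> \<lambda>A x. max (Min A) (min x (Max A))"
  assumes \<delta>: "- int k \<le> \<delta>" "\<delta> \<le> int k"
    and S: "S \<noteq> {}" "S \<subseteq> {..k}" and T: "T \<noteq> {}" "T \<subseteq> {..k}"
    and ST: "\<And>s. s \<in> S \<Longrightarrow> \<exists>r\<in>T. rel s r" and TS: "\<And>r. r \<in> T \<Longrightarrow> \<exists>s\<in>S. rel s r"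
    and sr: "rel s r" "s \<le> k" "r \<le> k"
  shows "rel (clamp S s) (clamp T r)"
proof -
  have fin: "finite S" "finite T" using S T finite_subset by blast+
  have mem: "Min S \<in> S" "Max S \<in> S" "Min T \<in> T" "Max T \<in> T" using fin S T by auto
  have le: "\<And>x. x \<in> S \<Longrightarrow> Min S \<le> x \<and> x \<le> Max S" "\<And>x. x \<in> T \<Longrightarrow> Min T \<le> x \<and> x \<le> Max T"
    using fin by auto
  have bd: "\<And>x. x \<in> S \<Longrightarrow> x \<le> k" "\<And>x. x \<in> T \<Longrightarrow> x \<le> k" using S T by auto
  show ?thesis
  proof (cases "\<delta> = - int k")
    case False
    have rel: "rel s r \<longleftrightarrow> int r + \<delta> - int s \<in> {0, 1}" if "s \<le> k" "r \<le> k" for s r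
      using that False \<delta> by (auto simp: rel_def)
    \<comment> \<open>The partner \<open>r1\<close> of \<open>Min S\<close> bounds the difference
      above by 1, the partner \<open>s1\<close> of \<open>Min T\<close> bounds it below by 0. At the
      upper ends the two bounds exchange roles.\<close>
    have min: "rel (Min S) (Min T)"
    proof -
      obtain r1 where r1: "r1 \<in> T" "rel (Min S) r1" using ST mem by blast
      obtain s1 where s1: "s1 \<in> S" "rel s1 (Min T)" using TS mem by blast
      show ?thesis using r1 s1 mem le[of s1] le(2)[of r1] bd by (auto simp: rel)
    qed
    have max: "rel (Max S) (Max T)"
    proof -
      obtain r1 where r1: "r1 \<in> T" "rel (Max S) r1" using ST mem by blast
      obtain s1 where s1: "s1 \<in> S" "rel s1 (Max T)" using TS mem by blast
      show ?thesis using r1 s1 mem le[of s1] le(2)[of r1] bd by (auto simp: rel)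
    qed
    have "Min S \<le> Max S" "Min T \<le> Max T" "Max S \<le> k" "Max T \<le> k" "Min S \<le> k" "Min T \<le> k"
      using le mem bd by auto
    moreover have "clamp S s \<le> k" "clamp T r \<le> k" using calculation sr by (auto simp: clamp_def)
    ultimately show ?thesis using min max sr by (auto simp: rel clamp_def min_def max_def)
  next
    case True
    have k: "k > 0" using k_ge_2 by simp
    have rel: "rel s r \<longleftrightarrow> (s = 0 \<and> r = k) \<or> (s = k \<and> r = 0)" if "s \<le> k" "r \<le> k" for s r
      using that True by (auto simp: rel_def)
    have S0: "x = 0 \<or> x = k" if "x \<in> S" for x using ST[OF that] that bd by (auto simp: rel)
    have T0: "x = 0 \<or> x = k" if "x \<in> T" for x using TS[OF that] that bd by (auto simp: rel)
    have flip: "0 \<in> S \<longleftrightarrow> k \<in> T" "k \<in> S \<longleftrightarrow> 0 \<in> T"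
      using ST[of 0] TS[of k] ST[of k] TS[of 0] k bd by (auto simp: rel)
    have "S = (if 0 \<in> S then {0} else {}) \<union> (if k \<in> S then {k} else {})" using S0 by auto
    moreover have "T = (if k \<in> S then {0} else {}) \<union> (if 0 \<in> S then {k} else {})"
      using T0 flip by auto
    ultimately consider "S = {0}" "T = {k}" | "S = {k}" "T = {0}" | "S = {0,k}" "T = {0,k}"
      using S(1) by (cases "0 \<in> S"; cases "k \<in> S") auto
    then show ?thesis
      using k sr by cases (auto simp: rel clamp_def)
  qed
qed

end

section \<open>Lists on a graph\<close>

context odd_cycle
begin

lemma coordinate_unique:
  assumes "(c + 2 * s) mod m = (c + 2 * t) mod m" "s \<le> k" "t \<le> k"
  shows "s = t"
proof -
  have "int (c + 2 * s) mod int m = int (c + 2 * t) mod int m"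
    using assms(1) by (metis zmod_int)
  then have "int m dvd 2 * (int s - int t)"
    by (simp add: mod_eq_dvd_iff algebra_simps)
  then have "int m dvd int s - int t" by (simp only: m_dvd_double)
  then show ?thesis
    using assms(2,3) dvd_imp_le_int[of "int s - int t" "int m"] by (cases "s = t") (auto simp: m_def)
qed

end

locale colouring = odd_cycle +
  fixes n :: nat and E :: "nat \<Rightarrow> nat \<Rightarrow> bool"
  assumes E_sym: "E u v \<Longrightarrow> E v u" and E_less: "E u v \<Longrightarrow> u < n"
begin

lemma E_less2: "E u v \<Longrightarrow> v < n"
  using E_sym E_less by blast

definition hom :: "(nat \<Rightarrow> nat set) \<Rightarrow> (nat \<Rightarrow> nat) \<Rightarrow> bool" where
  "hom L \<phi> \<longleftrightarrow> (\<forall>v<n. \<phi> v \<in> L v) \<and> (\<forall>u v. E u v \<longrightarrow> cadj (\<phi> u) (\<phi> v))"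

definition wfl :: "(nat \<Rightarrow> nat set) \<Rightarrow> bool" where
  "wfl L \<longleftrightarrow> (\<forall>v<n. L v \<subseteq> {..<m})"

definition ac :: "(nat \<Rightarrow> nat set) \<Rightarrow> bool" where
  "ac L \<longleftrightarrow> (\<forall>u v. E u v \<longrightarrow> L v \<subseteq> nbs (L u))"

definition sub :: "(nat \<Rightarrow> nat set) \<Rightarrow> (nat \<Rightarrow> nat set) \<Rightarrow> bool" where
  "sub L' L \<longleftrightarrow> (\<forall>v<n. L' v \<subseteq> L v)"

text \<open>The measure of progress for all three phases: it bounds the number of propagation
  rounds, the depth of the greedy phase and the branching.\<close>

definition mu :: "(nat \<Rightarrow> nat set) \<Rightarrow> nat" where
  "mu L = (\<Sum>v<n. card (L v))"

lemma wfl_finite: "wfl L \<Longrightarrow> v < n \<Longrightarrow> finite (L v)"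
  unfolding wfl_def using finite_subset by blast

lemma sub_card: "sub L' L \<Longrightarrow> wfl L \<Longrightarrow> v < n \<Longrightarrow> card (L' v) \<le> card (L v)"
  by (metis card_mono sub_def wfl_finite)

lemma sub_refl: "sub L L"
  by (simp add: sub_def)

lemma sub_trans: "sub L1 L2 \<Longrightarrow> sub L2 L3 \<Longrightarrow> sub L1 L3"
  by (fastforce simp: sub_def)

lemma sub_wfl: "sub L' L \<Longrightarrow> wfl L \<Longrightarrow> wfl L'"
  by (fastforce simp: sub_def wfl_def)

lemma mu_less:
  assumes "sub L' L" "wfl L" "v < n" "card (L' v) < card (L v)"
  shows "mu L' < mu L"
  unfolding mu_def using assms by (intro sum_strict_mono_ex1) (auto intro: sub_card)

lemma mu_le:
  assumes "wfl L"
  shows "mu L \<le> n * m"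
proof -
  have "card (L v) \<le> m" if "v < n" for v
    using assms that card_mono[of "{..<m}" "L v"] by (auto simp: wfl_def)
  then have "mu L \<le> (\<Sum>v<n. m)" unfolding mu_def by (intro sum_mono) auto
  then show ?thesis by simp
qed

text \<open>\<open>L' v\<close> may have gaps between its extreme coordinates, so the clamped colour
  need not lie in it. But it is either the colour given by \<open>\<phi>\<close> or an extreme
  colour of \<open>L' v\<close>, hence always in \<open>L v\<close>. Where \<open>L' v\<close> has
  one colour, both extremes coincide and force it, which is all that the greedy phase needs.\<close>

lemma extend_by_clamping:
  assumes L: "wfl L" "\<And>v. v < n \<Longrightarrow> good (L v)"
    and L': "sub L' L" "ac L'" "\<And>v. v < n \<Longrightarrow> L' v \<noteq> {}"
    and \<phi>: "hom L \<phi>"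
  shows "\<exists>\<psi>. hom L \<psi> \<and> (\<forall>v<n. card (L' v) = 1 \<longrightarrow> \<psi> v \<in> L' v)"
proof -
  have "\<forall>v. \<exists>c. v < n \<longrightarrow> L v \<subseteq> {(c + 2 * s) mod m |s. s \<le> k}"
    using L(2) unfolding good_def by auto
  from choice[OF this] obtain c
    where c: "\<And>v. v < n \<Longrightarrow> L v \<subseteq> {(c v + 2 * s) mod m |s. s \<le> k}" by blast
  define S where "S v = {s. s \<le> k \<and> (c v + 2 * s) mod m \<in> L' v}" for v
  have S: "S v \<noteq> {}" "S v \<subseteq> {..k}" "finite (S v)" if v: "v < n" for v
  proof -
    obtain x where x: "x \<in> L' v" using L'(3)[OF v] by blast
    then have "x \<in> L v" using L'(1) v by (auto simp: sub_def)
    then show "S v \<noteq> {}" using c[OF v] x by (auto simp: S_def)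
    show "S v \<subseteq> {..k}" by (auto simp: S_def)
    then show "finite (S v)" using finite_subset by blast
  qed
  have "\<forall>v. \<exists>s. v < n \<longrightarrow> s \<le> k \<and> \<phi> v = (c v + 2 * s) mod m"
  proof
    fix v
    show "\<exists>s. v < n \<longrightarrow> s \<le> k \<and> \<phi> v = (c v + 2 * s) mod m"
    proof (cases "v < n")
      case True
      then have "\<phi> v \<in> {(c v + 2 * s) mod m |s. s \<le> k}" using \<phi> c unfolding hom_def by blast
      then show ?thesis by blast
    qed simp
  qed
  from choice[OF this] obtain p
    where p: "\<And>v. v < n \<Longrightarrow> p v \<le> k \<and> \<phi> v = (c v + 2 * p v) mod m" by blast
  define q where "q v = max (Min (S v)) (min (p v) (Max (S v)))" for v
  define \<psi> where "\<psi> v = (c v + 2 * q v) mod m" for v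
  have mm: "Min (S v) \<in> S v" "Max (S v) \<in> S v" if "v < n" for v using S[OF that] by auto
  have in_L: "\<psi> v \<in> L v" if v: "v < n" for v
  proof -
    have "q v = p v \<or> q v \<in> S v"
      using mm[OF v] by (auto simp: q_def max_def min_def)
    then have "\<psi> v = \<phi> v \<or> \<psi> v \<in> L' v"
      using p[OF v] by (auto simp: \<psi>_def S_def)
    then show ?thesis using v \<phi> L'(1) unfolding hom_def sub_def by (metis subsetD)
  qed
  have qk: "q v \<le> k" if "v < n" for v
    using p[OF that] mm[OF that] by (auto simp: q_def S_def)
  have edge: "cadj (\<psi> u) (\<psi> v)" if uv: "E u v" for u v
  proof -
    have u: "u < n" and v: "v < n" using uv E_less E_less2 by auto
    obtain \<delta> where \<delta>: "- int k \<le> \<delta>" "\<delta> \<le> int k" "int m dvd int (c v) - int (c u) + 1 - 2 * \<delta>"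
      using offset_exists by blast
    note co = cadj_coordinates[OF \<delta>]
    have 1: "\<exists>r\<in>S v. int r + \<delta> - int s \<in> {0, 1, - 2 * int k}" if s: "s \<in> S u" for s
    proof -
      have "(c u + 2 * s) mod m \<in> nbs (L' v)"
        using s L'(2) E_sym[OF uv] by (auto simp: ac_def S_def)
      then obtain y where y: "y \<in> L' v" "cadj ((c u + 2 * s) mod m) y"
        by (auto simp: nbs_def cadj_sym)
      then obtain r where r: "r \<le> k" "y = (c v + 2 * r) mod m"
        using c[OF v] L'(1) v by (fastforce simp: sub_def)
      then show ?thesis using co[of s r] y s by (auto simp: S_def)
    qed
    have 2: "\<exists>s\<in>S u. int r + \<delta> - int s \<in> {0, 1, - 2 * int k}" if r: "r \<in> S v" for r
    proof -
      have "(c v + 2 * r) mod m \<in> nbs (L' u)"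
        using r L'(2) uv by (auto simp: ac_def S_def)
      then obtain y where y: "y \<in> L' u" "cadj y ((c v + 2 * r) mod m)"
        by (auto simp: nbs_def)
      then obtain s where s: "s \<le> k" "y = (c u + 2 * s) mod m"
        using c[OF u] L'(1) u by (fastforce simp: sub_def)
      then show ?thesis using co[of s r] y r by (auto simp: S_def)
    qed
    have 3: "int (p v) + \<delta> - int (p u) \<in> {0, 1, - 2 * int k}"
    proof -
      have "cadj (\<phi> u) (\<phi> v)" using \<phi> uv by (simp add: hom_def)
      then have "cadj ((c u + 2 * p u) mod m) ((c v + 2 * p v) mod m)"
        by (simp only: conjunct2[OF p[OF u]] conjunct2[OF p[OF v]])
      then show ?thesis
        by (rule iffD1[OF co[OF conjunct1[OF p[OF u]] conjunct1[OF p[OF v]]]])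
    qed
    have "int (q v) + \<delta> - int (q u) \<in> {0, 1, - 2 * int k}"
      unfolding q_def
      by (rule clamp_preserves[OF \<delta>(1,2)]) (use S u v 1 2 3 p in auto)
    then show ?thesis unfolding \<psi>_def using co[of "q u" "q v"] qk[OF u] qk[OF v] by blast
  qed
  have "\<psi> v \<in> L' v" if v: "v < n" and "card (L' v) = 1" for v
  proof -
    obtain x where x: "L' v = {x}" using \<open>card (L' v) = 1\<close> card_1_singletonE by blast
    have "Min (S v) = Max (S v)"
      by (rule coordinate_unique[of "c v"]) (use mm[OF v] x in \<open>simp_all add: S_def\<close>)
    then have "q v = Max (S v)" by (auto simp: q_def)
    then show ?thesis using mm[OF v] by (auto simp: \<psi>_def S_def)
  qed
  then show ?thesis using in_L edge unfolding hom_def by blast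
qed

section \<open>Balls in the graph of unfixed vertices\<close>

definition bstep :: "(nat \<Rightarrow> nat set) \<Rightarrow> nat set \<Rightarrow> nat set" where
  "bstep L B = {v. v < n \<and> 2 \<le> card (L v) \<and> (v \<in> B \<or> (\<exists>u\<in>B. E v u))}"

lemma mem_bstep: "v \<in> bstep L B \<longleftrightarrow> v < n \<and> 2 \<le> card (L v) \<and> (v \<in> B \<or> (\<exists>u\<in>B. E v u))"
  by (simp add: bstep_def)

text \<open>Distances among unfixed vertices may exceed those bounded by \<open>diam\<close>. A walk
  of length at most k + 2 from \<open>v0\<close> nevertheless stays in the ball up to index k: a
  vertex with at most one colour there would make the list of \<open>v0\<close> good. At index k + 1
  the walk is in the ball or meets a fixed vertex, so at most one colour is left there in
  \<open>L'\<close>. The vertex \<open>u\<close> lies on this part of the walk or comes right after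
  it.\<close>

lemma good_of_fixed_ball:
  assumes L: "wfl L" "ac L" and v0: "v0 < n" "\<not> good (L v0)"
    and diam: "\<And>u. u < n \<Longrightarrow> \<exists>l\<le>k + 2. (E ^^ l) v0 u"
    and L': "sub L' L" "ac L'"
    and ball: "\<And>v. v \<in> (bstep L ^^ (k + 1)) {v0} \<Longrightarrow> card (L' v) \<le> 1"
    and u: "u < n"
  shows "good (L' u)"
proof -
  have L'wf: "wfl L'" using L' L sub_wfl by blast
  have small: "good (L' v)" "good (nbs (L' v))" if "v < n" "card (L' v) \<le> 1" for v
    using that good_singleton good_nbs_singleton wfl_finite[OF L'wf] L'wf by (auto simp: wfl_def)
  obtain l where l: "l \<le> k + 2" "(E ^^ l) v0 u" using diam[OF u] by blast
  then obtain f where f: "f 0 = v0" "f l = u" "\<And>i. i < l \<Longrightarrow> E (f i) (f (Suc i))"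
    unfolding relpowp_fun_conv by blast
  have fn: "f i < n" if "i \<le> l" for i
    using f u v0 E_less that by (metis le_neq_implies_less)
  have far: "2 \<le> card (L (f i))" if i: "i \<le> l" "i \<le> k" for i
  proof (rule ccontr)
    assume "\<not> 2 \<le> card (L (f i))"
    then have "card (L (f i)) = 0 \<or> card (L (f i)) = 1" by linarith
    then have "L (f i) = {} \<or> (\<exists>a. L (f i) = {a})"
      using wfl_finite[OF L(1) fn[OF i(1)]] by (auto simp: card_1_singleton_iff)
    then have "\<exists>a. L (f i) \<subseteq> pattern a 0"
      using pattern_0 L(1) fn[OF i(1)] unfolding wfl_def
      by (metis empty_subsetI insert_subset lessThan_iff subset_refl)
    then obtain a where a: "L (f i) \<subseteq> pattern a 0" by blast
    \<comment> \<open>Arc consistency carries the single colour back towards \<open>v0\<close>; each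
      edge of the walk advances the pattern by one step.\<close>
    have "L (f (i - j)) \<subseteq> pattern a j" if "j \<le> i" for j
      using that
    proof (induction j)
      case 0
      then show ?case using a by simp
    next
      case (Suc j)
      then have "E (f (i - Suc j)) (f (i - j))"
        using f(3)[of "i - Suc j"] i by (simp add: Suc_diff_Suc)
      then have "L (f (i - Suc j)) \<subseteq> nbs (L (f (i - j)))"
        using L(2) E_sym unfolding ac_def by blast
      then show ?case using Suc nbs_mono nbs_pattern by (meson Suc_leD order_trans)
    qed
    from this[of i] have "L v0 \<subseteq> pattern a i" using f by simp
    then show False using v0 good_pattern[OF i(2)] good_subset by blast
  qed
  have in_ball: "f i \<in> (bstep L ^^ t) {v0}"
    if "i \<le> t" "i \<le> l" "\<And>j. j \<le> i \<Longrightarrow> 2 \<le> card (L (f j))" for i t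
    using that
  proof (induction t arbitrary: i)
    case 0
    then show ?case using f by simp
  next
    case (Suc t)
    show ?case
    proof (cases "i \<le> t")
      case True
      then have "f i \<in> (bstep L ^^ t) {v0}" using Suc by blast
      then show ?thesis using Suc.prems fn by (auto simp: mem_bstep)
    next
      case False
      with Suc.prems have i: "i = Suc t" by simp
      have "f t \<in> (bstep L ^^ t) {v0}" using Suc i by auto
      moreover have "E (f i) (f t)" using f(3)[of t] Suc.prems i E_sym by auto
      ultimately show ?thesis using Suc.prems fn by (auto simp: mem_bstep)
    qed
  qed
  have last: "card (L' (f i)) \<le> 1" if i: "i \<le> l" "i \<le> k + 1" for i
  proof (cases "2 \<le> card (L (f i))")
    case True
    have "2 \<le> card (L (f j))" if "j \<le> i" for j
      using True far[of j] i that by (cases "j = i") auto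
    then show ?thesis using in_ball[of i "k + 1"] ball i by blast
  next
    case False
    then show ?thesis using sub_card[OF L'(1) L(1) fn[OF i(1)]] by linarith
  qed
  show ?thesis
  proof (cases "l \<le> k + 1")
    case True
    then show ?thesis using last[of l] small u f by auto
  next
    case False
    with l have l2: "l = Suc (k + 1)" by simp
    then have "E (f (k + 1)) u" using f(3)[of "k + 1"] f(2) by simp
    then have "L' u \<subseteq> nbs (L' (f (k + 1)))" using L'(2) unfolding ac_def by blast
    then show ?thesis using last[of "k + 1"] small(2)[of "f (k + 1)"] fn[of "k + 1"] l2 good_subset by auto
  qed
qed

text \<open>The strict degree bound leaves room for \<open>u\<close> itself, so the factor is
  \<open>e\<close> and not \<open>e + 1\<close>.\<close>

lemma card_bstep:
  assumes B: "finite B" and deg: "\<And>u. u \<in> B \<Longrightarrow> card {v. E u v \<and> 2 \<le> card (L v)} < e"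
  shows "card (bstep L B) \<le> e * card B"
proof -
  have fin: "finite {v. E u v \<and> 2 \<le> card (L v)}" for u
    by (rule finite_subset[of _ "{..<n}"]) (auto dest: E_less2)
  have "bstep L B \<subseteq> (\<Union>u\<in>B. insert u {v. E u v \<and> 2 \<le> card (L v)})"
    using E_sym by (fastforce simp: mem_bstep)
  then have "card (bstep L B) \<le> card (\<Union>u\<in>B. insert u {v. E u v \<and> 2 \<le> card (L v)})"
    using B fin by (intro card_mono) auto
  also have "\<dots> \<le> (\<Sum>u\<in>B. card (insert u {v. E u v \<and> 2 \<le> card (L v)}))"
    by (rule card_UN_le[OF B])
  also have "\<dots> \<le> (\<Sum>u\<in>B. e)"
    by (intro sum_mono order_trans[OF card_insert_le_m1]) (use deg in force)+
  finally show ?thesis by (simp add: mult.commute)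
qed

lemma card_ball:
  assumes "v0 < n" "2 \<le> card (L v0)"
    and deg: "\<And>u. u < n \<Longrightarrow> 2 \<le> card (L u) \<Longrightarrow> card {v. E u v \<and> 2 \<le> card (L v)} < e"
  shows "card ((bstep L ^^ i) {v0}) \<le> e ^ i"
proof (induction i)
  case 0
  then show ?case by simp
next
  case (Suc i)
  have sub: "(bstep L ^^ i) {v0} \<subseteq> {v. v < n \<and> 2 \<le> card (L v)}"
    using assms by (cases i) (auto simp: mem_bstep)
  then have "finite ((bstep L ^^ i) {v0})" by (rule finite_subset) simp
  then have "card ((bstep L ^^ Suc i) {v0}) \<le> e * card ((bstep L ^^ i) {v0})"
    using sub deg by (auto intro!: card_bstep)
  then show ?case using Suc by (simp add: mult_le_mono2 le_trans)
qed

text \<open>If neither branch shrank the list of an unfixed neighbour \<open>u\<close>, all colours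
  of \<open>L u\<close> would be common neighbours of \<open>a\<close> and \<open>b\<close>, and
  there is at most one of those. So each such \<open>u\<close> costs at least one of the two
  branches a colour. Applied to every pair of branches, this shows that all but one lose at least
  half of the degree.\<close>

lemma two_branches_mu:
  assumes L: "wfl L" and ab: "a \<noteq> b"
    and La: "sub La L" "ac La" "La v \<subseteq> {a}" and Lb: "sub Lb L" "ac Lb" "Lb v \<subseteq> {b}"
  shows "mu La + mu Lb + card {u. E v u \<and> 2 \<le> card (L u)} \<le> 2 * mu L"
proof -
  define D where "D = {u. E v u \<and> 2 \<le> card (L u)}"
  have D: "D \<subseteq> {..<n}" by (auto simp: D_def dest: E_less2)
  have "card (La u) + card (Lb u) + (if u \<in> D then 1 else 0) \<le> 2 * card (L u)" if u: "u < n" for u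
  proof (cases "u \<in> D")
    case False
    then show ?thesis using sub_card[OF La(1) L u] sub_card[OF Lb(1) L u] by simp
  next
    case True
    have "\<not> (L u \<subseteq> La u \<and> L u \<subseteq> Lb u)"
    proof
      assume *: "L u \<subseteq> La u \<and> L u \<subseteq> Lb u"
      have uv: "E v u" "2 \<le> card (L u)" using True by (auto simp: D_def)
      then have "L u \<subseteq> nbs {a}" "L u \<subseteq> nbs {b}"
        using * La Lb nbs_mono unfolding ac_def by (meson order_trans)+
      then have "\<And>x y. x \<in> L u \<Longrightarrow> y \<in> L u \<Longrightarrow> x = y"
        using cadj_common_unique[OF ab] by (auto simp: nbs_def subset_iff)
      then have "card (L u) \<le> 1" using card_le_Suc0_iff_eq[OF wfl_finite[OF L u]] by simp
      then show False using uv by simp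
    qed
    then have "card (La u) < card (L u) \<or> card (Lb u) < card (L u)"
      using La(1) Lb(1) u wfl_finite[OF L u] unfolding sub_def
      by (metis psubset_card_mono psubsetI subset_refl)
    then show ?thesis using sub_card[OF La(1) L u] sub_card[OF Lb(1) L u] True by auto
  qed
  then have "(\<Sum>u<n. card (La u) + card (Lb u) + (if u \<in> D then 1 else 0)) \<le> (\<Sum>u<n. 2 * card (L u))"
    by (intro sum_mono) auto
  moreover have "(\<Sum>u<n. (if u \<in> D then 1 else 0)) = card D"
    using D by (simp add: sum.If_cases Int_absorb1 inf.absorb2)
  ultimately show ?thesis
    by (simp add: mu_def sum.distrib sum_distrib_left D_def[symmetric])
qed

end

section \<open>Cost of program expressions\<close>

text \<open>A weakest precondition for total correctness whose postcondition also receives the exact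
  cost. The equations \<open>wp_simps\<close> execute a function body symbolically.\<close>

definition wp :: "program \<Rightarrow> tree list \<Rightarrow> expr \<Rightarrow> (tree \<Rightarrow> nat \<Rightarrow> bool) \<Rightarrow> bool" where
  "wp p env e Q \<longleftrightarrow> (\<exists>v t. evaluates p env e v t \<and> Q v t)"

definition wps :: "program \<Rightarrow> tree list \<Rightarrow> expr list \<Rightarrow> (tree list \<Rightarrow> nat \<Rightarrow> bool) \<Rightarrow> bool" where
  "wps p env es Q \<longleftrightarrow> (\<exists>vs t. evaluates_list p env es vs t \<and> Q vs t)"

text \<open>Opaque to \<open>wp_simps\<close>: symbolic execution stops at a function call, where
  \<open>runs_call\<close> brings in a lemma about the callee or an induction hypothesis.\<close>

definition call :: "program \<Rightarrow> nat \<Rightarrow> tree list \<Rightarrow> (tree \<Rightarrow> nat \<Rightarrow> bool) \<Rightarrow> bool" where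
  "call p f vs Q \<longleftrightarrow> f < length p \<and> wp p vs (p ! f) Q"

definition runs :: "program \<Rightarrow> nat \<Rightarrow> tree list \<Rightarrow> tree \<Rightarrow> nat \<Rightarrow> bool" where
  "runs p f vs v T \<longleftrightarrow> call p f vs (\<lambda>w t. w = v \<and> t \<le> T)"

lemma wp_Arg: "wp p env (Arg i) Q \<longleftrightarrow> i < length env \<and> Q (env ! i) 1"
  unfolding wp_def by (rule iffI) (force elim: evaluates_elims, blast intro: ev_Arg)

lemma wp_Nil: "wp p env Nil_Expr Q \<longleftrightarrow> Q TNil 1"
  unfolding wp_def by (rule iffI) (force elim: evaluates_elims, blast intro: ev_Nil)

lemma wp_Cons: "wp p env (Cons_Expr a b) Q \<longleftrightarrow>
    wp p env a (\<lambda>u s. wp p env b (\<lambda>v t. Q (TCons u v) (s + t + 1)))"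
  unfolding wp_def by (rule iffI) (force elim: evaluates_elims, blast intro: ev_Cons)

lemma wp_Hd: "wp p env (Hd a) Q \<longleftrightarrow> wp p env a (\<lambda>v t. Q (tree_hd v) (t + 1))"
  unfolding wp_def by (rule iffI) (force elim: evaluates_elims, blast intro: ev_Hd)

lemma wp_Tl: "wp p env (Tl a) Q \<longleftrightarrow> wp p env a (\<lambda>v t. Q (tree_tl v) (t + 1))"
  unfolding wp_def by (rule iffI) (force elim: evaluates_elims, blast intro: ev_Tl)

lemma wp_If: "wp p env (If_Expr c a b) Q \<longleftrightarrow>
    wp p env c (\<lambda>u s. if u = TNil then wp p env b (\<lambda>v t. Q v (s + t + 1))
                          else wp p env a (\<lambda>v t. Q v (s + t + 1)))"
proof
  assume "wp p env (If_Expr c a b) Q"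
  then show "wp p env c (\<lambda>u s. if u = TNil then wp p env b (\<lambda>v t. Q v (s + t + 1))
                          else wp p env a (\<lambda>v t. Q v (s + t + 1)))"
    unfolding wp_def
  proof (elim exE conjE)
    fix v t assume ev: "evaluates p env (If_Expr c a b) v t" and Q: "Q v t"
    from ev show "\<exists>u s. evaluates p env c u s \<and>
        (if u = TNil then \<exists>v t. evaluates p env b v t \<and> Q v (s + t + 1)
         else \<exists>v t. evaluates p env a v t \<and> Q v (s + t + 1))"
    proof (rule evaluates_elims(6))
      fix x y s t' assume "t = Suc (s + t')" "evaluates p env c (TCons x y) s" "evaluates p env a v t'"
      then show ?thesis using Q by (intro exI[of _ "TCons x y"] exI[of _ s]) auto
    next
      fix s t' assume "t = Suc (s + t')" "evaluates p env c TNil s" "evaluates p env b v t'"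
      then show ?thesis using Q by (intro exI[of _ TNil] exI[of _ s]) auto
    qed
  qed
next
  assume "wp p env c (\<lambda>u s. if u = TNil then wp p env b (\<lambda>v t. Q v (s + t + 1))
                          else wp p env a (\<lambda>v t. Q v (s + t + 1)))"
  then obtain u s where us: "evaluates p env c u s"
    "if u = TNil then wp p env b (\<lambda>v t. Q v (s + t + 1)) else wp p env a (\<lambda>v t. Q v (s + t + 1))"
    unfolding wp_def by blast
  then show "wp p env (If_Expr c a b) Q"
    unfolding wp_def
    by (cases u) (simp_all only: simp_thms if_True if_False tree.distinct, blast intro: ev_If_false, blast intro: ev_If_true)
qed

lemma wps_Nil: "wps p env [] Q \<longleftrightarrow> Q [] 0"
  by (auto simp: wps_def elim: evaluates_elims intro: evs_Nil)

lemma wps_Cons: "wps p env (e # es) Q \<longleftrightarrow>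
    wp p env e (\<lambda>v s. wps p env es (\<lambda>vs t. Q (v # vs) (s + t)))"
  unfolding wp_def wps_def by (rule iffI) (force elim: evaluates_elims, blast intro: evs_Cons)

lemma wp_Call: "wp p env (Call f es) Q \<longleftrightarrow>
    wps p env es (\<lambda>vs s. call p f vs (\<lambda>v t. Q v (s + t + 1)))"
  unfolding wp_def wps_def call_def
  by (rule iffI) (force elim: evaluates_elims, blast intro: ev_Call)

lemmas wp_simps = wp_Arg wp_Nil wp_Cons wp_Hd wp_Tl wp_If wp_Call wps_Nil wps_Cons

lemma wp_mono: "wp p env e Q \<Longrightarrow> (\<And>v t. Q v t \<Longrightarrow> Q' v t) \<Longrightarrow> wp p env e Q'"
  by (auto simp: wp_def)

lemma runs_call: "runs p f vs v T \<Longrightarrow> (\<And>t. t \<le> T \<Longrightarrow> Q v t) \<Longrightarrow> call p f vs Q"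
  unfolding runs_def call_def by (auto intro: wp_mono)

lemma runs_mono: "runs p f vs v T \<Longrightarrow> T \<le> T' \<Longrightarrow> runs p f vs v T'"
  unfolding runs_def call_def by (auto intro: wp_mono)

lemma runsI:
  "p ! f = e \<Longrightarrow> f < length p \<Longrightarrow> wp p vs e (\<lambda>w t. w = v \<and> t \<le> T) \<Longrightarrow> runs p f vs v T"
  by (simp add: runs_def call_def)

text \<open>\<open>F\<close> is a HOL function evaluated while the expression is built, so any
  function of finitely many bits can be tabulated. The expression is exponentially large in the
  number of tests, but an evaluation follows a single path.\<close>

fun decision_tree :: "expr list \<Rightarrow> (bool list \<Rightarrow> expr) \<Rightarrow> expr" where
  "decision_tree [] F = F []"
| "decision_tree (e # es) F =
     If_Expr e (decision_tree es (\<lambda>bs. F (True # bs))) (decision_tree es (\<lambda>bs. F (False # bs)))"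

fun const :: "tree \<Rightarrow> expr" where
  "const TNil = Nil_Expr"
| "const (TCons x y) = Cons_Expr (const x) (const y)"

lemma encode_bool_eq_TNil [simp]: "encode_bool b = TNil \<longleftrightarrow> \<not> b"
  by (cases b) auto

lemma wp_const: "wp p env (const t) Q \<longleftrightarrow> Q t (2 * size t + 1)"
  by (induction t arbitrary: Q) (simp_all add: wp_simps algebra_simps)

lemma wp_decision_tree:
  assumes "list_all2 (\<lambda>e b. wp p env e (\<lambda>v t. v = encode_bool b \<and> t \<le> c)) es bs"
    and "\<And>t. t \<le> length es * (c + 1) \<Longrightarrow> wp p env (F bs) (\<lambda>v s. Q v (t + s))"
  shows "wp p env (decision_tree es F) Q"
  using assms
proof (induction arbitrary: F Q rule: list_all2_induct)
  case Nil
  then show ?case by simp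
next
  case (Cons e es b bs)
  have "wp p env (if b then decision_tree es (\<lambda>bs. F (True # bs)) else decision_tree es (\<lambda>bs. F (False # bs)))
      (\<lambda>v s. Q v (t + s + 1))" if "t \<le> c" for t
  proof -
    have "wp p env (decision_tree es (\<lambda>bs. F (b # bs))) (\<lambda>v s. Q v (t + s + 1))"
    proof (rule Cons.IH)
      fix t' assume "t' \<le> length es * (c + 1)"
      then have "t + t' + 1 \<le> length (e # es) * (c + 1)" using that by simp
      from Cons.prems[OF this] show "wp p env (F (b # bs)) (\<lambda>v s. Q v (t + (t' + s) + 1))"
        by (simp add: algebra_simps)
    qed
    then show ?thesis by (cases b) auto
  qed
  then show ?case
    unfolding decision_tree.simps wp_If
    by (intro wp_mono[OF Cons.hyps(1)]) (cases b; auto)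
qed

lemma tree_hd_encode_bits_drop:
  "i < length bs \<Longrightarrow> tree_hd ((tree_tl ^^ i) (encode_bits bs)) = encode_bool (bs ! i)"
proof (induction i arbitrary: bs)
  case 0
  then show ?case by (cases bs) (auto simp: encode_bits_def)
next
  case (Suc i)
  then obtain b bs' where "bs = b # bs'" by (cases bs) auto
  with Suc show ?case
    by (simp add: encode_bits_def funpow_Suc_right del: funpow.simps)
qed

lemma wp_Tl_pow: "wp p env ((Tl ^^ i) e) Q \<longleftrightarrow> wp p env e (\<lambda>v t. Q ((tree_tl ^^ i) v) (t + i))"
  by (induction i arbitrary: Q) (simp_all add: wp_Tl algebra_simps)

definition bits_of :: "nat \<Rightarrow> nat \<Rightarrow> expr list" where
  "bits_of m j = map (\<lambda>i. Hd ((Tl ^^ i) (Arg j))) [0..<m]"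

lemma bits_of_all2:
  assumes "j < length env" "env ! j = encode_bits bs" "length bs = m"
  shows "list_all2 (\<lambda>e b. wp p env e (\<lambda>v t. v = encode_bool b \<and> t \<le> m + 2)) (bits_of m j) bs"
  unfolding bits_of_def list_all2_conv_all_nth using assms
  by (auto simp: wp_Hd wp_Tl_pow wp_Arg tree_hd_encode_bits_drop)

lemma size_encode_bits: "size (encode_bits bs) \<le> 2 * length bs"
proof (induction bs)
  case (Cons b bs)
  then show ?case by (cases b) (auto simp: encode_bits_def)
qed (simp add: encode_bits_def)

text \<open>At most \<open>2 * m\<close> tests cost \<open>m + 3\<close> steps each, branching
  included. A result of size at most \<open>2 * m + 1\<close> is written in at most
  \<open>4 * m + 3\<close> steps.\<close>

definition table_cost :: "nat \<Rightarrow> nat" where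
  "table_cost m = 2 * m * (m + 3) + 4 * m + 3"

lemma wp_table1:
  assumes "length bs = m" "size (F bs) \<le> 2 * m + 1"
  shows "wp p [encode_bits bs] (decision_tree (bits_of m 0) (\<lambda>bs. const (F bs)))
      (\<lambda>w t. w = F bs \<and> t \<le> table_cost m)"
  using assms
  by (intro wp_decision_tree[OF bits_of_all2]) (auto simp: wp_const bits_of_def table_cost_def algebra_simps)

lemma wp_table2:
  assumes "length bs = m" "length cs = m" "size (F bs cs) \<le> 2 * m + 1"
  shows "wp p [encode_bits bs, encode_bits cs]
      (decision_tree (bits_of m 0 @ bits_of m 1) (\<lambda>ds. const (F (take m ds) (drop m ds))))
      (\<lambda>w t. w = F bs cs \<and> t \<le> table_cost m)"
  using assms
  by (intro wp_decision_tree[OF list_all2_appendI[OF bits_of_all2[of 0 _ bs] bits_of_all2[of 1 _ cs]]])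
    (auto simp: wp_const bits_of_def table_cost_def algebra_simps)

lemma size_encode_bool: "size (encode_bool b) \<le> 1"
  by (cases b) auto

fun or_chain :: "expr list \<Rightarrow> expr" where
  "or_chain [] = Nil_Expr"
| "or_chain (e # es) = If_Expr e (const (encode_bool True)) (or_chain es)"

lemma wp_or_chain:
  assumes "\<And>i. i < length es \<Longrightarrow> wp p env (es ! i) (\<lambda>v t. v = encode_bool (P i) \<and> t \<le> T i)"
  shows "wp p env (or_chain es)
    (\<lambda>v t. v = encode_bool (\<exists>i<length es. P i) \<and> t \<le> (\<Sum>i<length es. T i) + 4 * length es + 1)"
  using assms
proof (induction es arbitrary: P T)
  case Nil
  then show ?case by (simp add: wp_simps)
next
  case (Cons e es)
  have 1: "wp p env e (\<lambda>v t. v = encode_bool (P 0) \<and> t \<le> T 0)" using Cons.prems[of 0] by simp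
  have 2: "wp p env (or_chain es) (\<lambda>v t. v = encode_bool (\<exists>i<length es. P (Suc i)) \<and>
      t \<le> (\<Sum>i<length es. T (Suc i)) + 4 * length es + 1)"
    using Cons.prems[of "Suc _"] by (intro Cons.IH) simp
  have ex: "(\<exists>i<length (e # es). P i) \<longleftrightarrow> P 0 \<or> (\<exists>i<length es. P (Suc i))"
    by (auto simp: less_Suc_eq_0_disj)
  have sum: "(\<Sum>i<length (e # es). T i) = T 0 + (\<Sum>i<length es. T (Suc i))"
    unfolding list.size add_Suc_right add_0_right sum.lessThan_Suc_shift ..
  show ?case unfolding or_chain.simps wp_If
  proof (rule wp_mono[OF 1])
    fix v t assume vt: "v = encode_bool (P 0) \<and> t \<le> T 0"
    show "if v = TNil
        then wp p env (or_chain es) (\<lambda>v s. v = encode_bool (\<exists>i<length (e # es). P i) \<and>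
            t + s + 1 \<le> (\<Sum>i<length (e # es). T i) + 4 * length (e # es) + 1)
        else wp p env (const (encode_bool True)) (\<lambda>v s. v = encode_bool (\<exists>i<length (e # es). P i) \<and>
            t + s + 1 \<le> (\<Sum>i<length (e # es). T i) + 4 * length (e # es) + 1)"
    proof (cases "P 0")
      case True
      then show ?thesis using vt unfolding ex sum by (simp add: wp_simps)
    next
      case False
      then show ?thesis using vt unfolding ex sum by (auto intro!: wp_mono[OF 2])
    qed
  qed
qed

section \<open>The program\<close>

text \<open>
  Numbers are represented in unary, by the lengths of lists. A position in the list of vertices is
  represented by a list of Booleans whose first true entry has that position. Colour lists are bit
  vectors of fixed length \<open>m\<close>, so every function on them is a finite decision tree.
\<close>

abbreviation (input) "F_main \<equiv> 0 :: nat"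
abbreviation (input) "F_lists \<equiv> 1 :: nat"
abbreviation (input) "F_app \<equiv> 2 :: nat"
abbreviation (input) "F_half \<equiv> 3 :: nat"
abbreviation (input) "F_nlog \<equiv> 4 :: nat"
abbreviation (input) "F_drop \<equiv> 5 :: nat"
abbreviation (input) "F_nb \<equiv> 6 :: nat"
abbreviation (input) "F_and \<equiv> 7 :: nat"
abbreviation (input) "F_unfixed \<equiv> 8 :: nat"
abbreviation (input) "F_empty \<equiv> 9 :: nat"
abbreviation (input) "F_bad \<equiv> 10 :: nat"
abbreviation (input) "F_revise \<equiv> 11 :: nat"
abbreviation (input) "F_sweep \<equiv> 12 :: nat"
abbreviation (input) "F_round \<equiv> 13 :: nat"
abbreviation (input) "F_ac \<equiv> 14 :: nat"
abbreviation (input) "F_count \<equiv> 15 :: nat"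
abbreviation (input) "F_heavy \<equiv> 16 :: nat"
abbreviation (input) "F_anyempty \<equiv> 17 :: nat"
abbreviation (input) "F_marked \<equiv> 18 :: nat"
abbreviation (input) "F_firstbad \<equiv> 19 :: nat"
abbreviation (input) "F_touches \<equiv> 20 :: nat"
abbreviation (input) "F_grow \<equiv> 21 :: nat"
abbreviation (input) "F_ball \<equiv> 22 :: nat"
abbreviation (input) "F_assign \<equiv> 23 :: nat"
abbreviation (input) "F_unmark \<equiv> 24 :: nat"
abbreviation (input) "F_firstunfixed \<equiv> 25 :: nat"
abbreviation (input) "F_branch \<equiv> 26 :: nat"
abbreviation (input) "F_guess \<equiv> 27 :: nat"
abbreviation (input) "F_greedy \<equiv> 28 :: nat"

abbreviation (input) "True_Expr \<equiv> Cons_Expr Nil_Expr Nil_Expr"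

definition "lists_body = If_Expr (Arg 0) (Cons_Expr (Hd (Hd (Arg 0))) (Call F_lists [Tl (Arg 0)])) Nil_Expr"

definition "app_body = If_Expr (Arg 0) (Cons_Expr (Hd (Arg 0)) (Call F_app [Tl (Arg 0), Arg 1])) (Arg 1)"

definition "half_body = If_Expr (Tl (Arg 0)) (Cons_Expr Nil_Expr (Call F_half [Tl (Tl (Arg 0))])) Nil_Expr"

text \<open>Length \<open>n (\<lfloor>log 2 n\<rfloor> + 1)\<close>, the only place where the logarithm is computed.\<close>

definition "nlog_body =
  If_Expr (Arg 1) (Call F_app [Arg 0, Call F_nlog [Arg 0, Call F_half [Arg 1]]]) Nil_Expr"

text \<open>Drops \<open>c ^ j\<close> elements, so that testing the result for nil compares \<open>c ^ (k + 2)\<close> with \<open>n log n\<close>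
  without computing a root.\<close>

definition "drop_body =
  If_Expr (Arg 0)
    (If_Expr (Arg 2)
      (Call F_drop [Arg 0, Arg 1, Tl (Arg 2), Call F_drop [Tl (Arg 0), Arg 1, Arg 1, Arg 3]])
      (Arg 3))
    (Tl (Arg 3))"

definition "revise_body =
  If_Expr (Arg 2)
    (Call F_revise
      [If_Expr (Hd (Arg 1)) (Call F_and [Arg 0, Call F_nb [Hd (Arg 2)]]) (Arg 0), Tl (Arg 1), Tl (Arg 2)])
    (Arg 0)"

definition "sweep_body =
  If_Expr (Arg 1)
    (Cons_Expr (Call F_revise [Hd (Arg 1), Tl (Hd (Arg 0)), Arg 2])
      (Call F_sweep [Tl (Arg 0), Tl (Arg 1), Arg 2]))
    Nil_Expr"

definition "round_body = Call F_sweep [Arg 0, Arg 1, Arg 1]"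

definition "count_body =
  If_Expr (Arg 1)
    (If_Expr (If_Expr (Hd (Arg 0)) (Call F_unfixed [Hd (Arg 1)]) Nil_Expr)
      (Cons_Expr Nil_Expr (Call F_count [Tl (Arg 0), Tl (Arg 1)]))
      (Call F_count [Tl (Arg 0), Tl (Arg 1)]))
    Nil_Expr"

definition "anyempty_body =
  If_Expr (Arg 0) (If_Expr (Call F_empty [Hd (Arg 0)]) True_Expr (Call F_anyempty [Tl (Arg 0)])) Nil_Expr"

definition "marked_body =
  If_Expr (Arg 0) (If_Expr (Hd (Arg 0)) True_Expr (Call F_marked [Tl (Arg 0)])) Nil_Expr"

definition "first_body test self =
  If_Expr (Arg 0)
    (If_Expr (Call test [Hd (Arg 0)]) (Cons_Expr True_Expr Nil_Expr)
      (Cons_Expr Nil_Expr (Call self [Tl (Arg 0)])))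
    Nil_Expr"

definition "touches_body =
  If_Expr (Arg 1)
    (If_Expr (If_Expr (Hd (Arg 1)) (Hd (Arg 0)) Nil_Expr) True_Expr
      (Call F_touches [Tl (Arg 0), Tl (Arg 1)]))
    Nil_Expr"

text \<open>Argument 2 is consumed along with the vertices, while argument 3 keeps the whole set for
  the adjacency test. Mark lists may end early; the head of nil then reads as unmarked.\<close>

definition "grow_body =
  If_Expr (Arg 1)
    (Cons_Expr
      (If_Expr (Call F_unfixed [Hd (Arg 1)])
        (If_Expr (Hd (Arg 2)) True_Expr (Call F_touches [Tl (Hd (Arg 0)), Arg 3]))
        Nil_Expr)
      (Call F_grow [Tl (Arg 0), Tl (Arg 1), Tl (Arg 2), Arg 3]))
    Nil_Expr"

definition "ball_body = Call F_grow [Arg 0, Arg 1, Arg 2, Arg 2]"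

text \<open>Intersecting instead of overwriting turns a colour outside the list into an empty list,
  so all \<open>m\<close> colours can be tried without a membership test.\<close>

definition "assign_body =
  If_Expr (Arg 0)
    (If_Expr (Hd (Arg 0)) (Cons_Expr (Call F_and [Arg 1, Hd (Arg 2)]) (Tl (Arg 2)))
      (Cons_Expr (Hd (Arg 2)) (Call F_assign [Tl (Arg 0), Arg 1, Tl (Arg 2)])))
    (Arg 2)"

definition "unmark_body =
  If_Expr (Arg 0)
    (If_Expr (Hd (Arg 0)) (Cons_Expr Nil_Expr (Tl (Arg 0))) (Cons_Expr Nil_Expr (Call F_unmark [Tl (Arg 0)])))
    Nil_Expr"

definition "main_body =
  Call F_branch [Arg 0, Call F_nlog [Arg 0, Arg 0], Call F_ac [Arg 0, Arg 0, Call F_lists [Arg 0]]]"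

context odd_cycle
begin

definition cset :: "bool list \<Rightarrow> nat set" where "cset x = {i. i < m \<and> x ! i}"

definition nbv :: "bool list \<Rightarrow> bool list" where "nbv x = map (\<lambda>i. i \<in> nbs (cset x)) [0..<m]"

definition andv :: "bool list \<Rightarrow> bool list \<Rightarrow> bool list" where
  "andv x y = map (\<lambda>i. x ! i \<and> y ! i) [0..<m]"

definition unfixed :: "bool list \<Rightarrow> bool" where "unfixed x \<longleftrightarrow> 2 \<le> card (cset x)"

definition "nb_body = decision_tree (bits_of m 0) (\<lambda>bs. const (encode_bits (nbv bs)))"

definition "and_body = decision_tree (bits_of m 0 @ bits_of m 1)
  (\<lambda>bs. const (encode_bits (andv (take m bs) (drop m bs))))"

definition "unfixed_body = decision_tree (bits_of m 0) (\<lambda>bs. const (encode_bool (unfixed bs)))"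

definition "empty_body = decision_tree (bits_of m 0) (\<lambda>bs. const (encode_bool (cset bs = {})))"

definition "bad_body = decision_tree (bits_of m 0) (\<lambda>bs. const (encode_bool (\<not> good (cset bs))))"

text \<open>The n m rounds are obtained without arithmetic: recursion along a list of length n, with
  \<open>m\<close> rounds nested in the text of each call.\<close>

definition "ac_body =
  If_Expr (Arg 0)
    (Call F_ac [Tl (Arg 0), Arg 1, ((\<lambda>e. Call F_round [Arg 1, e]) ^^ m) (Arg 2)])
    (Arg 2)"

definition "exponent_expr = const (encode_list (replicate (k + 2) TNil))"

text \<open>Argument 1 is the suffix still to be scanned, argument 2 the whole list in which
  neighbours are counted. The inner test has its branches exchanged: a vertex is heavy when dropping
  leaves nothing of argument 3.\<close>

definition "heavy_body =
  If_Expr (Arg 1)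
    (If_Expr
      (If_Expr (Call F_unfixed [Hd (Arg 1)])
        (If_Expr (Call F_drop [exponent_expr, Call F_count [Tl (Hd (Arg 0)), Arg 2],
            Call F_count [Tl (Hd (Arg 0)), Arg 2], Arg 3])
          Nil_Expr True_Expr)
        Nil_Expr)
      (Cons_Expr True_Expr Nil_Expr)
      (Cons_Expr Nil_Expr (Call F_heavy [Tl (Arg 0), Tl (Arg 1), Arg 2, Arg 3])))
    Nil_Expr"

definition single :: "nat \<Rightarrow> bool list" where "single a = map (\<lambda>i. i = a) [0..<m]"

definition "child_expr rows marks ls a =
  Call F_ac [rows, rows, Call F_assign [marks, const (encode_bits (single a)), ls]]"

definition "heavy_expr = Call F_heavy [Arg 0, Arg 2, Arg 2, Arg 1]"

text \<open>A bad list is attacked only when no vertex is heavy, because the degree bound is what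
  limits the size of the ball.\<close>

definition "branch_body =
  If_Expr (Call F_anyempty [Arg 2]) Nil_Expr
    (If_Expr (Call F_marked [heavy_expr])
      (or_chain (map (\<lambda>a. Call F_branch [Arg 0, Arg 1, child_expr (Arg 0) heavy_expr (Arg 2) a]) [0..<m]))
      (If_Expr (Call F_marked [Call F_firstbad [Arg 2]])
        (Call F_guess [Arg 0,
           ((\<lambda>e. Call F_ball [Arg 0, Arg 2, e]) ^^ (k + 1)) (Call F_firstbad [Arg 2]), Arg 2])
        (Call F_greedy [Arg 0, Arg 2])))"

definition "guess_body =
  If_Expr (Call F_anyempty [Arg 2]) Nil_Expr
    (If_Expr (Call F_marked [Arg 1])
      (or_chain (map (\<lambda>a. Call F_guess [Arg 0, Call F_unmark [Arg 1], child_expr (Arg 0) (Arg 1) (Arg 2) a]) [0..<m]))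
      (Call F_greedy [Arg 0, Arg 2]))"

definition "greedy_child a = child_expr (Arg 0) (Call F_firstunfixed [Arg 1]) (Arg 1) a"

text \<open>Commits to the first colour whose propagated child has no empty list, without
  backtracking. The child expression occurs twice because the language has no local
  bindings.\<close>

definition greedy_chain :: "nat list \<Rightarrow> expr" where
  "greedy_chain as = foldr (\<lambda>a e.
     If_Expr (Call F_anyempty [greedy_child a]) e (Call F_greedy [Arg 0, greedy_child a])) as Nil_Expr"

definition "greedy_body =
  If_Expr (Call F_marked [Call F_firstunfixed [Arg 1]]) (greedy_chain [0..<m]) True_Expr"

definition prog :: program where
  "prog = [main_body, lists_body, app_body, half_body, nlog_body, drop_body, nb_body, and_body,
     unfixed_body, empty_body, bad_body, revise_body, sweep_body, round_body, ac_body, count_body,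
     heavy_body, anyempty_body, marked_body, first_body F_bad F_firstbad, touches_body, grow_body,
     ball_body, assign_body, unmark_body, first_body F_unfixed F_firstunfixed, branch_body,
     guess_body, greedy_body]"

lemma length_prog: "length prog = 29"
  by (simp add: prog_def)

lemma prog_nth:
  "prog ! F_main = main_body" "prog ! F_lists = lists_body"
  "prog ! F_app = app_body" "prog ! F_half = half_body" "prog ! F_nlog = nlog_body"
  "prog ! F_drop = drop_body" "prog ! F_nb = nb_body" "prog ! F_and = and_body"
  "prog ! F_unfixed = unfixed_body" "prog ! F_empty = empty_body" "prog ! F_bad = bad_body"
  "prog ! F_revise = revise_body" "prog ! F_sweep = sweep_body" "prog ! F_round = round_body"
  "prog ! F_ac = ac_body" "prog ! F_count = count_body" "prog ! F_heavy = heavy_body"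
  "prog ! F_anyempty = anyempty_body" "prog ! F_marked = marked_body"
  "prog ! F_firstbad = first_body F_bad F_firstbad" "prog ! F_touches = touches_body"
  "prog ! F_grow = grow_body" "prog ! F_ball = ball_body" "prog ! F_assign = assign_body"
  "prog ! F_unmark = unmark_body" "prog ! F_firstunfixed = first_body F_unfixed F_firstunfixed"
  "prog ! F_branch = branch_body" "prog ! F_guess = guess_body" "prog ! F_greedy = greedy_body"
  by (simp_all add: prog_def)

abbreviation "wfv x \<equiv> length x = m"

abbreviation "wfvs X \<equiv> \<forall>x\<in>set X. length x = m"

abbreviation encs :: "bool list list \<Rightarrow> tree" where
  "encs X \<equiv> encode_list (map encode_bits X)"

lemma length_nbv [simp]: "length (nbv x) = m" and length_andv [simp]: "length (andv x y) = m"
  and length_single [simp]: "length (single a) = m"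
  by (simp_all add: nbv_def andv_def single_def)

lemma nbs_less: "i \<in> nbs S \<Longrightarrow> i < m"
  by (auto simp: nbs_def dest: cadj_less)

lemma cset_nbv: "cset (nbv x) = nbs (cset x)"
proof -
  have "i \<in> cset (nbv x) \<longleftrightarrow> i < m \<and> i \<in> nbs (cset x)" for i
    unfolding cset_def[of "nbv x"] by (auto simp: nbv_def)
  then show ?thesis using nbs_less by blast
qed

lemma cset_andv: "cset (andv x y) = cset x \<inter> cset y"
  by (auto simp: cset_def andv_def)

lemma cset_single: "cset (single a) = {a} \<inter> {..<m}"
  by (auto simp: cset_def single_def)

lemma cset_subset: "cset x \<subseteq> {..<m}"
  by (auto simp: cset_def)

lemma cset_inj: "wfv x \<Longrightarrow> wfv y \<Longrightarrow> cset x = cset y \<Longrightarrow> x = y"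
  by (rule nth_equalityI) (auto simp: cset_def set_eq_iff)

lemma runs_nb: "wfv x \<Longrightarrow> runs prog F_nb [encode_bits x] (encode_bits (nbv x)) (table_cost m)"
  by (rule runsI[OF prog_nth(7)]) (auto simp: length_prog nb_body_def
    intro!: wp_table1 order_trans[OF size_encode_bits])

lemma runs_and: "wfv x \<Longrightarrow> wfv y \<Longrightarrow>
    runs prog F_and [encode_bits x, encode_bits y] (encode_bits (andv x y)) (table_cost m)"
  by (rule runsI[OF prog_nth(8)]) (auto simp: length_prog and_body_def
    intro!: wp_table2[unfolded One_nat_def] order_trans[OF size_encode_bits])

lemma runs_unfixed: "wfv x \<Longrightarrow> runs prog F_unfixed [encode_bits x] (encode_bool (unfixed x)) (table_cost m)"
  by (rule runsI[OF prog_nth(9)]) (auto simp: length_prog unfixed_body_def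
    intro!: wp_table1 order_trans[OF size_encode_bool])

lemma runs_empty: "wfv x \<Longrightarrow> runs prog F_empty [encode_bits x] (encode_bool (cset x = {})) (table_cost m)"
  by (rule runsI[OF prog_nth(10)]) (auto simp: length_prog empty_body_def
    intro!: wp_table1 order_trans[OF size_encode_bool])

lemma runs_bad: "wfv x \<Longrightarrow> runs prog F_bad [encode_bits x] (encode_bool (\<not> good (cset x))) (table_cost m)"
  by (rule runsI[OF prog_nth(11)]) (auto simp: length_prog bad_body_def
    intro!: wp_table1 order_trans[OF size_encode_bool])

end

section \<open>Running times of the subroutines\<close>

context odd_cycle
begin

fun revise :: "bool list \<Rightarrow> bool list \<Rightarrow> bool list list \<Rightarrow> bool list" where
  "revise x (b # r) (y # L) = revise (if b then andv x (nbv y) else x) r L"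
| "revise x r L = x"

definition sweep :: "bool list list \<Rightarrow> bool list list \<Rightarrow> bool list list \<Rightarrow> bool list list" where
  "sweep R X L = map2 (\<lambda>r x. revise x r L) R X"

definition count :: "bool list \<Rightarrow> bool list list \<Rightarrow> nat" where
  "count r X = length (filter (\<lambda>(b, x). b \<and> unfixed x) (zip r X))"

fun mark_first :: "('a \<Rightarrow> bool) \<Rightarrow> 'a list \<Rightarrow> bool list" where
  "mark_first P [] = []"
| "mark_first P (x # xs) = (if P x then [True] else False # mark_first P xs)"

definition touches :: "bool list \<Rightarrow> bool list \<Rightarrow> bool" where
  "touches r B = list_ex (\<lambda>(b, c). b \<and> c) (zip r B)"

fun grow :: "bool list list \<Rightarrow> bool list list \<Rightarrow> bool list \<Rightarrow> bool list \<Rightarrow> bool list" where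
  "grow (r # R) (x # X) B B0 =
     (unfixed x \<and> (B \<noteq> [] \<and> hd B \<or> touches r B0)) # grow R X (tl B) B0"
| "grow R X B B0 = []"

fun assign :: "bool list \<Rightarrow> bool list \<Rightarrow> bool list list \<Rightarrow> bool list list" where
  "assign (True # V) c (x # X) = andv c x # X"
| "assign (False # V) c (x # X) = x # assign V c X"
| "assign V c X = X"

fun unmark :: "bool list \<Rightarrow> bool list" where
  "unmark [] = []"
| "unmark (True # V) = False # V"
| "unmark (False # V) = False # unmark V"

text \<open>An input entry pairs a colour list with an adjacency row. The lists change during the
  search, so only the tail of the entry is tied to the graph.\<close>

definition row_tree :: "tree \<Rightarrow> bool list \<Rightarrow> bool" where
  "row_tree t r \<longleftrightarrow> tree_tl t = encode_bits r"

end

lemma encode_bits_simps [simp]: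
  "encode_bits [] = TNil" "encode_bits (b # bs) = TCons (encode_bool b) (encode_bits bs)"
  by (simp_all add: encode_bits_def)

lemma encode_list_eq_TNil [simp]: "encode_list xs = TNil \<longleftrightarrow> xs = []"
  by (cases xs) auto

lemma encode_bits_eq_TNil [simp]: "encode_bits xs = TNil \<longleftrightarrow> xs = []"
  by (cases xs) auto

lemma tree_tl_encode_list [simp]: "tree_tl (encode_list xs) = encode_list (tl xs)"
  by (cases xs) auto

lemma tree_tl_encode_bits [simp]: "tree_tl (encode_bits xs) = encode_bits (tl xs)"
  by (cases xs) auto

lemma tree_hd_encode_bits [simp]: "tree_hd (encode_bits xs) = encode_bool (xs \<noteq> [] \<and> hd xs)"
  by (cases xs) auto

text \<open>A common base for all polynomial costs: \<open>N\<close> exceeds the number of vertices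
  by a multiple of the table cost and a constant, so a loop over the vertices costs one further
  power of \<open>N\<close>.\<close>

locale runtime = odd_cycle +
  fixes n N :: nat
  assumes N_ge: "n + 10 * table_cost m + 100 \<le> N"
begin

lemma N_facts: "100 \<le> N" "n + 1 \<le> N" "10 * table_cost m + 100 \<le> N" "n + 100 \<le> N" "m \<le> table_cost m"
  using N_ge by (auto simp: table_cost_def)

lemma runs_lists:
  "runs prog F_lists [encode_list ts] (encode_list (map tree_hd ts)) ((length ts + 1) * N)"
proof (induction ts)
  case Nil
  show ?case using N_facts
    by (intro runsI[OF prog_nth(2)]) (simp_all add: length_prog lists_body_def wp_simps)
next
  case (Cons t ts)
  show ?case using N_facts
    by (intro runsI[OF prog_nth(2)])
      (auto simp: length_prog lists_body_def wp_simps intro!: runs_call[OF Cons[simplified]])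
qed

lemma runs_app:
  "runs prog F_app [encode_list xs, encode_list ys] (encode_list (xs @ ys)) ((length xs + 1) * N)"
proof (induction xs)
  case Nil
  show ?case using N_facts
    by (intro runsI[OF prog_nth(3)]) (simp_all add: length_prog app_body_def wp_simps)
next
  case (Cons t ts)
  show ?case using N_facts
    by (intro runsI[OF prog_nth(3)])
      (auto simp: length_prog app_body_def wp_simps intro!: runs_call[OF Cons[simplified]])
qed

lemma runs_revise:
  assumes "length r = length L" "wfv x" "wfvs L"
  shows "runs prog F_revise [encode_bits x, encode_bits r, encs L] (encode_bits (revise x r L))
      ((length L + 1) * N)"
  using assms
proof (induction r L arbitrary: x rule: list_induct2)
  case Nil
  then show ?case using N_facts
    by (intro runsI[OF prog_nth(12)]) (simp_all add: length_prog revise_body_def wp_simps)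
next
  case (Cons b r y L)
  have *: "runs prog F_revise [encode_bits z, encode_bits r, encs L] (encode_bits (revise z r L))
      ((length L + 1) * N)" if "wfv z" for z
    using Cons that by simp
  show ?case using Cons.prems N_facts
    by (intro runsI[OF prog_nth(12)])
      (auto simp: length_prog revise_body_def wp_simps intro!: runs_call[OF *] runs_call[OF runs_nb]
        runs_call[OF runs_and])
qed

end

text \<open>For positive arguments this is the number of binary digits, \<lfloor>log 2 x\<rfloor> +
  1.\<close>

fun halvings :: "nat \<Rightarrow> nat" where
  "halvings 0 = 0"
| "halvings (Suc x) = Suc (halvings (Suc x div 2))"

context runtime
begin

text \<open>The slack of 50 copies pays for the work around a loop; l + 51 \<le> N is all that is
  behind it.\<close>

lemma pow_absorb:
  assumes "l \<le> n"
  shows "(l + 1) * N ^ e + 50 * N ^ e \<le> N ^ Suc e"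
proof -
  have "(l + 1) * N ^ e + 50 * N ^ e = (l + 51) * N ^ e" by (simp add: algebra_simps)
  also have "\<dots> \<le> N * N ^ e" using assms N_facts by (intro mult_le_mono1) linarith
  finally show ?thesis by simp
qed

lemma pow_ge: "50 \<le> 50 * N ^ e" "1 \<le> N ^ e" "e \<le> e' \<Longrightarrow> N ^ e \<le> N ^ e'"
  using N_facts by (auto intro: power_increasing)

lemma pow_bound: "l \<le> n \<Longrightarrow> (l + 1) * N ^ e \<le> N ^ Suc e"
  using pow_absorb[of l e] by linarith

lemma pow_100: "0 < e \<Longrightarrow> 100 \<le> N ^ e"
  using N_facts power_increasing[of 1 e N] by auto

lemma pow_absorb1: "l \<le> n \<Longrightarrow> (l + 1) * N + 50 * N \<le> N ^ 2"
  using pow_absorb[of l 1] by (simp add: power2_eq_square)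

lemma pow_absorb2: "51 * N ^ 2 \<le> N ^ 3"
  using pow_absorb[of 0 2] by simp

lemma runs_half:
  "runs prog F_half [encode_list ys] (encode_list (replicate (length ys div 2) TNil)) ((length ys + 1) * N)"
proof (induction ys rule: induct_list012)
  case 1
  show ?case using N_facts
    by (intro runsI[OF prog_nth(4)]) (simp_all add: length_prog half_body_def wp_simps)
next
  case (2 x)
  show ?case using N_facts
    by (intro runsI[OF prog_nth(4)]) (simp_all add: length_prog half_body_def wp_simps)
next
  case (3 x y zs)
  show ?case using N_facts
    by (intro runsI[OF prog_nth(4)])
      (auto simp: length_prog half_body_def wp_simps intro!: runs_call[OF "3"(1)])
qed

lemma runs_nlog:
  assumes "length xs \<le> n" "length ys \<le> n"
  shows "\<exists>ws. length ws = length xs * halvings (length ys) \<and>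
    runs prog F_nlog [encode_list xs, encode_list ys] (encode_list ws) ((length ys + 1) * N ^ 3)"
  using assms(2)
proof (induction "length ys" arbitrary: ys rule: less_induct)
  case less
  show ?case
  proof (cases ys)
    case Nil
    have "runs prog F_nlog [encode_list xs, encode_list ys] (encode_list []) ((length ys + 1) * N ^ 3)"
      using pow_100[of 3] unfolding Nil
      by (intro runsI[OF prog_nth(5)]) (simp_all add: length_prog nlog_body_def wp_simps)
    then show ?thesis using Nil by auto
  next
    case (Cons y ys')
    let ?h = "replicate (length ys div 2) TNil"
    have "length ?h < length ys" using Cons by simp
    moreover have "length ?h \<le> n" using less(2) div_le_dividend[of "length ys" 2] by simp
    ultimately obtain ws where ws: "length ws = length xs * halvings (length ?h)"
      "runs prog F_nlog [encode_list xs, encode_list ?h] (encode_list ws) ((length ?h + 1) * N ^ 3)"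
      using less(1) by blast
    have b: "(length ?h + 1) * N ^ 3 \<le> length ys * N ^ 3" using Cons by (intro mult_le_mono1) auto
    have c: "N ^ 2 + 50 * N ^ 2 \<le> N ^ 3" using pow_absorb2 by simp
    have d: "100 \<le> N ^ 2" by (rule pow_100) simp
    have e: "(length xs + 1) * N \<le> N ^ 2" "(length ys + 1) * N \<le> N ^ 2"
      using pow_absorb1[of "length xs"] pow_absorb1[of "length ys"] assms less(2) by linarith+
    have "runs prog F_nlog [encode_list xs, encode_list ys] (encode_list (xs @ ws)) ((length ys + 1) * N ^ 3)"
      using b c d
      by (intro runsI[OF prog_nth(5)])
        (auto simp: Cons length_prog nlog_body_def wp_simps
          intro!: runs_call[OF runs_mono[OF runs_app e(1)]]
            runs_call[OF runs_mono[OF runs_half e(2)], unfolded Cons, simplified]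
            runs_call[OF runs_mono[OF ws(2) b], unfolded Cons, simplified])
    then show ?thesis using ws(1) Cons by (auto intro!: exI[of _ "xs @ ws"])
  qed
qed

text \<open>\<open>js\<close> counts the levels of nested loops and \<open>xs\<close> the iterations
  left at the outermost level; every inner loop runs over \<open>ts\<close>. Started with
  \<open>xs = ts\<close> and a nonempty \<open>js\<close>, it therefore removes
  \<open>length ts ^ length js\<close> elements. The loops continue after \<open>ws\<close> is
  exhausted, and each level costs a factor \<open>N\<close>, which is polynomial since the depth is
  fixed.\<close>

lemma runs_drop:
  assumes "length ts \<le> n"
  shows "runs prog F_drop [encode_list js, encode_list ts, encode_list xs, encode_list ws]
      (encode_list (drop (if js = [] then 1 else length xs * length ts ^ (length js - 1)) ws))
      ((length xs + 1) * N ^ (length js + 1))"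
proof (induction js arbitrary: xs ws)
  case Nil
  have "20 \<le> (length xs + 1) * N" using N_facts by simp
  then show ?case
    by (intro runsI[OF prog_nth(6)]) (simp_all add: length_prog drop_body_def wp_simps drop_Suc)
next
  case (Cons j js)
  note outer = Cons
  have inner: "runs prog F_drop [encode_list js, encode_list ts, encode_list ts, encode_list ws]
      (encode_list (drop (length ts ^ length js) ws)) ((length ts + 1) * N ^ (length js + 1))" for ws
    using outer[of ts ws] by (cases js) auto
  show ?case
  proof (induction xs arbitrary: ws)
    case Nil
    show ?case using pow_100[of "length js + 2"]
      by (intro runsI[OF prog_nth(6)]) (simp_all add: length_prog drop_body_def wp_simps)
  next
    case (Cons x xs)
    have b: "(length ts + 1) * N ^ (length js + 1) + 50 \<le> N ^ (length js + 2)"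
      using pow_absorb[OF assms, of "length js + 1"] pow_ge(1)[of "length js + 1"]
      by (simp only: add_Suc_right[symmetric] Suc_1)
    show ?case using b
      by (intro runsI[OF prog_nth(6)])
        (auto simp: length_prog drop_body_def wp_simps drop_drop algebra_simps
          intro!: runs_call[OF inner] runs_call[OF Cons[simplified]])
  qed
qed

lemma runs_sweep:
  assumes "length rows = length R" "length R = length X" "list_all2 row_tree rows R"
    "\<forall>r\<in>set R. length r = length L" "wfvs X" "wfvs L" "length L \<le> n"
  shows "runs prog F_sweep [encode_list rows, encs X, encs L] (encs (sweep R X L)) ((length X + 1) * N ^ 3)"
  using assms
proof (induction rows R X rule: list_induct3)
  case Nil
  then show ?case using pow_100[of 3]
    by (intro runsI[OF prog_nth(13)]) (simp_all add: length_prog sweep_body_def sweep_def wp_simps)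
next
  case (Cons t rows r R x X)
  have *: "runs prog F_sweep [encode_list rows, encs X, encs L] (encs (sweep R X L)) ((length X + 1) * N ^ 3)"
    using Cons by simp
  have b: "(length L + 1) * N + 50 \<le> N ^ 3"
    using pow_absorb1[OF \<open>length L \<le> n\<close>] pow_absorb2 N_facts by linarith
  show ?case using Cons.prems b
    by (intro runsI[OF prog_nth(13)])
      (auto simp: length_prog sweep_body_def sweep_def wp_simps row_tree_def
        intro!: runs_call[OF *[unfolded sweep_def]] runs_call[OF runs_revise])
qed

lemma runs_count:
  assumes "length r = length X" "wfvs X"
  shows "runs prog F_count [encode_bits r, encs X] (encode_list (replicate (count r X) TNil)) ((length X + 1) * N)"
  using assms
proof (induction r X rule: list_induct2)
  case Nil
  then show ?case using N_facts
    by (intro runsI[OF prog_nth(16)]) (simp_all add: length_prog count_body_def count_def wp_simps)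
next
  case (Cons b r x X)
  have *: "runs prog F_count [encode_bits r, encs X] (encode_list (replicate (count r X) TNil)) ((length X + 1) * N)"
    using Cons by simp
  show ?case using Cons.prems N_facts
    by (intro runsI[OF prog_nth(16)])
      (auto simp: length_prog count_body_def count_def wp_simps
        intro!: runs_call[OF *[unfolded count_def]] runs_call[OF runs_unfixed])
qed

lemma runs_anyempty:
  assumes "wfvs X"
  shows "runs prog F_anyempty [encs X] (encode_bool (\<exists>x\<in>set X. cset x = {})) ((length X + 1) * N)"
  using assms
proof (induction X)
  case Nil
  then show ?case using N_facts
    by (intro runsI[OF prog_nth(18)]) (simp_all add: length_prog anyempty_body_def wp_simps)
next
  case (Cons x X)
  then show ?case using N_facts
    by (intro runsI[OF prog_nth(18)])
      (auto simp: length_prog anyempty_body_def wp_simps intro!: runs_call[OF Cons.IH] runs_call[OF runs_empty])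
qed

lemma runs_marked: "runs prog F_marked [encode_bits V] (encode_bool (True \<in> set V)) ((length V + 1) * N)"
proof (induction V)
  case Nil
  then show ?case using N_facts
    by (intro runsI[OF prog_nth(19)]) (simp_all add: length_prog marked_body_def wp_simps)
next
  case (Cons x X)
  then show ?case using N_facts
    by (intro runsI[OF prog_nth(19)])
      (auto simp: length_prog marked_body_def wp_simps intro!: runs_call[OF Cons.IH])
qed

lemma runs_firstbad:
  assumes "wfvs X"
  shows "runs prog F_firstbad [encs X] (encode_bits (mark_first (\<lambda>x. \<not> good (cset x)) X)) ((length X + 1) * N)"
  using assms
proof (induction X)
  case Nil
  then show ?case using N_facts
    by (intro runsI[OF prog_nth(20)]) (simp_all add: length_prog first_body_def wp_simps)
next
  case (Cons x X)
  then show ?case using N_facts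
    by (intro runsI[OF prog_nth(20)])
      (auto simp: length_prog first_body_def wp_simps intro!: runs_call[OF Cons.IH] runs_call[OF runs_bad])
qed

lemma runs_firstunfixed:
  assumes "wfvs X"
  shows "runs prog F_firstunfixed [encs X] (encode_bits (mark_first unfixed X)) ((length X + 1) * N)"
  using assms
proof (induction X)
  case Nil
  then show ?case using N_facts
    by (intro runsI[OF prog_nth(26)]) (simp_all add: length_prog first_body_def wp_simps)
next
  case (Cons x X)
  then show ?case using N_facts
    by (intro runsI[OF prog_nth(26)])
      (auto simp: length_prog first_body_def wp_simps intro!: runs_call[OF Cons.IH] runs_call[OF runs_unfixed])
qed

lemma runs_touches:
  assumes "length B \<le> length r"
  shows "runs prog F_touches [encode_bits r, encode_bits B] (encode_bool (touches r B)) ((length B + 1) * N)"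
  using assms
proof (induction B arbitrary: r)
  case Nil
  then show ?case using N_facts
    by (intro runsI[OF prog_nth(21)]) (simp_all add: length_prog touches_body_def touches_def wp_simps)
next
  case (Cons b B r)
  then obtain a r' where r: "r = a # r'" by (cases r) auto
  then show ?case using N_facts Cons.prems
    by (intro runsI[OF prog_nth(21)])
      (auto simp: length_prog touches_body_def touches_def wp_simps
        intro!: runs_call[OF Cons.IH[unfolded touches_def]])
qed

lemma runs_grow:
  assumes "length rows = length R" "length R = length X" "list_all2 row_tree rows R"
    "\<forall>r\<in>set R. length r = n" "wfvs X" "length B0 \<le> n"
  shows "runs prog F_grow [encode_list rows, encs X, encode_bits B, encode_bits B0]
      (encode_bits (grow R X B B0)) ((length X + 1) * N ^ 3)"
  using assms
proof (induction rows R X arbitrary: B rule: list_induct3)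
  case Nil
  then show ?case using pow_100[of 3]
    by (intro runsI[OF prog_nth(22)]) (simp_all add: length_prog grow_body_def wp_simps)
next
  case (Cons t rows r R x X)
  have *: "runs prog F_grow [encode_list rows, encs X, encode_bits B, encode_bits B0]
      (encode_bits (grow R X B B0)) ((length X + 1) * N ^ 3)" for B
    using Cons by simp
  have b: "(length B0 + 1) * N + table_cost m + 50 \<le> N ^ 3"
    using pow_absorb1[OF \<open>length B0 \<le> n\<close>] pow_absorb2 N_facts by linarith
  show ?case using Cons.prems b
    by (intro runsI[OF prog_nth(22)])
      (auto simp: length_prog grow_body_def wp_simps row_tree_def
        intro!: runs_call[OF *] runs_call[OF *[of "[]", simplified]] runs_call[OF runs_touches] runs_call[OF runs_unfixed])
qed

lemma runs_assign:
  assumes "length V \<le> length X" "wfv c" "wfvs X"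
  shows "runs prog F_assign [encode_bits V, encode_bits c, encs X] (encs (assign V c X)) ((length V + 1) * N)"
  using assms
proof (induction V c X rule: assign.induct)
  case (1 V c x X)
  then show ?case using N_facts
    by (intro runsI[OF prog_nth(24)])
      (auto simp: length_prog assign_body_def wp_simps intro!: runs_call[OF runs_and])
next
  case (2 V c x X)
  then show ?case using N_facts
    by (intro runsI[OF prog_nth(24)])
      (auto simp: length_prog assign_body_def wp_simps intro!: runs_call[OF 2(1)])
qed (use N_facts in \<open>auto intro!: runsI[OF prog_nth(24)] simp: length_prog assign_body_def wp_simps\<close>)

lemma runs_unmark: "runs prog F_unmark [encode_bits V] (encode_bits (unmark V)) ((length V + 1) * N)"
proof (induction V rule: unmark.induct)
  case 1
  then show ?case using N_facts
    by (intro runsI[OF prog_nth(25)]) (simp_all add: length_prog unmark_body_def wp_simps)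
next
  case (2 V)
  then show ?case using N_facts
    by (intro runsI[OF prog_nth(25)]) (simp_all add: length_prog unmark_body_def wp_simps)
next
  case (3 V)
  then show ?case using N_facts
    by (intro runsI[OF prog_nth(25)])
      (auto simp: length_prog unmark_body_def wp_simps intro!: runs_call[OF 3])
qed

end

section \<open>Mark lists as vertex sets, and the effect of the list operations on colour
  sets\<close>

definition marks :: "bool list \<Rightarrow> nat set" where
  "marks B = {v. v < length B \<and> B ! v}"

lemma True_in_set_iff_marks: "True \<in> set V \<longleftrightarrow> marks V \<noteq> {}"
  by (force simp: marks_def in_set_conv_nth)

context odd_cycle
begin

lemma mark_first_cases:
  "(\<forall>x\<in>set xs. \<not> P x) \<and> mark_first P xs = replicate (length xs) False \<or>
   (\<exists>i<length xs. P (xs ! i) \<and> mark_first P xs = replicate i False @ [True])"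
proof (induction xs)
  case (Cons x xs)
  show ?case
  proof (cases "P x")
    case True
    then show ?thesis by (intro disjI2 exI[of _ 0]) auto
  next
    case False
    from Cons show ?thesis
    proof
      assume "\<exists>i<length xs. P (xs ! i) \<and> mark_first P xs = replicate i False @ [True]"
      then obtain i where "i < length xs" "P (xs ! i)" "mark_first P xs = replicate i False @ [True]" by blast
      then show ?thesis using False by (intro disjI2 exI[of _ "Suc i"]) auto
    qed (use False in auto)
  qed
qed simp

lemma length_mark_first: "length (mark_first P xs) \<le> length xs"
  by (induction xs) auto

lemma marks_single: "marks (replicate i False @ [True]) = {i}"
  by (auto simp: marks_def nth_append split: if_splits)

lemma marks_mark_first: "marks (mark_first P xs) \<noteq> {} \<longleftrightarrow> (\<exists>x\<in>set xs. P x)"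
  by (induction xs) (auto simp: True_in_set_iff_marks[symmetric])

lemma first_mark:
  assumes "marks V \<noteq> {}"
  obtains i where "i < length V" "V ! i" "\<And>j. j < i \<Longrightarrow> \<not> V ! j"
proof -
  define i where "i = (LEAST i. i \<in> marks V)"
  have "i \<in> marks V" unfolding i_def using assms by (metis LeastI ex_in_conv)
  moreover have "\<not> V ! j" if "j < i" for j
    using not_less_Least[of j "\<lambda>i. i \<in> marks V", folded i_def] that calculation
    by (auto simp: marks_def)
  ultimately show ?thesis using that by (auto simp: marks_def)
qed

lemma assign_first:
  assumes "i < length V" "V ! i" "\<And>j. j < i \<Longrightarrow> \<not> V ! j" "length V \<le> length X"
  shows "assign V c X = X[i := andv c (X ! i)]"
  using assms
proof (induction V arbitrary: i X)
  case (Cons b V)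
  then obtain x X' where X: "X = x # X'" by (cases X) auto
  show ?case
  proof (cases i)
    case 0
    then show ?thesis using Cons.prems X by simp
  next
    case (Suc i')
    have "\<not> b" using Cons.prems(3)[of 0] Suc by simp
    moreover have "\<not> V ! j" if "j < i'" for j using Cons.prems(3)[of "Suc j"] Suc that by simp
    then have "assign V c X' = X'[i' := andv c (X' ! i')]"
      using Cons.prems X Suc by (intro Cons.IH) auto
    ultimately show ?thesis using X Suc by simp
  qed
qed simp

lemma unmark_first:
  assumes "i < length V" "V ! i" "\<And>j. j < i \<Longrightarrow> \<not> V ! j"
  shows "unmark V = V[i := False]"
  using assms
proof (induction V arbitrary: i)
  case (Cons b V)
  show ?case
  proof (cases i)
    case 0
    then show ?thesis using Cons.prems by simp
  next
    case (Suc i')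
    have "\<not> b" using Cons.prems(3)[of 0] Suc by simp
    moreover have "\<not> V ! j" if "j < i'" for j using Cons.prems(3)[of "Suc j"] Suc that by simp
    then have "unmark V = V[i' := False]"
      using Cons.prems Suc by (intro Cons.IH) auto
    ultimately show ?thesis using Suc by simp
  qed
qed simp

lemma cset_revise:
  assumes "length r = length L"
  shows "cset (revise x r L) = cset x \<inter> {i. \<forall>u<length L. r ! u \<longrightarrow> i \<in> nbs (cset (L ! u))}"
  using assms
proof (induction r L arbitrary: x rule: list_induct2)
  case (Cons b r y L)
  have "(\<forall>u<length (y # L). (b # r) ! u \<longrightarrow> i \<in> nbs (cset ((y # L) ! u))) \<longleftrightarrow>
      (b \<longrightarrow> i \<in> nbs (cset y)) \<and> (\<forall>u<length L. r ! u \<longrightarrow> i \<in> nbs (cset (L ! u)))" for i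
    by (auto simp: less_Suc_eq_0_disj)
  then show ?case using Cons by (auto simp: cset_andv cset_nbv)
qed simp

lemma length_revise: "length x = m \<Longrightarrow> length (revise x r L) = m"
  by (induction x r L rule: revise.induct) auto

lemma touches_iff: "length B \<le> length r \<Longrightarrow> touches r B \<longleftrightarrow> (\<exists>u\<in>marks B. r ! u)"
  unfolding touches_def list_ex_iff by (force simp: set_zip marks_def)

lemma length_grow: "length R = length X \<Longrightarrow> length (grow R X B B0) = length X"
  by (induction R X B B0 rule: grow.induct) auto

lemma nth_grow:
  assumes "length R = length X" "v < length X"
  shows "grow R X B B0 ! v \<longleftrightarrow> unfixed (X ! v) \<and> (v \<in> marks B \<or> touches (R ! v) B0)"
  using assms
proof (induction R X arbitrary: v B rule: list_induct2)
  case (Cons r R x X)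
  have mk: "Suc i \<in> marks B \<longleftrightarrow> i \<in> marks (tl B)" "0 \<in> marks B \<longleftrightarrow> B \<noteq> [] \<and> hd B" for i
    by (cases B; auto simp: marks_def)+
  show ?case using Cons by (cases v) (auto simp: mk)
qed simp

lemma count_eq_card:
  assumes "length r = length X"
  shows "count r X = card {u. u < length X \<and> r ! u \<and> unfixed (X ! u)}"
  unfolding count_def length_filter_conv_card using assms
  by (intro arg_cong[where f = card]) auto

end

text \<open>\<open>W\<close> is the unary list against which powers of degrees are compared. Its
  length stays open until \<open>runs_main\<close> sets it to \<open>n * halvings n\<close>.\<close>

locale input_graph = runtime +
  fixes R :: "bool list list" and rows W :: "tree list"
  assumes length_R: "length R = n" and rows_R: "list_all2 row_tree rows R"
    and length_row: "\<And>r. r \<in> set R \<Longrightarrow> length r = n"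
    and R_sym: "\<And>u v. u < n \<Longrightarrow> v < n \<Longrightarrow> R ! u ! v \<Longrightarrow> R ! v ! u"
begin

definition E :: "nat \<Rightarrow> nat \<Rightarrow> bool" where
  "E u v \<longleftrightarrow> u < n \<and> v < n \<and> R ! u ! v"

sublocale colouring k n E
  by unfold_locales (auto simp: E_def R_sym)

abbreviation "wfX X \<equiv> length X = n \<and> wfvs X"

definition lst :: "bool list list \<Rightarrow> nat \<Rightarrow> nat set" where
  "lst X v = cset (X ! v)"

lemma length_rows: "length rows = n"
  using rows_R length_R by (auto dest: list_all2_lengthD)

lemma wfl_lst: "wfl (lst X)"
  using cset_subset by (auto simp: wfl_def lst_def)

section \<open>Arc consistency by simultaneous revision of all lists\<close>

definition revise_all :: "bool list list \<Rightarrow> bool list list" where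
  "revise_all X = sweep R X X"

definition propagate :: "bool list list \<Rightarrow> bool list list" where
  "propagate X = (revise_all ^^ (n * m)) X"

lemma wfX_revise_all: "wfX X \<Longrightarrow> wfX (revise_all X)"
  using length_R by (auto simp: revise_all_def sweep_def set_zip intro!: length_revise)

lemma lst_revise_all:
  assumes "wfX X" "v < n"
  shows "lst (revise_all X) v = lst X v \<inter> {i. \<forall>u. E v u \<longrightarrow> i \<in> nbs (lst X u)}"
  using assms length_R length_row
  by (auto simp: lst_def revise_all_def sweep_def cset_revise E_def)

lemma wfX_pow: "wfX X \<Longrightarrow> wfX ((revise_all ^^ i) X)"
  by (induction i) (simp_all add: wfX_revise_all)

lemma wfX_propagate: "wfX X \<Longrightarrow> wfX (propagate X)"
  unfolding propagate_def by (rule wfX_pow)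

lemma hom_revise_all:
  assumes "wfX X"
  shows "hom (lst (revise_all X)) \<phi> \<longleftrightarrow> hom (lst X) \<phi>"
proof -
  have "\<phi> v \<in> nbs (lst X u)" if "hom (lst X) \<phi>" "E v u" for u v
    using that E_less2 cadj_sym unfolding hom_def nbs_def by blast
  then show ?thesis
    using lst_revise_all[OF assms] unfolding hom_def by auto
qed

lemma sub_revise_all: "wfX X \<Longrightarrow> sub (lst (revise_all X)) (lst X)"
  unfolding sub_def using lst_revise_all by auto

lemma hom_propagate: "wfX X \<Longrightarrow> hom (lst (propagate X)) \<phi> \<longleftrightarrow> hom (lst X) \<phi>"
proof -
  assume X: "wfX X"
  have "hom (lst ((revise_all ^^ i) X)) \<phi> \<longleftrightarrow> hom (lst X) \<phi>" for i
    by (induction i) (simp_all add: hom_revise_all wfX_pow[OF X])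
  then show ?thesis by (simp add: propagate_def)
qed

lemma sub_propagate: "wfX X \<Longrightarrow> sub (lst (propagate X)) (lst X)"
proof -
  assume X: "wfX X"
  have "sub (lst ((revise_all ^^ i) X)) (lst X)" for i
    by (induction i) (auto simp: sub_refl intro!: sub_trans[OF sub_revise_all[OF wfX_pow[OF X]]])
  then show ?thesis by (simp add: propagate_def)
qed

lemma revise_all_strict:
  assumes "wfX X" "revise_all X \<noteq> X"
  shows "mu (lst (revise_all X)) < mu (lst X)"
proof -
  have "\<exists>v<n. lst (revise_all X) v \<noteq> lst X v"
  proof (rule ccontr)
    assume "\<not> (\<exists>v<n. lst (revise_all X) v \<noteq> lst X v)"
    then have "revise_all X = X"
      using assms wfX_revise_all[OF assms(1)] by (intro nth_equalityI cset_inj) (auto simp: lst_def)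
    then show False using assms by simp
  qed
  then obtain v where v: "v < n" "lst (revise_all X) v \<noteq> lst X v" by blast
  then have "lst (revise_all X) v \<subset> lst X v"
    using sub_revise_all[OF assms(1)] by (auto simp: sub_def)
  then have "card (lst (revise_all X) v) < card (lst X v)"
    using wfl_finite[OF wfl_lst v(1)] by (intro psubset_card_mono)
  then show ?thesis using mu_less[OF sub_revise_all[OF assms(1)] wfl_lst v(1)] by simp
qed

text \<open>A round that changes anything lowers \<open>mu\<close>, so after
  \<open>mu (lst X)\<close> rounds a further one is idle. With \<open>mu_le\<close> this justifies
  the n m rounds of \<open>propagate\<close>.\<close>

lemma revise_all_fixpoint:
  assumes "wfX X" "mu (lst X) \<le> i"
  shows "revise_all ((revise_all ^^ i) X) = (revise_all ^^ i) X"
  using assms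
proof (induction i arbitrary: X)
  case 0
  then show ?case using revise_all_strict[of X] by auto
next
  case (Suc i)
  show ?case
  proof (cases "revise_all X = X")
    case True
    have "(revise_all ^^ j) X = X" for j by (induction j) (simp_all add: True)
    then show ?thesis using True by simp
  next
    case False
    then have "mu (lst (revise_all X)) \<le> i" using revise_all_strict[OF Suc.prems(1)] Suc.prems by simp
    then show ?thesis
      using Suc.IH[of "revise_all X"] wfX_revise_all[OF Suc.prems(1)]
      by (simp add: funpow_Suc_right del: funpow.simps)
  qed
qed

lemma ac_propagate:
  assumes "wfX X"
  shows "ac (lst (propagate X))"
  unfolding ac_def
proof (intro allI impI)
  fix u v assume uv: "E u v"
  have v: "v < n" using uv E_less2 by blast
  have fixed: "revise_all (propagate X) = propagate X"
    unfolding propagate_def by (intro revise_all_fixpoint assms mu_le wfl_lst)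
  have "lst (propagate X) v = lst (propagate X) v \<inter> {i. \<forall>u. E v u \<longrightarrow> i \<in> nbs (lst (propagate X) u)}"
    using lst_revise_all[OF wfX_propagate[OF assms] v] unfolding fixed .
  then show "lst (propagate X) v \<subseteq> nbs (lst (propagate X) u)"
    using E_sym[OF uv] by blast
qed

lemma lst_update:
  "i < n \<Longrightarrow> wfX X \<Longrightarrow> lst (X[i := andv (single a) (X ! i)]) v = (if v = i then {a} \<inter> lst X i else lst X v)"
  using cset_subset[of "X ! i"] by (auto simp: lst_def cset_andv cset_single)

lemma marks_grow:
  assumes "wfX X" "length B \<le> n"
  shows "marks (grow R X B B) = bstep (lst X) (marks B)"
proof -
  have len: "length (grow R X B B) = n" using assms length_R by (simp add: length_grow)
  have "v \<in> marks (grow R X B B) \<longleftrightarrow> v \<in> bstep (lst X) (marks B)" for v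
  proof (cases "v < n")
    case True
    have "marks B \<subseteq> {..<n}" using assms by (auto simp: marks_def)
    then show ?thesis
      using True len assms length_R length_row[of "R ! v"] nth_mem[of v R]
      by (auto simp: marks_def[of "grow R X B B"] nth_grow touches_iff bstep_def unfixed_def lst_def E_def)
  next
    case False
    then show ?thesis using len by (auto simp: marks_def bstep_def)
  qed
  then show ?thesis by blast
qed

lemma marks_grow_pow:
  assumes "wfX X" "length V \<le> n"
  shows "marks (((\<lambda>B. grow R X B B) ^^ i) V) = (bstep (lst X) ^^ i) (marks V) \<and>
    length (((\<lambda>B. grow R X B B) ^^ i) V) \<le> n"
  using assms length_R by (induction i) (simp_all add: marks_grow length_grow)

lemma pow_absorb_eq: "l \<le> n \<Longrightarrow> e' = e + 1 \<Longrightarrow> (l + 1) * N ^ e + 50 * N ^ e \<le> N ^ e'"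
  using pow_absorb[of l e] by simp

lemma pow_bound_eq: "l \<le> n \<Longrightarrow> e' = e + 1 \<Longrightarrow> (l + 1) * N ^ e \<le> N ^ e'"
  using pow_absorb[of l e] by simp

lemma rows_facts: "length rows = length R" "\<forall>r\<in>set R. length r = n" "list_all2 row_tree rows R"
  using length_rows length_R length_row rows_R by auto

lemma runs_round:
  assumes "wfX X"
  shows "runs prog F_round [encode_list rows, encs X] (encs (revise_all X)) (N ^ 4)"
proof -
  have "(n + 1) * N ^ 3 + 50 * N ^ 3 \<le> N ^ 4" using pow_absorb[of n 3] by simp
  then have b: "(length X + 1) * N ^ 3 + 10 \<le> N ^ 4" using assms pow_ge(1)[of 3] by simp
  show ?thesis using b assms rows_facts length_R
    by (intro runsI[OF prog_nth(14)])
      (auto simp: length_prog round_body_def wp_simps revise_all_def intro!: runs_call[OF runs_sweep[where R = R]])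
qed

lemma wp_round_pow:
  assumes X: "wfX X" and env: "env ! 1 = encode_list rows" "1 < length env"
    and e: "wp prog env e (\<lambda>v t. v = encs X \<and> t \<le> T)"
  shows "wp prog env (((\<lambda>e. Call F_round [Arg 1, e]) ^^ i) e)
      (\<lambda>v t. v = encs ((revise_all ^^ i) X) \<and> t \<le> T + i * (N ^ 4 + 2))"
proof (induction i)
  case 0
  then show ?case using e by simp
next
  case (Suc i)
  show ?case
    unfolding funpow.simps o_apply wp_Call wps_Cons wps_Nil wp_Arg
    using env wfX_pow[OF X, of i]
    by (auto intro!: wp_mono[OF Suc[unfolded One_nat_def]] runs_call[OF runs_round])
qed

lemma runs_ac:
  assumes "wfX X"
  shows "runs prog F_ac [encode_list fs, encode_list rows, encs X]
      (encs ((revise_all ^^ (length fs * m)) X)) ((length fs + 1) * N ^ 6)"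
  using assms
proof (induction fs arbitrary: X)
  case Nil
  then show ?case using pow_100[of 6]
    by (intro runsI[OF prog_nth(15)]) (simp_all add: length_prog ac_body_def wp_simps)
next
  case (Cons f fs)
  have "m * N ^ 4 \<le> N * N ^ 4" using N_facts by (intro mult_le_mono1) linarith
  moreover have "N ^ 5 + 50 * N ^ 5 \<le> N ^ 6" using pow_absorb[of 0 5] by simp
  moreover have "N * N ^ 4 = N ^ 5" by (simp add: power_Suc[symmetric])
  moreover have "N \<le> N ^ 5" using pow_ge(3)[of 1 5] by simp
  ultimately have b: "m * N ^ 4 + m * 2 + 20 \<le> N ^ 6" using N_facts by linarith
  have env: "[encode_list (f # fs), encode_list rows, encs X] ! 1 = encode_list rows"
    "1 < length [encode_list (f # fs), encode_list rows, encs X]" by auto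
  have e: "wp prog [encode_list (f # fs), encode_list rows, encs X] (Arg 2) (\<lambda>v t. v = encs X \<and> t \<le> 1)"
    by (simp add: wp_simps)
  have *: "runs prog F_ac [encode_list fs, encode_list rows, encs ((revise_all ^^ m) X)]
      (encs ((revise_all ^^ (length fs * m)) ((revise_all ^^ m) X))) ((length fs + 1) * N ^ 6)"
    using Cons.prems by (intro Cons.IH wfX_pow)
  have eq: "(revise_all ^^ (length fs * m)) ((revise_all ^^ m) X) = (revise_all ^^ (length (f # fs) * m)) X"
    by (simp add: funpow_add[symmetric] add.commute flip: o_apply[of "revise_all ^^ (length fs * m)"])
  show ?case
    unfolding eq[symmetric] using b
    by (intro runsI[OF prog_nth(15)])
      (auto simp: length_prog ac_body_def wp_If wp_Call wps_Cons wps_Nil wp_Tl wp_Arg algebra_simps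
        intro!: wp_mono[OF wp_round_pow[OF Cons.prems env e, simplified]] runs_call[OF *[simplified]])
qed

lemma runs_propagate:
  assumes "wfX X"
  shows "runs prog F_ac [encode_list rows, encode_list rows, encs X] (encs (propagate X)) (N ^ 7)"
  using runs_mono[OF runs_ac[OF assms, of rows], of "N ^ 7"] pow_bound[of "length rows" 6]
  by (simp add: propagate_def length_rows)

definition child :: "bool list \<Rightarrow> bool list list \<Rightarrow> nat \<Rightarrow> bool list list" where
  "child V X a = propagate (assign V (single a) X)"

lemma wfX_assign: "wfX X \<Longrightarrow> length V \<le> n \<Longrightarrow> wfX (assign V (single a) X)"
proof -
  have "length (assign V c X) = length X \<and> (wfvs X \<longrightarrow> wfvs (assign V c X))" for c
    by (induction V c X rule: assign.induct) auto
  then show "wfX X \<Longrightarrow> length V \<le> n \<Longrightarrow> wfX (assign V (single a) X)" by simp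
qed

lemma wfX_child: "wfX X \<Longrightarrow> length V \<le> n \<Longrightarrow> wfX (child V X a)"
  unfolding child_def by (intro wfX_propagate wfX_assign)

lemma wp_child:
  assumes X: "wfX X" and V: "length V \<le> n"
    and env: "r < length env" "env ! r = encode_list rows" "l < length env" "env ! l = encs X"
    and e: "wp prog env e (\<lambda>v t. v = encode_bits V \<and> t \<le> T)"
  shows "wp prog env (child_expr (Arg r) e (Arg l) a) (\<lambda>v t. v = encs (child V X a) \<and> t \<le> T + N ^ 8)"
proof -
  have s: "size (encode_bits (single a)) \<le> 2 * m" using size_encode_bits[of "single a"] by simp
  have "(n + 1) * N + 50 * N \<le> N ^ 2" by (rule pow_absorb1) simp
  moreover have "(length V + 1) * N \<le> (n + 1) * N" using V by (intro mult_le_mono1) simp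
  moreover have "N ^ 7 + 50 * N ^ 7 \<le> N ^ 8" using pow_absorb[of 0 7] by simp
  moreover have "N ^ 2 \<le> N ^ 7" by (rule pow_ge(3)) simp
  ultimately have b: "(length V + 1) * N + N ^ 7 + 4 * m + 20 \<le> N ^ 8" using N_facts by linarith
  have wf: "wfX (assign V (single a) X)" by (rule wfX_assign[OF X V])
  show ?thesis
    unfolding child_expr_def child_def using X V env b s
    by (auto simp: wp_Call wps_Cons wps_Nil wp_Arg wp_const
      intro!: wp_mono[OF e] runs_call[OF runs_assign] runs_call[OF runs_propagate[OF wf]])
qed

definition is_heavy :: "bool list list \<Rightarrow> bool list \<Rightarrow> bool list \<Rightarrow> bool" where
  "is_heavy L r x \<longleftrightarrow> unfixed x \<and> length W \<le> count r L ^ (k + 2)"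

lemma size_unary: "size (encode_list (replicate j TNil)) = j"
  by (induction j) auto

lemma runs_heavy_suffix:
  assumes "length rows' = length R'" "length R' = length X" "list_all2 row_tree rows' R'"
    "\<forall>r\<in>set R'. length r = n" "wfvs X" "wfX L"
  shows "runs prog F_heavy [encode_list rows', encs X, encs L, encode_list W]
      (encode_bits (mark_first (\<lambda>(r, x). is_heavy L r x) (zip R' X))) ((length X + 1) * N ^ (k + 5))"
  using assms
proof (induction rows' R' X rule: list_induct3)
  case Nil
  then show ?case using pow_100[of "k + 5"]
    by (intro runsI[OF prog_nth(17)]) (simp_all add: length_prog heavy_body_def wp_simps)
next
  case (Cons t rows' r R' x X)
  have IH: "runs prog F_heavy [encode_list rows', encs X, encs L, encode_list W]
      (encode_bits (mark_first (\<lambda>(r, x). is_heavy L r x) (zip R' X))) ((length X + 1) * N ^ (k + 5))"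
    using Cons by simp
  define c where "c = count r L"
  have r: "length r = n" "tree_tl t = encode_bits r" using Cons.prems by (auto simp: row_tree_def)
  have c_le: "c \<le> n" unfolding c_def count_def
    using r Cons.prems by (intro order_trans[OF length_filter_le]) simp
  have cnt: "runs prog F_count [encode_bits r, encs L] (encode_list (replicate c TNil)) (N ^ 2)"
    unfolding c_def using runs_count[of r L] r Cons.prems pow_absorb1[of n] by (auto intro: runs_mono)
  have dr: "runs prog F_drop [encode_list (replicate (k + 2) TNil), encode_list (replicate c TNil),
      encode_list (replicate c TNil), encode_list W] (encode_list (drop (c ^ (k + 2)) W)) (N ^ (k + 4))"
  proof (rule runs_mono)
    show "runs prog F_drop [encode_list (replicate (k + 2) TNil), encode_list (replicate c TNil),
      encode_list (replicate c TNil), encode_list W] (encode_list (drop (c ^ (k + 2)) W)) ((c + 1) * N ^ (k + 3))"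
      using runs_drop[of "replicate c TNil" "replicate (k + 2) TNil" "replicate c TNil" W] c_le by (simp add: numeral_eq_Suc)
  qed (rule pow_bound_eq[OF c_le], simp)
  have b: "N ^ (k + 4) + 2 * N ^ 2 + table_cost m + 2 * k + 44 \<le> N ^ (k + 5)"
  proof -
    define A B where "A = N ^ (k + 4)" and "B = N ^ (k + 5)"
    have "A + 50 * A \<le> B" unfolding A_def B_def using pow_absorb_eq[of 0 "k + 5" "k + 4"] by simp
    moreover have "N ^ 2 \<le> A" "N \<le> A" unfolding A_def using pow_ge(3)[of 2 "k + 4"] pow_ge(3)[of 1 "k + 4"] by simp_all
    moreover have "k + 1 \<le> m" by (simp add: m_def)
    ultimately show ?thesis using N_facts unfolding A_def[symmetric] B_def[symmetric] by linarith
  qed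
  have x: "wfv x" using Cons.prems by simp
  define J K where "J = encode_list (replicate (k + 2) TNil)" and "K = c ^ (k + 2)"
  have J: "exponent_expr = const J" "size J = k + 2" by (simp_all only: exponent_expr_def J_def size_unary)
  have iff: "is_heavy L r x \<longleftrightarrow> unfixed x \<and> length W \<le> K" by (simp only: is_heavy_def K_def c_def)
  show ?case using b
    by (intro runsI[OF prog_nth(17)])
      (auto simp: length_prog heavy_body_def J wp_simps wp_const r iff
        intro!: runs_call[OF IH] runs_call[OF cnt] runs_call[OF dr[folded J_def K_def]]
          runs_call[OF runs_unfixed[OF x]])
qed

definition heavy :: "bool list list \<Rightarrow> bool list" where
  "heavy X = mark_first (\<lambda>(r, x). is_heavy X r x) (zip R X)"

lemma runs_heavy:
  assumes "wfX X"
  shows "runs prog F_heavy [encode_list rows, encs X, encs X, encode_list W] (encode_bits (heavy X)) (N ^ (k + 6))"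
  unfolding heavy_def
  using runs_mono[OF runs_heavy_suffix[OF rows_facts(1) _ rows_facts(3,2)], of X X "N ^ (k + 6)"]
    assms length_R pow_bound_eq[of n "k + 6" "k + 5"] by simp

lemma length_heavy: "wfX X \<Longrightarrow> length (heavy X) \<le> n"
  unfolding heavy_def using length_mark_first[of _ "zip R X"] length_R by (simp add: order_trans)

lemma runs_ball:
  assumes "wfX X" "length B \<le> n"
  shows "runs prog F_ball [encode_list rows, encs X, encode_bits B] (encode_bits (grow R X B B)) (N ^ 4)"
proof -
  have "(n + 1) * N ^ 3 + 50 * N ^ 3 \<le> N ^ 4" using pow_absorb[of n 3] by simp
  then have b: "(length X + 1) * N ^ 3 + 10 \<le> N ^ 4" using assms pow_ge(1)[of 3] by simp
  show ?thesis using b assms rows_facts length_R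
    by (intro runsI[OF prog_nth(23)])
      (auto simp: length_prog ball_body_def wp_simps intro!: runs_call[OF runs_grow[where R = R]])
qed

lemma wp_ball_pow:
  assumes X: "wfX X" and V: "length V \<le> n"
    and env: "env ! 0 = encode_list rows" "env ! 2 = encs X" "2 < length env"
    and e: "wp prog env e (\<lambda>v t. v = encode_bits V \<and> t \<le> T)"
  shows "wp prog env (((\<lambda>e. Call F_ball [Arg 0, Arg 2, e]) ^^ i) e)
      (\<lambda>v t. v = encode_bits (((\<lambda>B. grow R X B B) ^^ i) V) \<and> t \<le> T + i * (N ^ 4 + 3))"
proof (induction i)
  case 0
  then show ?case using e by simp
next
  case (Suc i)
  show ?case
    unfolding funpow.simps o_apply wp_Call wps_Cons wps_Nil wp_Arg
    using env X conjunct2[OF marks_grow_pow[OF X V, of i]]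
    by (auto intro!: wp_mono[OF Suc] runs_call[OF runs_ball])
qed

end

section \<open>The search procedures\<close>

context input_graph
begin

definition solvable :: "bool list list \<Rightarrow> bool" where
  "solvable X \<longleftrightarrow> (\<exists>\<phi>. hom (lst X) \<phi>)"

abbreviation has_empty :: "bool list list \<Rightarrow> bool" where
  "has_empty X \<equiv> \<exists>x\<in>set X. cset x = {}"

lemma has_empty_iff:
  assumes "wfX X"
  shows "has_empty X \<longleftrightarrow> (\<exists>v<n. lst X v = {})"
proof -
  have "has_empty X \<longleftrightarrow> (\<exists>v<length X. cset (X ! v) = {})" by (metis in_set_conv_nth)
  then show ?thesis using assms by (simp add: lst_def)
qed

lemma not_solvable_of_empty:
  assumes "wfX X" "has_empty X"
  shows "\<not> solvable X"
  using assms(2) unfolding has_empty_iff[OF assms(1)] solvable_def hom_def by blast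

lemma child_facts:
  assumes X: "wfX X" and V: "length V \<le> n" and i: "i < length V" "V ! i" "\<And>j. j < i \<Longrightarrow> \<not> V ! j"
  shows "wfX (child V X a)" "ac (lst (child V X a))" "sub (lst (child V X a)) (lst X)"
    "lst (child V X a) i \<subseteq> {a}" "hom (lst (child V X a)) \<phi> \<longleftrightarrow> hom (lst X) \<phi> \<and> \<phi> i = a"
proof -
  let ?Y = "assign V (single a) X"
  have Y: "wfX ?Y" by (rule wfX_assign[OF X V])
  have i_n: "i < n" using i V by simp
  have "?Y = X[i := andv (single a) (X ! i)]"
    using assign_first[OF i] X V by simp
  then have lst: "lst ?Y v = (if v = i then {a} \<inter> lst X i else lst X v)" for v
    using lst_update[OF i_n X] by simp
  show "wfX (child V X a)" by (rule wfX_child[OF X V])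
  show "ac (lst (child V X a))" unfolding child_def by (rule ac_propagate[OF Y])
  have sub: "sub (lst (child V X a)) (lst ?Y)" unfolding child_def by (rule sub_propagate[OF Y])
  have "sub (lst ?Y) (lst X)" by (auto simp: sub_def lst)
  then show "sub (lst (child V X a)) (lst X)" using sub sub_trans by blast
  have "lst (child V X a) i \<subseteq> lst ?Y i" using sub i_n unfolding sub_def by blast
  then show "lst (child V X a) i \<subseteq> {a}" using lst[of i] by auto
  show "hom (lst (child V X a)) \<phi> \<longleftrightarrow> hom (lst X) \<phi> \<and> \<phi> i = a"
    unfolding child_def hom_propagate[OF Y] using i_n by (auto simp: hom_def lst)
qed

lemma solvable_children:
  assumes X: "wfX X" and V: "length V \<le> n" and i: "i < length V" "V ! i" "\<And>j. j < i \<Longrightarrow> \<not> V ! j"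
  shows "solvable X \<longleftrightarrow> (\<exists>a<m. solvable (child V X a))"
proof -
  have i_n: "i < n" using i V by simp
  have "\<phi> i < m" if "hom (lst X) \<phi>" for \<phi>
    using that i_n wfl_lst[of X] by (auto simp: hom_def wfl_def)
  then show ?thesis unfolding solvable_def using child_facts(5)[OF X V i] by blast
qed

text \<open>Between one-element lists arc consistency is adjacency, so the only candidate is a
  solution.\<close>

lemma hom_of_singletons:
  assumes "ac (lst X)" "\<And>v. v < n \<Longrightarrow> card (lst X v) = 1"
  shows "solvable X"
proof -
  define \<phi> where "\<phi> v = the_elem (lst X v)" for v
  have \<phi>: "lst X v = {\<phi> v}" if "v < n" for v
    using assms(2)[OF that] unfolding \<phi>_def by (metis card_1_singletonE the_elem_eq)
  have "cadj (\<phi> u) (\<phi> v)" if "E u v" for u v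
  proof -
    have "lst X v \<subseteq> nbs (lst X u)" using assms(1) that by (auto simp: ac_def)
    then show ?thesis using \<phi>[OF E_less[OF that]] \<phi>[OF E_less2[OF that]] by (auto simp: nbs_def)
  qed
  then have "hom (lst X) \<phi>" using \<phi> by (auto simp: hom_def)
  then show ?thesis unfolding solvable_def by blast
qed

text \<open>Clamping by itself only yields another solution of \<open>X\<close>. As the list of
  \<open>i\<close> in the child is exactly \<open>{a}\<close>, this solution takes the colour
  \<open>a\<close> at \<open>i\<close>, and solutions of \<open>X\<close> with that property are the
  solutions of the child.\<close>

lemma solvable_child_of_good:
  assumes X: "wfX X" "\<And>v. v < n \<Longrightarrow> good (lst X v)" "solvable X"
    and V: "length V \<le> n" and i: "i < length V" "V ! i" "\<And>j. j < i \<Longrightarrow> \<not> V ! j"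
    and ne: "\<not> has_empty (child V X a)"
  shows "solvable (child V X a)"
proof -
  note c = child_facts[OF X(1) V i, of a]
  have i_n: "i < n" using i V by simp
  have ne': "lst (child V X a) v \<noteq> {}" if "v < n" for v using ne that has_empty_iff[OF c(1)] by blast
  obtain \<phi> where "hom (lst X) \<phi>" using X(3) by (auto simp: solvable_def)
  from extend_by_clamping[OF wfl_lst X(2) c(3,2) ne' this] obtain \<psi> where
    \<psi>: "hom (lst X) \<psi>" "\<forall>v<n. card (lst (child V X a) v) = 1 \<longrightarrow> \<psi> v \<in> lst (child V X a) v" by blast
  have "lst (child V X a) i = {a}" using c(4) ne'[OF i_n] by blast
  then have "\<psi> i = a" using \<psi>(2) i_n by auto
  then show ?thesis using c(5)[of \<psi>] \<psi>(1) unfolding solvable_def by blast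
qed

lemma child_mu_less:
  assumes X: "wfX X" and V: "length V \<le> n" and i: "i < length V" "V ! i" "\<And>j. j < i \<Longrightarrow> \<not> V ! j"
    and unf: "unfixed (X ! i)"
  shows "mu (lst (child V X a)) < mu (lst X)"
proof -
  note c = child_facts[OF X V i, of a]
  have "card (lst (child V X a) i) \<le> card {a}" using c(4) by (intro card_mono) auto
  then have "card (lst (child V X a) i) < card (lst X i)" using unf by (simp add: unfixed_def lst_def)
  then show ?thesis using i(1) V by (intro mu_less[OF c(3) wfl_lst, of i]) auto
qed

lemma runs_linear:
  assumes "wfX X"
  shows "runs prog F_anyempty [encs X] (encode_bool (has_empty X)) (N ^ 2)"
    "runs prog F_firstbad [encs X] (encode_bits (mark_first (\<lambda>x. \<not> good (cset x)) X)) (N ^ 2)"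
    "runs prog F_firstunfixed [encs X] (encode_bits (mark_first unfixed X)) (N ^ 2)"
proof -
  have b: "(length X + 1) * N \<le> N ^ 2" using assms pow_absorb1[of "length X"] by simp
  have X: "wfvs X" using assms by blast
  show "runs prog F_anyempty [encs X] (encode_bool (has_empty X)) (N ^ 2)"
    "runs prog F_firstbad [encs X] (encode_bits (mark_first (\<lambda>x. \<not> good (cset x)) X)) (N ^ 2)"
    "runs prog F_firstunfixed [encs X] (encode_bits (mark_first unfixed X)) (N ^ 2)"
    using runs_mono[OF runs_anyempty[OF X] b] runs_mono[OF runs_firstbad[OF X] b]
      runs_mono[OF runs_firstunfixed[OF X] b] .
qed

lemma runs_marks:
  assumes "length V \<le> n"
  shows "runs prog F_marked [encode_bits V] (encode_bool (marks V \<noteq> {})) (N ^ 2)"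
    "runs prog F_unmark [encode_bits V] (encode_bits (unmark V)) (N ^ 2)"
proof -
  have b: "(length V + 1) * N \<le> N ^ 2" using pow_absorb1[OF assms] by simp
  show "runs prog F_marked [encode_bits V] (encode_bool (marks V \<noteq> {})) (N ^ 2)"
    "runs prog F_unmark [encode_bits V] (encode_bits (unmark V)) (N ^ 2)"
    using runs_mono[OF runs_marked b] runs_mono[OF runs_unmark b] by (simp_all add: True_in_set_iff_marks)
qed

text \<open>Induction over the colours still to be tried; \<open>finished\<close> records that all
  others have been rejected. At the end of the chain every colour is rejected and
  \<open>none\<close> justifies the negative answer, while \<open>s\<close> lets the first surviving
  child decide for \<open>X\<close>.\<close>

lemma wp_greedy_chain:
  fixes X :: "bool list list"
  defines "V \<equiv> mark_first unfixed X"
  assumes X: "wfX X" and s: "\<And>a. \<not> has_empty (child V X a) \<Longrightarrow>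
      runs prog F_greedy [encode_list rows, encs (child V X a)] (encode_bool (solvable X)) T"
    and finished: "\<And>a. a < m \<Longrightarrow> a \<notin> set as \<Longrightarrow> has_empty (child V X a)"
    and none: "(\<And>a. a < m \<Longrightarrow> has_empty (child V X a)) \<Longrightarrow> \<not> solvable X"
  shows "wp prog [encode_list rows, encs X] (greedy_chain as)
      (\<lambda>v t. v = encode_bool (solvable X) \<and> t \<le> length as * (6 * N ^ 8) + T + 1)"
  using finished
proof (induction as)
  case Nil
  then show ?case using none by (simp add: greedy_chain_def wp_simps)
next
  case (Cons a as)
  let ?env = "[encode_list rows, encs X]"
  have V: "length V \<le> n" unfolding V_def using length_mark_first[of unfixed X] X by simp
  have e: "wp prog ?env (Call F_firstunfixed [Arg 1]) (\<lambda>v t. v = encode_bits V \<and> t \<le> N ^ 2 + 2)"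
    unfolding V_def using runs_linear(3)[OF X] by (auto simp: wp_simps intro!: runs_call)
  have c: "wp prog ?env (greedy_child a) (\<lambda>v t. v = encs (child V X a) \<and> t \<le> N ^ 2 + 2 + N ^ 8)"
    unfolding greedy_child_def by (rule wp_child[OF X V _ _ _ _ e]) auto
  have wf: "wfX (child V X a)" by (rule wfX_child[OF X V])
  have le: "N ^ 2 \<le> N ^ 8" "100 \<le> N ^ 2" using pow_ge(3)[of 2 8] pow_100[of 2] by auto
  show ?case
  proof (cases "has_empty (child V X a)")
    case True
    have IH: "wp prog ?env (greedy_chain as)
      (\<lambda>v t. v = encode_bool (solvable X) \<and> t \<le> length as * (6 * N ^ 8) + T + 1)"
      using Cons.prems True by (intro Cons.IH) (metis set_ConsD)
    have "wp prog ?env (greedy_chain (a # as)) (\<lambda>v t. v = encode_bool (solvable X) \<and>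
        t \<le> (N ^ 2 + 2 + N ^ 8) + N ^ 2 + 3 + (length as * (6 * N ^ 8) + T + 1))"
      unfolding greedy_chain_def foldr.simps o_apply wp_If wp_Call wps_Cons wps_Nil
      unfolding greedy_chain_def[symmetric]
      using True by (auto intro!: wp_mono[OF c] runs_call[OF runs_linear(1)[OF wf]] wp_mono[OF IH])
    then show ?thesis by (rule wp_mono) (use le in auto)
  next
    case False
    have "wp prog ?env (greedy_chain (a # as)) (\<lambda>v t. v = encode_bool (solvable X) \<and>
        t \<le> (N ^ 2 + 2 + N ^ 8) + N ^ 2 + 6 + (N ^ 2 + 2 + N ^ 8) + T)"
      unfolding greedy_chain_def foldr.simps o_apply wp_If wp_Call wps_Cons wps_Nil
      unfolding greedy_chain_def[symmetric]
      using False by (auto simp: wp_Arg intro!: wp_mono[OF c] runs_call[OF runs_linear(1)[OF wf]] runs_call[OF s])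
    then show ?thesis by (rule wp_mono) (use le in auto)
  qed
qed

lemma runs_greedy:
  assumes "wfX X" "ac (lst X)" "\<not> has_empty X" "\<And>v. v < n \<Longrightarrow> good (lst X v)"
  shows "runs prog F_greedy [encode_list rows, encs X] (encode_bool (solvable X)) ((mu (lst X) + 1) * N ^ 10)"
  using assms
proof (induction "mu (lst X)" arbitrary: X rule: less_induct)
  case less
  note X = less.prems
  let ?V = "mark_first unfixed X"
  have V: "length ?V \<le> n" using length_mark_first[of unfixed X] X by simp
  have le: "N ^ 2 \<le> N ^ 8" "100 \<le> N ^ 2" "51 * N ^ 8 \<le> N ^ 9" "51 * N ^ 9 \<le> N ^ 10"
    using pow_ge(3)[of 2 8] pow_100[of 2] pow_absorb_eq[of 0 9 8] pow_absorb_eq[of 0 10 9] by auto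
  show ?case
  proof (cases "\<exists>x\<in>set X. unfixed x")
    case False
    then have mk: "marks ?V = {}" using marks_mark_first[of unfixed X] by blast
    have "card (lst X v) = 1" if v: "v < n" for v
    proof -
      have "\<not> unfixed (X ! v)" "lst X v \<noteq> {}" using False v X(1,3) has_empty_iff by auto
      moreover have "finite (lst X v)" using wfl_finite[OF wfl_lst v] .
      ultimately show ?thesis by (auto simp: unfixed_def lst_def card_gt_0_iff le_less_Suc_eq not_le less_2_cases_iff)
    qed
    then have sol: "solvable X" using hom_of_singletons X(2) by blast
    have b: "2 * N ^ 2 + 20 \<le> (mu (lst X) + 1) * N ^ 10" using le by simp
    show ?thesis
      using b sol mk
      by (intro runsI[OF prog_nth(29)])
        (auto simp: length_prog greedy_body_def wp_simps
          intro!: runs_call[OF runs_linear(3)[OF X(1)]] runs_call[OF runs_marks(1)[OF V]])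
  next
    case True
    then obtain i where i: "i < length X" "unfixed (X ! i)" "?V = replicate i False @ [True]"
      using mark_first_cases[where P = unfixed and xs = X] by blast
    have iV: "i < length ?V" "?V ! i" "\<And>j. j < i \<Longrightarrow> \<not> ?V ! j"
      using i(3) by (auto simp: nth_append)
    have mk: "marks ?V \<noteq> {}" using True marks_mark_first[of unfixed X] by blast
    have rec: "runs prog F_greedy [encode_list rows, encs (child ?V X a)] (encode_bool (solvable X))
        (mu (lst X) * N ^ 10)" if ne: "\<not> has_empty (child ?V X a)" for a
    proof -
      note c = child_facts[OF X(1) V iV, of a]
      have less: "mu (lst (child ?V X a)) < mu (lst X)" by (rule child_mu_less[OF X(1) V iV i(2)])
      have gd: "good (lst (child ?V X a) v)" if "v < n" for v
        using X(4)[OF that] c(3) that good_subset by (auto simp: sub_def)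
      have "solvable (child ?V X a) \<longleftrightarrow> solvable X"
        using solvable_child_of_good[OF X(1,4) _ V iV ne] c(5) unfolding solvable_def by blast
      moreover have "(mu (lst (child ?V X a)) + 1) * N ^ 10 \<le> mu (lst X) * N ^ 10"
        using less by (intro mult_le_mono1) simp
      ultimately show ?thesis
        using runs_mono[OF less.hyps[OF less c(1,2) ne gd]] by simp
    qed
    have none: "\<not> solvable X" if "\<And>a. a < m \<Longrightarrow> has_empty (child ?V X a)"
      using that solvable_children[OF X(1) V iV] not_solvable_of_empty[OF child_facts(1)[OF X(1) V iV]] by blast
    have "wp prog [encode_list rows, encs X] (greedy_chain [0..<m])
      (\<lambda>v t. v = encode_bool (solvable X) \<and> t \<le> length [0..<m] * (6 * N ^ 8) + mu (lst X) * N ^ 10 + 1)"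
      by (rule wp_greedy_chain[OF X(1) rec _ none]) auto
    note chain = this[simplified]
    have "m * N ^ 8 \<le> N * N ^ 8" using N_facts by (intro mult_le_mono1) linarith
    moreover have "N * N ^ 8 = N ^ 9" by (simp add: power_Suc[symmetric])
    ultimately have b: "m * (6 * N ^ 8) + 2 * N ^ 2 + 20 \<le> N ^ 10" using le by linarith
    show ?thesis
      using b mk
      by (intro runsI[OF prog_nth(29)])
        (auto simp: length_prog greedy_body_def wp_simps
          intro!: runs_call[OF runs_linear(3)[OF X(1)]] runs_call[OF runs_marks(1)[OF V]] wp_mono[OF chain])
  qed
qed

definition suffices :: "bool list \<Rightarrow> bool list list \<Rightarrow> bool" where
  "suffices B X \<longleftrightarrow> (\<forall>L. ac L \<longrightarrow> sub L (lst X) \<longrightarrow> (\<forall>v\<in>marks B. card (L v) \<le> 1) \<longrightarrow>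
     (\<forall>u<n. good (L u)))"

lemma mu_lst_le: "(mu (lst X) + 1) * N ^ 10 \<le> N ^ 12"
proof -
  have "m \<le> N" using N_facts by linarith
  then have "m * n \<le> N * n" by (rule mult_le_mono1)
  moreover have "N * (n + 1) = N * n + N" by simp
  ultimately have "m * n + 1 \<le> N * (n + 1)" using N_facts(1) by linarith
  also have "\<dots> \<le> N * N" using N_facts by (intro mult_le_mono2) simp
  finally have "mu (lst X) + 1 \<le> N * N"
    using mu_le[OF wfl_lst[of X]] by (simp add: mult.commute)
  then have "(mu (lst X) + 1) * N ^ 10 \<le> (N * N) * N ^ 10" by (rule mult_le_mono1)
  also have "\<dots> = N ^ 12" by (simp add: power2_eq_square[symmetric] power_add[symmetric])
  finally show ?thesis .
qed

lemma runs_greedy_poly: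
  assumes "wfX X" "ac (lst X)" "\<not> has_empty X" "\<And>v. v < n \<Longrightarrow> good (lst X v)"
  shows "runs prog F_greedy [encode_list rows, encs X] (encode_bool (solvable X)) (N ^ 12)"
  by (rule runs_mono[OF runs_greedy[OF assms] mu_lst_le])

lemma runs_guess:
  assumes "wfX X" "ac (lst X)" "length B \<le> n" "suffices B X"
  shows "runs prog F_guess [encode_list rows, encode_bits B, encs X] (encode_bool (solvable X))
      ((m + 1) ^ card (marks B) * N ^ 13)"
  using assms
proof (induction "card (marks B)" arbitrary: B X)
  case 0
  note X = "0.prems"
  have "finite (marks B)" by (simp add: marks_def)
  then have mk: "marks B = {}" using 0 by simp
  have "51 * N ^ 12 \<le> N ^ 13" "N ^ 2 \<le> N ^ 12" "100 \<le> N ^ 12"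
    using pow_absorb_eq[of 0 13 12] pow_ge(3)[of 2 12] pow_100[of 12] by auto
  then have b: "N ^ 12 + 2 * N ^ 2 + 20 \<le> N ^ 13" by linarith
  show ?case
  proof (cases "has_empty X")
    case True
    then show ?thesis using b mk not_solvable_of_empty[OF X(1)]
      by (intro runsI[OF prog_nth(28)])
        (auto simp: length_prog guess_body_def wp_If wp_Call wps_Cons wps_Nil wp_Arg wp_Nil
          intro!: runs_call[OF runs_linear(1)[OF X(1)]])
  next
    case False
    have "good (lst X v)" if "v < n" for v
      using X(4) X(2) sub_refl mk that unfolding suffices_def by blast
    note g = runs_greedy_poly[OF X(1,2) False this]
    show ?thesis using b mk False
      by (intro runsI[OF prog_nth(28)])
        (auto simp: length_prog guess_body_def wp_If wp_Call wps_Cons wps_Nil wp_Arg wp_Nil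
          intro!: runs_call[OF runs_linear(1)[OF X(1)]] runs_call[OF runs_marks(1)[OF X(3)]] runs_call[OF g])
  qed
next
  case (Suc b)
  note X = Suc.prems
  have mk: "marks B \<noteq> {}" using Suc by auto
  then obtain i where i: "i < length B" "B ! i" "\<And>j. j < i \<Longrightarrow> \<not> B ! j"
    using first_mark by blast
  have um: "unmark B = B[i := False]" by (rule unmark_first[OF i])
  have marks_um: "marks (unmark B) = marks B - {i}"
    unfolding um using i(1) by (auto simp: marks_def nth_list_update split: if_splits)
  have "i \<in> marks B" "finite (marks B)" using i by (auto simp: marks_def)
  then have card_um: "b = card (marks (unmark B))" using Suc(2) marks_um by simp
  have len_um: "length (unmark B) \<le> n" using X um by simp
  define T where "T = (m + 1) ^ b * N ^ 13"
  have rec: "runs prog F_guess [encode_list rows, encode_bits (unmark B), encs (child B X a)]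
      (encode_bool (solvable (child B X a))) T" for a
  proof -
    note c = child_facts[OF X(1,3) i, of a]
    have "suffices (unmark B) (child B X a)"
      unfolding suffices_def
    proof (intro allI impI)
      fix L u assume L: "ac L" "sub L (lst (child B X a))" "\<forall>v\<in>marks (unmark B). card (L v) \<le> 1" and u: "u < n"
      have "L i \<subseteq> {a}" using L(2) c(4) i(1) X(3) unfolding sub_def by (meson less_le_trans subset_trans)
      then have "card (L i) \<le> card {a}" by (intro card_mono) auto
      then have "\<forall>v\<in>marks B. card (L v) \<le> 1" using L(3) marks_um by auto
      moreover have "sub L (lst X)" using L(2) c(3) by (rule sub_trans)
      ultimately show "good (L u)" using X(4) L(1) u unfolding suffices_def by blast
    qed
    then have "runs prog F_guess [encode_list rows, encode_bits (unmark B), encs (child B X a)]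
      (encode_bool (solvable (child B X a))) ((m + 1) ^ card (marks (unmark B)) * N ^ 13)"
      by (intro Suc.hyps(1) card_um c(1,2) len_um)
    then show ?thesis unfolding T_def card_um .
  qed
  let ?env = "[encode_list rows, encode_bits B, encs X]"
  have e: "wp prog ?env (Arg 1) (\<lambda>v t. v = encode_bits B \<and> t \<le> 1)" by (simp add: wp_simps)
  have child: "wp prog ?env (child_expr (Arg 0) (Arg 1) (Arg 2) a) (\<lambda>v t. v = encs (child B X a) \<and> t \<le> 1 + N ^ 8)" for a
    by (rule wp_child[OF X(1,3) _ _ _ _ e]) auto
  have "N ^ 2 \<le> N ^ 8" "100 \<le> N ^ 2" using pow_ge(3)[of 2 8] pow_100[of 2] by auto
  then have le: "N ^ 8 + N ^ 2 + 10 \<le> 3 * N ^ 8" by linarith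
  let ?es = "map (\<lambda>a. Call F_guess [Arg 0, Call F_unmark [Arg 1], child_expr (Arg 0) (Arg 1) (Arg 2) a]) [0..<m]"
  have "wp prog ?env (or_chain ?es)
    (\<lambda>v t. v = encode_bool (\<exists>i<length ?es. solvable (child B X i)) \<and>
       t \<le> (\<Sum>i<length ?es. 3 * N ^ 8 + T) + 4 * length ?es + 1)"
  proof (rule wp_or_chain)
    fix a assume a: "a < length ?es"
    then have "?es ! a = Call F_guess [Arg 0, Call F_unmark [Arg 1], child_expr (Arg 0) (Arg 1) (Arg 2) a]" by simp
    then show "wp prog ?env (?es ! a) (\<lambda>v t. v = encode_bool (solvable (child B X a)) \<and> t \<le> 3 * N ^ 8 + T)"
      using le
      by (auto simp: wp_Call wps_Cons wps_Nil wp_Arg intro!: runs_call[OF runs_marks(2)[OF X(3)]]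
        wp_mono[OF child[unfolded One_nat_def]] runs_call[OF rec])
  qed
  then have chain: "wp prog ?env (or_chain ?es)
    (\<lambda>v t. v = encode_bool (solvable X) \<and> t \<le> m * (3 * N ^ 8 + T) + 4 * m + 1)"
    using solvable_children[OF X(1,3) i] by simp
  \<comment> \<open>The base is m + 1 because the \<open>m\<close> recursive calls use
    \<open>m * T\<close> and all other work of this call fits into one more
    \<open>T\<close>.\<close>
  have bound: "m * (3 * N ^ 8 + T) + 4 * m + 1 + 2 * N ^ 2 + 20 \<le> (m + 1) ^ card (marks B) * N ^ 13"
  proof -
    have "m * N ^ 8 \<le> N * N ^ 8" using N_facts by (intro mult_le_mono1) linarith
    moreover have "N * N ^ 8 = N ^ 9" by (simp add: power_Suc[symmetric])
    moreover have "51 * N ^ 9 \<le> N ^ 10" "N ^ 10 \<le> N ^ 13" "N ^ 2 \<le> N ^ 9" "N ^ 1 \<le> N ^ 9"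
      using pow_absorb_eq[of 0 10 9] pow_ge(3)[of 10 13] pow_ge(3)[of 2 9] pow_ge(3)[of 1 9] by auto
    ultimately have "3 * (m * N ^ 8) + 4 * m + 1 + 2 * N ^ 2 + 20 \<le> N ^ 13"
      using N_facts by (simp only: power_one_right)
    moreover have "N ^ 13 \<le> T" unfolding T_def by simp
    ultimately have "m * (3 * N ^ 8 + T) + 4 * m + 1 + 2 * N ^ 2 + 20 \<le> m * T + T"
      by (simp add: algebra_simps)
    also have "\<dots> = (m + 1) ^ card (marks B) * N ^ 13" unfolding T_def Suc(2)[symmetric] by (simp add: algebra_simps)
    finally show ?thesis .
  qed
  show ?case
  proof (cases "has_empty X")
    case True
    then show ?thesis using bound not_solvable_of_empty[OF X(1)]
      by (intro runsI[OF prog_nth(28)])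
        (auto simp: length_prog guess_body_def wp_If wp_Call wps_Cons wps_Nil wp_Arg wp_Nil
          intro!: runs_call[OF runs_linear(1)[OF X(1)]])
  next
    case False
    have "wp prog ?env guess_body (\<lambda>v t. v = encode_bool (solvable X) \<and>
       t \<le> m * (3 * N ^ 8 + T) + 4 * m + 1 + 2 * N ^ 2 + 20)"
      unfolding guess_body_def wp_If wp_Call wps_Cons wps_Nil wp_Arg wp_Nil
      using mk False
      by (auto intro!: runs_call[OF runs_linear(1)[OF X(1)]] runs_call[OF runs_marks(1)[OF X(3)]]
        wp_mono[OF chain[unfolded One_nat_def]])
    then show ?thesis
      by (intro runsI[OF prog_nth(28)]) (use bound in \<open>auto simp: length_prog elim!: wp_mono\<close>)
  qed
qed

section \<open>Cost of the branching phase\<close>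

definition thr :: nat where
  "thr = (LEAST e. length W \<le> e ^ (k + 2))"

text \<open>Half of \<open>thr\<close>, rounded up: when two children together lose at least
  \<open>thr\<close>, one of them loses at least this much.\<close>

definition drop_size :: nat where
  "drop_size = (thr + 1) div 2"

text \<open>A solution of the recurrence \<open>T x \<ge> 1 + T (x - 1) + (m - 1) * T (x - d)\<close> of the branching phase.\<close>

definition leaves :: "nat \<Rightarrow> nat" where
  "leaves x = (x + 1) * N ^ (3 * (x div drop_size + 1))"

text \<open>Charged to every node of the branching tree; inner nodes are the summand 1 in the
  recurrence. It covers guessing on a ball of at most \<open>thr ^ (k + 1)\<close> vertices and the
  polynomial work of a node.\<close>

definition leaf_cost :: nat where
  "leaf_cost = (m + 1) ^ (thr ^ (k + 1)) * N ^ (k + 14)"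

text \<open>\<open>thr\<close> is the bound d of the overview and exists only in the analysis; the
  program tests the inequality of powers. The least element exists because \<open>length W\<close>
  is itself a candidate.\<close>

lemma thr_le_iff: "thr \<le> c \<longleftrightarrow> length W \<le> c ^ (k + 2)"
proof
  have "length W \<le> length W ^ (k + 2)"
  proof (cases "W = []")
    case False
    then show ?thesis by (intro self_le_power) (auto simp: Suc_le_eq)
  qed simp
  then have "length W \<le> thr ^ (k + 2)" unfolding thr_def by (rule LeastI)
  then show "length W \<le> c ^ (k + 2)" if "thr \<le> c" using power_mono[OF that, of "k + 2"] by simp
qed (simp add: thr_def Least_le)

lemma drop_size_pos: "W \<noteq> [] \<Longrightarrow> 0 < drop_size"
  using thr_le_iff[of 0] by (auto simp: drop_size_def)

lemma leaves_mono: "x \<le> y \<Longrightarrow> leaves x \<le> leaves y"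
  unfolding leaves_def using N_facts
  by (intro mult_le_mono power_increasing) (auto intro: div_le_mono)

text \<open>With q = x div d, the child that loses only 1 takes \<open>x\<close> of the
  \<open>x + 1\<close> copies of N ^ (3 (q + 1)). The other children have quotient q - 1, so
  together with the summand 1 they take at most m (x + 1) N ^ (3 q). Since m (x + 1) \<le> N ^ 3,
  this fits into the remaining copy; hence the 3 in \<open>leaves\<close>.\<close>

lemma leaves_step:
  assumes d: "0 < drop_size" "drop_size \<le> x" and x: "x \<le> n * m"
  shows "1 + leaves (x - 1) + (m - 1) * leaves (x - drop_size) \<le> leaves x"
proof -
  define d q where "d = drop_size" and "q = x div d"
  have q: "(x - d) div d = q - 1" "1 \<le> q" using d by (auto simp: q_def d_def le_div_geq div_greater_zero_iff Suc_le_eq)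
  then have e: "3 * ((x - d) div d + 1) = 3 * q" by simp
  have "leaves (x - 1) \<le> (x - 1 + 1) * N ^ (3 * (q + 1))"
    unfolding leaves_def q_def d_def using N_facts
    by (intro mult_le_mono2 power_increasing) (auto intro: div_le_mono)
  then have 1: "leaves (x - 1) \<le> x * N ^ (3 * (q + 1))" using d by simp
  have 2: "leaves (x - d) \<le> (x + 1) * N ^ (3 * q)"
    unfolding leaves_def d_def[symmetric] e by (intro mult_le_mono1) simp
  have "1 + (m - 1) * leaves (x - d) \<le> (x + 1) * N ^ (3 * q) + (m - 1) * ((x + 1) * N ^ (3 * q))"
    using 2 pow_ge(2)[of "3 * q"] by (intro add_mono mult_le_mono2) (auto simp: Suc_le_eq)
  also have "\<dots> = (m * (x + 1)) * N ^ (3 * q)" using m_ge by (cases m) (auto simp: algebra_simps)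
  also have "\<dots> \<le> N ^ 3 * N ^ (3 * q)"
  proof (rule mult_le_mono1)
    have mN: "m \<le> N" using N_facts by linarith
    have "m * n \<le> N * n" using mN by (rule mult_le_mono1)
    moreover have "N * (n + 1) = N * n + N" by simp
    ultimately have "n * m + 1 \<le> N * (n + 1)" using N_facts(1) by (simp only: mult.commute[of n m])
    also have "\<dots> \<le> N * N" using N_facts by (intro mult_le_mono2) simp
    finally have "x + 1 \<le> N * N" using x by linarith
    then have "m * (x + 1) \<le> N * (N * N)" using mN by (intro mult_le_mono)
    then show "m * (x + 1) \<le> N ^ 3" by (simp add: power3_eq_cube mult.assoc)
  qed
  also have "\<dots> = N ^ (3 * (q + 1))" by (simp add: power_add[symmetric] algebra_simps)
  finally have "1 + leaves (x - 1) + (m - 1) * leaves (x - d) \<le> (x + 1) * N ^ (3 * (q + 1))"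
    using 1 by (simp add: algebra_simps)
  then show ?thesis unfolding leaves_def[of x] d_def q_def .
qed

lemma leaves_ge_1: "1 \<le> leaves x"
  unfolding leaves_def using mult_le_mono[OF _ pow_ge(2), of 1 "x + 1"] by simp

lemma leaf_cost_ge:
  "(m + 1) ^ (thr ^ (k + 1)) * N ^ 13 + N ^ (k + 8) \<le> leaf_cost"
proof -
  define P where "P = (m + 1) ^ (thr ^ (k + 1))"
  have P: "1 \<le> P" by (simp add: P_def)
  have "P * N ^ 13 \<le> P * N ^ (k + 13)" by (intro mult_le_mono2 pow_ge(3)) simp
  moreover have "N ^ (k + 8) \<le> N ^ (k + 13)" by (rule pow_ge(3)) simp
  moreover have "1 * N ^ (k + 13) \<le> P * N ^ (k + 13)" using P by (rule mult_le_mono1)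
  moreover have "P * (51 * N ^ (k + 13)) \<le> P * N ^ (k + 14)"
    using pow_absorb_eq[of 0 "k + 14" "k + 13"] by (intro mult_le_mono2) simp
  ultimately show ?thesis unfolding leaf_cost_def P_def[symmetric] by linarith
qed

lemma branch_overhead:
  "m * (N ^ (k + 6) + N ^ 8 + 20) + 4 * m + N ^ (k + 6) + (k + 1) * (N ^ 4 + 3) + N ^ 12 + 5 * N ^ 2 + 50 \<le> N ^ (k + 8) + N ^ 12"
proof -
  define A B where "A = N ^ (k + 6)" and "B = N ^ (k + 7)"
  have le: "N ^ 8 \<le> A" "N ^ 4 \<le> A" "N ^ 2 \<le> A" "N ^ 1 \<le> A" "100 \<le> A"
    unfolding A_def using k_ge_2 pow_ge(3)[of 8 "k + 6"] pow_ge(3)[of 4 "k + 6"] pow_ge(3)[of 2 "k + 6"]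
      pow_ge(3)[of 1 "k + 6"] pow_100[of "k + 6"] by auto
  have AB: "51 * A \<le> B" "51 * B \<le> N ^ (k + 8)"
    unfolding A_def B_def using pow_absorb_eq[of 0 "k + 7" "k + 6"] pow_absorb_eq[of 0 "k + 8" "k + 7"] by auto
  have "k + 7 = Suc (k + 6)" by simp
  then have B: "N * A = B" unfolding A_def B_def by (simp only: power_Suc)
  have mN: "m \<le> N" "k + 1 \<le> N" using N_facts by (auto simp: m_def)
  have "m * (A + N ^ 8 + 20) \<le> N * (A + A + A)" using mN le by (intro mult_le_mono) auto
  also have "\<dots> = 3 * B" unfolding B[symmetric] by simp
  finally have 1: "m * (A + N ^ 8 + 20) \<le> 3 * B" .
  have "(k + 1) * (N ^ 4 + 3) \<le> N * (A + A)" using mN le by (intro mult_le_mono) auto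
  also have "\<dots> = 2 * B" unfolding B[symmetric] by simp
  finally have 2: "(k + 1) * (N ^ 4 + 3) \<le> 2 * B" .
  show ?thesis unfolding A_def[symmetric] using 1 2 AB le mN by (simp only: power_one_right)
qed

lemma count_row:
  assumes "wfX X" "v < n"
  shows "count (R ! v) X = card {u. E v u \<and> 2 \<le> card (lst X u)}"
proof -
  have "length (R ! v) = n" using length_row length_R assms by simp
  then have "count (R ! v) X = card {u. u < length X \<and> R ! v ! u \<and> unfixed (X ! u)}"
    using assms by (intro count_eq_card) simp
  also have "{u. u < length X \<and> R ! v ! u \<and> unfixed (X ! u)} = {u. E v u \<and> 2 \<le> card (lst X u)}"
    using assms by (auto simp: E_def unfixed_def lst_def)
  finally show ?thesis .
qed

lemma heavy_cases:
  assumes X: "wfX X"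
  obtains i where "i < n" "unfixed (X ! i)" "thr \<le> card {u. E i u \<and> 2 \<le> card (lst X u)}"
      "heavy X = replicate i False @ [True]"
  | "marks (heavy X) = {}"
      "\<And>v. v < n \<Longrightarrow> 2 \<le> card (lst X v) \<Longrightarrow> card {u. E v u \<and> 2 \<le> card (lst X u)} < thr"
proof -
  let ?P = "\<lambda>(r, x). is_heavy X r x"
  have len: "length (zip R X) = n" using X length_R by simp
  have nth: "zip R X ! v = (R ! v, X ! v)" if "v < n" for v using that X length_R by simp
  have hv: "is_heavy X (R ! v) (X ! v) \<longleftrightarrow>
      unfixed (X ! v) \<and> thr \<le> card {u. E v u \<and> 2 \<le> card (lst X u)}" if "v < n" for v
    unfolding is_heavy_def thr_le_iff count_row[OF X that] ..
  from mark_first_cases[where P = ?P and xs = "zip R X"] show ?thesis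
  proof
    assume *: "(\<forall>p\<in>set (zip R X). \<not> ?P p) \<and> mark_first ?P (zip R X) = replicate (length (zip R X)) False"
    have "marks (heavy X) = {}" unfolding heavy_def using * by (auto simp: marks_def)
    moreover have "card {u. E v u \<and> 2 \<le> card (lst X u)} < thr" if v: "v < n" "2 \<le> card (lst X v)" for v
    proof -
      have "(R ! v, X ! v) \<in> set (zip R X)" using nth[OF v(1)] len v(1) nth_mem[of v "zip R X"] by simp
      then have "\<not> is_heavy X (R ! v) (X ! v)" using * by blast
      then show ?thesis using hv[OF v(1)] v(2) by (simp add: unfixed_def lst_def not_le)
    qed
    ultimately show ?thesis by (rule that(2))
  next
    assume "\<exists>i<length (zip R X). ?P (zip R X ! i) \<and> mark_first ?P (zip R X) = replicate i False @ [True]"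
    then obtain i where i: "i < length (zip R X)" "?P (zip R X ! i)"
      "mark_first ?P (zip R X) = replicate i False @ [True]" by (elim exE conjE)
    have i_n: "i < n" using i(1) unfolding len .
    have "is_heavy X (R ! i) (X ! i)" using i(2) unfolding nth[OF i_n] by simp
    then have "unfixed (X ! i)" "thr \<le> card {u. E i u \<and> 2 \<le> card (lst X u)}" using hv[OF i_n] by simp_all
    then show ?thesis using that(1)[OF i_n] i(3) unfolding heavy_def by simp
  qed
qed

text \<open>Of any two children one loses at least \<open>drop_size\<close>, so at most one colour
  \<open>a0\<close> is exceptional. Its child still loses 1, because the list of the chosen vertex
  shrinks to at most one colour.\<close>

lemma heavy_children_leaves:
  assumes X: "wfX X" and i: "i < n" "unfixed (X ! i)" "thr \<le> card {u. E i u \<and> 2 \<le> card (lst X u)}"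
    "heavy X = replicate i False @ [True]" and W: "W \<noteq> []"
  shows "1 + (\<Sum>a<m. leaves (mu (lst (child (heavy X) X a)))) \<le> leaves (mu (lst X))"
proof -
  define f where "f a = mu (lst (child (heavy X) X a))" for a
  define x where "x = mu (lst X)"
  have V: "length (heavy X) \<le> n" by (rule length_heavy[OF X])
  have iV: "i < length (heavy X)" "heavy X ! i" "\<And>j. j < i \<Longrightarrow> \<not> heavy X ! j"
    using i(4) by (auto simp: nth_append)
  note c = child_facts[OF X V iV]
  have less: "f a \<le> x - 1" for a
    using child_mu_less[OF X V iV i(2), of a] by (simp add: f_def x_def)
  have pair: "f a + drop_size \<le> x \<or> f b + drop_size \<le> x" if "a \<noteq> b" for a b
  proof -
    have "f a + f b + thr \<le> 2 * x"
      using two_branches_mu[OF wfl_lst that c(3,2,4) c(3,2,4)] i(3) unfolding f_def x_def by linarith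
    then show ?thesis unfolding drop_size_def by linarith
  qed
  obtain a0 where a0: "a0 < m" "\<And>a. a < m \<Longrightarrow> a \<noteq> a0 \<Longrightarrow> f a + drop_size \<le> x"
  proof (cases "\<exists>a<m. \<not> f a + drop_size \<le> x")
    case True
    then show ?thesis using that pair by blast
  next
    case False
    then show ?thesis using that[of 0] m_ge by blast
  qed
  \<comment> \<open>Any colour other than \<open>a0\<close> serves: its loss shows
    \<open>drop_size \<le> x\<close>, as \<open>leaves_step\<close> requires.\<close>
  define a1 where "a1 = (if a0 = 0 then 1 else 0 :: nat)"
  have "f a1 + drop_size \<le> x" using a0(2)[of a1] m_ge by (auto simp: a1_def)
  then have dx: "drop_size \<le> x" by simp
  have "(\<Sum>a<m. leaves (f a)) = leaves (f a0) + (\<Sum>a\<in>{..<m} - {a0}. leaves (f a))"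
    using a0(1) by (intro sum.remove) auto
  also have "\<dots> \<le> leaves (x - 1) + (\<Sum>a\<in>{..<m} - {a0}. leaves (x - drop_size))"
  proof (intro add_mono sum_mono leaves_mono less)
    fix a assume "a \<in> {..<m} - {a0}"
    then have "f a + drop_size \<le> x" using a0(2) by auto
    then show "f a \<le> x - drop_size" by simp
  qed
  also have "\<dots> = leaves (x - 1) + (m - 1) * leaves (x - drop_size)" using a0(1) by simp
  finally show ?thesis
    using leaves_step[OF drop_size_pos[OF W] dx] mu_le[OF wfl_lst[of X]] unfolding x_def f_def by simp
qed

lemma firstbad_cases:
  assumes X: "wfX X"
  obtains i where "i < n" "\<not> good (lst X i)" "mark_first (\<lambda>x. \<not> good (cset x)) X = replicate i False @ [True]"
  | "marks (mark_first (\<lambda>x. \<not> good (cset x)) X) = {}" "\<And>v. v < n \<Longrightarrow> good (lst X v)"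
proof -
  let ?P = "\<lambda>x. \<not> good (cset x)"
  have len: "length X = n" using X by blast
  from mark_first_cases[where P = ?P and xs = X] show ?thesis
  proof
    assume *: "(\<forall>x\<in>set X. \<not> ?P x) \<and> mark_first ?P X = replicate (length X) False"
    have "marks (mark_first ?P X) = {}" using * by (auto simp: marks_def)
    moreover have "good (lst X v)" if "v < n" for v
      using * nth_mem[of v X] that len unfolding lst_def by blast
    ultimately show ?thesis by (rule that(2))
  next
    assume "\<exists>i<length X. ?P (X ! i) \<and> mark_first ?P X = replicate i False @ [True]"
    then show ?thesis using that(1) unfolding len lst_def by blast
  qed
qed

lemma runs_branch:
  assumes diam: "\<And>u v. u < n \<Longrightarrow> v < n \<Longrightarrow> \<exists>l\<le>k + 2. (E ^^ l) u v" and W: "0 < n \<Longrightarrow> W \<noteq> []"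
    and "wfX X" "ac (lst X)"
  shows "runs prog F_branch [encode_list rows, encode_list W, encs X] (encode_bool (solvable X))
      (leaves (mu (lst X)) * leaf_cost)"
  using assms(3-)
proof (induction "mu (lst X)" arbitrary: X rule: less_induct)
  case less
  note X = less.prems
  let ?env = "[encode_list rows, encode_list W, encs X]"
  let ?O = "N ^ (k + 8)"
  have tot: "leaf_cost \<le> leaves (mu (lst X)) * leaf_cost"
    using mult_le_mono1[OF leaves_ge_1, of leaf_cost] by simp
  have V: "length (heavy X) \<le> n" by (rule length_heavy[OF X(1)])
  have e: "wp prog ?env heavy_expr (\<lambda>v t. v = encode_bits (heavy X) \<and> t \<le> N ^ (k + 6) + 5)"
    unfolding heavy_expr_def using runs_heavy[OF X(1)] by (auto simp: wp_simps intro!: runs_call)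
  have P: "1 \<le> (m + 1) ^ (thr ^ (k + 1))" by simp
  have ov: "m * (N ^ (k + 6) + N ^ 8 + 20) + 4 * m + N ^ (k + 6) + (k + 1) * (N ^ 4 + 3) + 5 * N ^ 2 + 50 \<le> ?O"
    using branch_overhead by simp
  show ?case
  proof (cases "has_empty X")
    case True
    have "N ^ 2 + 10 \<le> leaves (mu (lst X)) * leaf_cost" using ov tot leaf_cost_ge by linarith
    then show ?thesis using True not_solvable_of_empty[OF X(1) True]
      by (intro runsI[OF prog_nth(27)])
        (auto simp: length_prog branch_body_def wp_If wp_Call wps_Cons wps_Nil wp_Arg wp_Nil
          intro!: runs_call[OF runs_linear(1)[OF X(1)]])
  next
    case nonempty: False
    from X(1) show ?thesis
    proof (cases rule: heavy_cases)
      case (1 i)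
      have W': "W \<noteq> []" using W 1(1) by simp
      have mk: "marks (heavy X) \<noteq> {}" using 1(4) by (simp add: marks_single)
      have iV: "i < length (heavy X)" "heavy X ! i" "\<And>j. j < i \<Longrightarrow> \<not> heavy X ! j"
        using 1(4) by (auto simp: nth_append)
      define T where "T a = leaves (mu (lst (child (heavy X) X a))) * leaf_cost" for a
      have rec: "runs prog F_branch [encode_list rows, encode_list W, encs (child (heavy X) X a)]
          (encode_bool (solvable (child (heavy X) X a))) (T a)" for a
        unfolding T_def
        by (rule less.hyps[OF child_mu_less[OF X(1) V iV 1(2)] child_facts(1,2)[OF X(1) V iV]])
      have child: "wp prog ?env (child_expr (Arg 0) heavy_expr (Arg 2) a)
          (\<lambda>v t. v = encs (child (heavy X) X a) \<and> t \<le> N ^ (k + 6) + 5 + N ^ 8)" for a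
        by (rule wp_child[OF X(1) V _ _ _ _ e]) auto
      let ?es = "map (\<lambda>a. Call F_branch [Arg 0, Arg 1, child_expr (Arg 0) heavy_expr (Arg 2) a]) [0..<m]"
      have "wp prog ?env (or_chain ?es)
        (\<lambda>v t. v = encode_bool (\<exists>a<length ?es. solvable (child (heavy X) X a)) \<and>
           t \<le> (\<Sum>a<length ?es. N ^ (k + 6) + N ^ 8 + 20 + T a) + 4 * length ?es + 1)"
      proof (rule wp_or_chain)
        fix a assume a: "a < length ?es"
        then have "?es ! a = Call F_branch [Arg 0, Arg 1, child_expr (Arg 0) heavy_expr (Arg 2) a]" by simp
        then show "wp prog ?env (?es ! a)
          (\<lambda>v t. v = encode_bool (solvable (child (heavy X) X a)) \<and> t \<le> N ^ (k + 6) + N ^ 8 + 20 + T a)"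
          by (auto simp: wp_Call wps_Cons wps_Nil wp_Arg intro!: wp_mono[OF child] runs_call[OF rec])
      qed
      then have chain: "wp prog ?env (or_chain ?es) (\<lambda>v t. v = encode_bool (solvable X) \<and>
          t \<le> m * (N ^ (k + 6) + N ^ 8 + 20) + (\<Sum>a<m. T a) + 4 * m + 1)"
        using solvable_children[OF X(1) V iV] by (simp add: sum.distrib)
      have "leaf_cost + (\<Sum>a<m. T a) = (1 + (\<Sum>a<m. leaves (mu (lst (child (heavy X) X a))))) * leaf_cost"
        unfolding T_def distrib_right sum_distrib_right by simp
      also have "\<dots> \<le> leaves (mu (lst X)) * leaf_cost"
        by (intro mult_le_mono1 heavy_children_leaves[OF X(1) 1 W'])
      finally have b: "m * (N ^ (k + 6) + N ^ 8 + 20) + (\<Sum>a<m. T a) + 4 * m + 1 + N ^ (k + 6) + 2 * N ^ 2 + 30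
          \<le> leaves (mu (lst X)) * leaf_cost"
        using ov leaf_cost_ge by linarith
      \<comment> \<open>Hiding the powers behind constants leaves only linear inequalities to the
        symbolic execution.\<close>
      define C D where "C = m * (N ^ (k + 6) + N ^ 8 + 20) + (\<Sum>a<m. T a) + 4 * m + 1" and "D = N ^ (k + 6)"
      define ch where "ch = or_chain ?es"
      note chain = chain[folded C_def ch_def] and b = b[folded C_def D_def] and e = e[folded D_def]
      have "wp prog ?env branch_body (\<lambda>v t. v = encode_bool (solvable X) \<and> t \<le> C + D + 2 * N ^ 2 + 30)"
        unfolding branch_body_def ch_def[symmetric] wp_If wp_Call wps_Cons wps_Nil wp_Arg wp_Nil
        using mk nonempty
        by (auto intro!: runs_call[OF runs_linear(1)[OF X(1)]] wp_mono[OF e] runs_call[OF runs_marks(1)[OF V]]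
          wp_mono[OF chain])
      then show ?thesis
        by (intro runsI[OF prog_nth(27)]) (use b in \<open>auto simp: length_prog elim!: wp_mono order_trans\<close>)
    next
      case light: 2
      let ?B = "mark_first (\<lambda>x. \<not> good (cset x)) X"
      have B: "length ?B \<le> n" using length_mark_first[of "\<lambda>x. \<not> good (cset x)" X] X(1) by simp
      have eB: "wp prog ?env (Call F_firstbad [Arg 2]) (\<lambda>v t. v = encode_bits ?B \<and> t \<le> N ^ 2 + 2)"
        using runs_linear(2)[OF X(1)] by (auto simp: wp_simps intro!: runs_call)
      from X(1) show ?thesis
      proof (cases rule: firstbad_cases)
        case (1 i)
        have mk: "marks ?B \<noteq> {}" "marks ?B = {i}" using 1(3) by (simp_all add: marks_single)
        define B' where "B' = ((\<lambda>B. grow R X B B) ^^ (k + 1)) ?B"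
        have ball: "marks B' = (bstep (lst X) ^^ (k + 1)) {i}" "length B' \<le> n"
          using marks_grow_pow[OF X(1) B, of "k + 1"] mk(2) unfolding B'_def by simp_all
        have eB': "wp prog ?env (((\<lambda>e. Call F_ball [Arg 0, Arg 2, e]) ^^ (k + 1)) (Call F_firstbad [Arg 2]))
            (\<lambda>v t. v = encode_bits B' \<and> t \<le> N ^ 2 + 2 + (k + 1) * (N ^ 4 + 3))"
          unfolding B'_def by (rule wp_ball_pow[OF X(1) B _ _ _ eB]) auto
        \<comment> \<open>Lists with at most one colour are good, so a vertex with a bad list is
          unfixed and can be the centre of the ball.\<close>
        have "2 \<le> card (lst X i)"
          using 1(1,2) good_singleton[of "lst X i"] wfl_finite[OF wfl_lst 1(1)] wfl_lst[of X]
          by (fastforce simp: wfl_def)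
        then have card: "card (marks B') \<le> thr ^ (k + 1)"
          unfolding ball(1) using light(2) 1(1) by (intro card_ball) auto
        have "suffices B' X"
          unfolding suffices_def ball(1)
          using good_of_fixed_ball[OF wfl_lst X(2) 1(1,2) diam[OF 1(1)]] by blast
        note g = runs_guess[OF X ball(2) this]
        have "(m + 1) ^ card (marks B') * N ^ 13 \<le> (m + 1) ^ (thr ^ (k + 1)) * N ^ 13"
          using card by (intro mult_le_mono1 power_increasing) auto
        then have b: "(m + 1) ^ card (marks B') * N ^ 13 + N ^ (k + 6) + (k + 1) * (N ^ 4 + 3) + 5 * N ^ 2 + 50
            \<le> leaves (mu (lst X)) * leaf_cost"
          using ov tot leaf_cost_ge by linarith
        define C D F where "C = (m + 1) ^ card (marks B') * N ^ 13" and "D = N ^ (k + 6)"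
          and "F = (k + 1) * (N ^ 4 + 3)"
        define eX where "eX = ((\<lambda>e. Call F_ball [Arg 0, Arg 2, e]) ^^ (k + 1)) (Call F_firstbad [Arg 2])"
        define ch where "ch = or_chain (map (\<lambda>a. Call F_branch [Arg 0, Arg 1, child_expr (Arg 0) heavy_expr (Arg 2) a]) [0..<m])"
        note eB' = eB'[folded F_def eX_def] and b = b[folded C_def D_def F_def] and e = e[folded D_def]
          and g = g[folded C_def]
        have "wp prog ?env branch_body (\<lambda>v t. v = encode_bool (solvable X) \<and> t \<le> C + D + F + 5 * N ^ 2 + 50)"
          unfolding branch_body_def eX_def[symmetric] ch_def[symmetric] wp_If wp_Call wps_Cons wps_Nil wp_Arg wp_Nil
          using light(1) mk(1) nonempty
          by (auto intro!: runs_call[OF runs_linear(1)[OF X(1)]] wp_mono[OF e] runs_call[OF runs_marks(1)[OF V]]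
             runs_call[OF runs_marks(1)[OF B]] runs_call[OF runs_linear(2)[OF X(1)]] wp_mono[OF eB'] runs_call[OF g])
        then show ?thesis
          by (intro runsI[OF prog_nth(27)]) (use b in \<open>auto simp: length_prog elim!: wp_mono order_trans\<close>)
      next
        case 2
        note g = runs_greedy_poly[OF X nonempty 2(2)]
        have "1 * N ^ 13 \<le> (m + 1) ^ (thr ^ (k + 1)) * N ^ 13" using P by (rule mult_le_mono1)
        moreover have "N ^ 12 \<le> N ^ 13" by (rule pow_ge(3)) simp
        ultimately have b: "N ^ 12 + N ^ (k + 6) + 5 * N ^ 2 + 50 \<le> leaves (mu (lst X)) * leaf_cost"
          using ov tot leaf_cost_ge by linarith
        define D where "D = N ^ (k + 6)"
        define eX where "eX = ((\<lambda>e. Call F_ball [Arg 0, Arg 2, e]) ^^ (k + 1)) (Call F_firstbad [Arg 2])"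
        define ch where "ch = or_chain (map (\<lambda>a. Call F_branch [Arg 0, Arg 1, child_expr (Arg 0) heavy_expr (Arg 2) a]) [0..<m])"
        note b = b[folded D_def] and e = e[folded D_def]
        have "wp prog ?env branch_body (\<lambda>v t. v = encode_bool (solvable X) \<and> t \<le> N ^ 12 + D + 5 * N ^ 2 + 50)"
          unfolding branch_body_def eX_def[symmetric] ch_def[symmetric] wp_If wp_Call wps_Cons wps_Nil wp_Arg wp_Nil
          using light(1) 2(1) nonempty
          by (auto intro!: runs_call[OF runs_linear(1)[OF X(1)]] wp_mono[OF e] runs_call[OF runs_marks(1)[OF V]]
             runs_call[OF runs_marks(1)[OF B]] runs_call[OF runs_linear(2)[OF X(1)]] runs_call[OF g])
        then show ?thesis
          by (intro runsI[OF prog_nth(27)]) (use b in \<open>auto simp: length_prog elim!: wp_mono order_trans\<close>)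
      qed
    qed
  qed
qed

end

section \<open>Inputs and running time\<close>

context odd_cycle
begin

definition size_bound :: "nat \<Rightarrow> nat" where
  "size_bound n = n + 10 * table_cost m + 100"

definition threshold :: "nat \<Rightarrow> nat" where
  "threshold n = (LEAST e. n * halvings n \<le> e ^ (k + 2))"

text \<open>This is \<open>leaves (n * m) * leaf_cost + N ^ 8\<close> written outside the locale of
  a particular graph, so that for given \<open>k\<close> it depends on \<open>n\<close>
  alone.\<close>

definition time_bound :: "nat \<Rightarrow> nat" where
  "time_bound n = (n * m + 1) * size_bound n ^ (3 * ((n * m) div ((threshold n + 1) div 2) + 1)) *
     ((m + 1) ^ (threshold n ^ (k + 1)) * size_bound n ^ (k + 14)) + size_bound n ^ 8"

end

context input_graph
begin

lemma runs_main:
  assumes diam: "\<And>u v. u < n \<Longrightarrow> v < n \<Longrightarrow> \<exists>l\<le>k + 2. (E ^^ l) u v"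
    and W: "length W = n * halvings n"
      "runs prog F_nlog [encode_list rows, encode_list rows] (encode_list W) ((length rows + 1) * N ^ 3)"
    and N: "N = size_bound n"
    and X: "wfX X" "map tree_hd rows = map encode_bits X"
  shows "runs prog F_main [encode_list rows] (encode_bool (solvable X)) (time_bound n)"
proof -
  have W0: "W \<noteq> []" if "0 < n" using W(1) that by (cases n) auto
  have eq: "solvable (propagate X) \<longleftrightarrow> solvable X"
    unfolding solvable_def using hom_propagate[OF X(1)] by blast
  have "mu (lst (propagate X)) \<le> n * m" by (rule mu_le[OF wfl_lst])
  then have "leaves (mu (lst (propagate X))) * leaf_cost \<le> leaves (n * m) * leaf_cost"
    by (intro mult_le_mono1 leaves_mono)
  then have br: "runs prog F_branch [encode_list rows, encode_list W, encs (propagate X)] (encode_bool (solvable X))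
      (leaves (n * m) * leaf_cost)"
    using runs_mono[OF runs_branch[OF diam W0 wfX_propagate[OF X(1)] ac_propagate[OF X(1)]]] unfolding eq by blast
  have ls: "runs prog F_lists [encode_list rows] (encs X) ((length rows + 1) * N)"
    using runs_lists[of rows] unfolding X(2) .
  have "(length rows + 1) * N ^ 3 \<le> N ^ 4" using pow_bound_eq[of n 4 3] length_rows by simp
  moreover have "(length rows + 1) * N \<le> N ^ 2" using pow_absorb1[of n] length_rows by simp
  moreover have "51 * N ^ 7 \<le> N ^ 8" "N ^ 4 \<le> N ^ 7" "N ^ 2 \<le> N ^ 7" "100 \<le> N ^ 7"
    using pow_absorb_eq[of 0 8 7] pow_ge(3)[of 4 7] pow_ge(3)[of 2 7] pow_100[of 7] by auto
  ultimately have b: "(length rows + 1) * N ^ 3 + (length rows + 1) * N + N ^ 7 + 20 \<le> N ^ 8" by linarith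
  have T: "time_bound n = leaves (n * m) * leaf_cost + N ^ 8"
    unfolding time_bound_def N[symmetric] leaves_def leaf_cost_def drop_size_def thr_def threshold_def W(1) ..
  define C where "C = leaves (n * m) * leaf_cost"
  show ?thesis
    unfolding T using b unfolding C_def[symmetric]
    by (intro runsI[OF prog_nth(1)])
      (auto simp: length_prog main_body_def wp_Call wps_Cons wps_Nil wp_Arg
        intro!: runs_call[OF W(2)] runs_call[OF ls[unfolded One_nat_def]] runs_call[OF runs_propagate[OF X(1)]] runs_call[OF br[folded C_def]])
qed

end

section \<open>Short walks from a bound on the diameter\<close>

lemma walk_relpowp:
  assumes "pre_digraph.awalk (with_proj G) u p v"
  shows "((\<lambda>u v. (u, v) \<in> parcs G) ^^ length p) u v"
proof -
  have "set p \<subseteq> parcs G" "pcas u p v"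
    using assms by (simp_all add: pre_digraph.awalk_def cas_with_proj_eq)
  then show ?thesis
  proof (induction p arbitrary: u)
    case (Cons e p)
    have "(u, snd e) \<in> parcs G" using Cons.prems by auto
    moreover have "((\<lambda>u v. (u, v) \<in> parcs G) ^^ length p) (snd e) v" using Cons by auto
    ultimately show ?case unfolding list.size by (metis (no_types) add.right_neutral add_Suc_right relpowp_Suc_I2)
  qed simp
qed

text \<open>Arguing by contradiction also covers pairs joined by no path: the infimum is bounded
  below by c + 1 whether or not its index set is empty.\<close>

lemma walk_of_diameter:
  assumes diam: "graph_diameter G \<le> enat c" and uv: "u \<in> pverts G" "v \<in> pverts G"
  shows "\<exists>l\<le>c. ((\<lambda>u v. (u, v) \<in> parcs G) ^^ l) u v"
proof (rule ccontr)
  assume no: "\<not> ?thesis"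
  have "enat (Suc c) \<le> graph_dist G u v"
    unfolding graph_dist_def
  proof (rule INF_greatest)
    fix p assume "p \<in> {p. pre_digraph.apath (with_proj G) u p v}"
    then have "((\<lambda>u v. (u, v) \<in> parcs G) ^^ length p) u v"
      by (intro walk_relpowp) (simp add: pre_digraph.apath_def)
    then have "\<not> length p \<le> c" using no by blast
    then show "enat (Suc c) \<le> enat (length p)" by simp
  qed
  also have "\<dots> \<le> graph_diameter G"
    unfolding graph_diameter_def using uv by (meson SUP_upper2 order_refl)
  finally show False using diam by (metis enat_ord_simps(1) not_less_eq_eq order_refl order_trans)
qed

context odd_cycle
begin

lemma prog_solves:
  "solves_LHom_in_time prog (cycle_graph (2 * k + 1)) (\<lambda>G. graph_diameter G \<le> enat (k + 2))
     (\<lambda>n. real (time_bound n + 2))"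
  unfolding solves_LHom_in_time_def
proof (intro allI impI)
  fix G :: "nat pair_pre_digraph" and L :: "nat \<Rightarrow> nat set"
  assume inst: "lhom_instance (cycle_graph (2 * k + 1)) G L" and diam: "graph_diameter G \<le> enat (k + 2)"
  define n where "n = card (pverts G)"
  interpret G: pair_graph G using inst by (simp add: lhom_instance_def)
  have verts: "pverts G = {0..<n}" using inst by (simp add: lhom_instance_def n_def)
  define R where "R = map (\<lambda>v. map (\<lambda>u. (v, u) \<in> parcs G) [0..<n]) [0..<n]"
  define X where "X = map (\<lambda>v. map (\<lambda>a. a \<in> L v) [0..<m]) [0..<n]"
  define rows where "rows = map (\<lambda>v. TCons (encode_bits (map (\<lambda>a. a \<in> L v) [0..<m]))
      (encode_bits (map (\<lambda>u. (v, u) \<in> parcs G) [0..<n]))) [0..<n]"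
  have enc: "encode_instance (cycle_graph (2 * k + 1)) G L = encode_list rows"
    unfolding encode_instance_def rows_def verts by (simp add: cycle_graph_def m_def)
  have arcs_less: "u < n \<and> v < n" if "(u, v) \<in> parcs G" for u v
    using G.wellformed'[OF that] verts by auto
  have arcs_sym: "(v, u) \<in> parcs G" if "(u, v) \<in> parcs G" for u v
    using G.pair_sym_arcs that by (auto simp: symmetric_def dest: symD)
  define N where "N = size_bound n"
  interpret rt: runtime k n N
    by unfold_locales (simp add: N_def size_bound_def)
  have len: "length rows = n" by (simp add: rows_def)
  obtain W where W: "length W = n * halvings n"
      "runs prog F_nlog [encode_list rows, encode_list rows] (encode_list W) ((length rows + 1) * N ^ 3)"
    using rt.runs_nlog[of rows rows] len by auto
  interpret ig: input_graph k n N R rows W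
  proof unfold_locales
    show "list_all2 row_tree rows R"
      by (auto simp: list_all2_conv_all_nth rows_def R_def row_tree_def)
  qed (auto simp: R_def dest: arcs_sym)
  have E_iff: "ig.E u v \<longleftrightarrow> (u, v) \<in> parcs G" for u v
    unfolding ig.E_def using arcs_less by (cases "u < n \<and> v < n") (auto simp: R_def)
  then have E: "ig.E = (\<lambda>u v. (u, v) \<in> parcs G)" by blast
  have X: "ig.wfX X" "map tree_hd rows = map encode_bits X"
    by (auto simp: X_def rows_def)
  have "\<exists>l\<le>k + 2. (ig.E ^^ l) u v" if "u < n" "v < n" for u v
    unfolding E using walk_of_diameter[OF diam] that verts by simp
  from ig.runs_main[OF this W N_def X]
  have run: "runs prog F_main [encode_list rows] (encode_bool (ig.solvable X)) (time_bound n)" .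
  have lst: "ig.lst X v = {a. a < m \<and> a \<in> L v}" if "v < n" for v
    using that by (auto simp: ig.lst_def X_def cset_def)
  have arcs_H: "(a, b) \<in> parcs (cycle_graph (2 * k + 1)) \<longleftrightarrow> cadj a b" for a b
    by (auto simp: cycle_graph_def cadj_def m_def)
  have verts_H: "pverts (cycle_graph (2 * k + 1)) = {0..<m}"
    by (simp add: cycle_graph_def m_def)
  have "ig.hom (ig.lst X) \<phi> \<longleftrightarrow> list_homomorphism G L (cycle_graph (2 * k + 1)) \<phi>" for \<phi>
    unfolding ig.hom_def list_homomorphism_def E_iff verts verts_H arcs_H by (auto simp: lst split: prod.splits)
  then have sol: "ig.solvable X \<longleftrightarrow> (\<exists>\<phi>. list_homomorphism G L (cycle_graph (2 * k + 1)) \<phi>)"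
    by (simp add: ig.solvable_def)
  \<comment> \<open>The outer call adds two steps, one for its argument and one for the call
    itself.\<close>
  have "wp prog [encode_list rows] (Call F_main [Arg 0])
      (\<lambda>v t. v = encode_bool (ig.solvable X) \<and> t \<le> time_bound n + 2)"
    by (auto simp: wp_simps intro!: runs_call[OF run])
  then show "computes_in_time prog (encode_instance (cycle_graph (2 * k + 1)) G L)
     (encode_bool (\<exists>\<phi>. list_homomorphism G L (cycle_graph (2 * k + 1)) \<phi>))
     (real (time_bound (card (pverts G)) + 2))"
    unfolding enc sol[symmetric] n_def[symmetric] computes_in_time_def wp_def by auto
qed

end

section \<open>Asymptotic estimate of the running time\<close>

lemma less_two_pow_halvings: "n < 2 ^ halvings n"
  by (induction n rule: halvings.induct) auto

lemma two_pow_halvings_le: "0 < n \<Longrightarrow> 2 ^ halvings n \<le> 2 * n"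
proof (induction n rule: halvings.induct)
  case (2 x)
  show ?case
  proof (cases "Suc x div 2 = 0")
    case True
    then show ?thesis by simp
  next
    case False
    then have "2 ^ halvings (Suc x div 2) \<le> 2 * (Suc x div 2)" using 2 by simp
    also have "\<dots> \<le> Suc x" by simp
    finally show ?thesis by simp
  qed
qed simp

text \<open>The 4 comes from ln 2 \<ge> 1 / 2 and ln 2 < 1 \<le> ln n: half of
  \<open>halvings n\<close> is at most ln 2 + ln n \<le> 2 ln n. The bound n \<ge> 3 gives 1 \<le>
  ln n because e \<le> 3.\<close>

lemma halvings_bounds:
  assumes "3 \<le> n"
  shows "ln (real n) \<le> real (halvings n)" "real (halvings n) \<le> 4 * ln (real n)" "1 \<le> ln (real n)"
proof -
  have "real n < 2 ^ halvings n" using less_two_pow_halvings[of n] by (metis of_nat_less_numeral_power_cancel_iff)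
  then have "ln (real n) < ln (2 ^ halvings n)" using assms by simp
  also have "\<dots> = real (halvings n) * ln 2" by (simp add: ln_realpow)
  also have "\<dots> \<le> real (halvings n) * 1" using ln_2_less_1 by (intro mult_left_mono) auto
  finally show "ln (real n) \<le> real (halvings n)" by simp
  have "exp 1 \<le> real n" using exp_le assms by linarith
  then show 1: "1 \<le> ln (real n)" using assms by (subst ln_ge_iff) auto
  have "2 ^ halvings n \<le> 2 * real n" using two_pow_halvings_le[of n] assms
    by (metis of_nat_le_iff of_nat_mult of_nat_numeral of_nat_power not_numeral_le_zero gr0I)
  then have "ln (2 ^ halvings n :: real) \<le> ln (2 * real n)" using assms by simp
  then have "real (halvings n) * ln 2 \<le> ln 2 + ln (real n)" using assms by (simp add: ln_realpow ln_mult)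
  moreover have "1 / 2 \<le> ln (2 :: real)" using ln_le_minus_one[of "1 / 2"] by (simp add: ln_div)
  then have "real (halvings n) * (1 / 2) \<le> real (halvings n) * ln 2" by (intro mult_left_mono) auto
  ultimately show "real (halvings n) \<le> 4 * ln (real n)" using 1 ln_2_less_1 by linarith
qed

context odd_cycle
begin

lemma threshold_bounds:
  assumes "0 < n * halvings n"
  shows "n * halvings n \<le> threshold n ^ (k + 2)" "(threshold n - 1) ^ (k + 2) < n * halvings n" "0 < threshold n"
proof -
  let ?w = "n * halvings n"
  have "?w \<le> ?w ^ (k + 2)" using assms by (intro self_le_power) auto
  then show le: "?w \<le> threshold n ^ (k + 2)" unfolding threshold_def by (rule LeastI)
  show pos: "0 < threshold n" using le assms by (cases "threshold n") auto
  have "\<not> ?w \<le> (threshold n - 1) ^ (k + 2)"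
    using not_less_Least[of "threshold n - 1" "\<lambda>e. ?w \<le> e ^ (k + 2)"] pos
    unfolding threshold_def by simp
  then show "(threshold n - 1) ^ (k + 2) < ?w" by simp
qed

text \<open>The 20 consists of 2 for n m + 1 \<le> N ^ 2, 3 from the exponent in
  \<open>leaves\<close>, 14 from \<open>leaf_cost\<close>, and 1 for the factor 2 that absorbs the
  additive terms.\<close>

lemma time_bound_le:
  defines "q \<equiv> \<lambda>n. (n * m) div ((threshold n + 1) div 2)"
  shows "time_bound n + 2 \<le> size_bound n ^ (3 * q n + k + 20) * (m + 1) ^ (threshold n ^ (k + 1))"
proof -
  define N P where "N = size_bound n" and "P = (m + 1) ^ (threshold n ^ (k + 1))"
  have N: "n + 10 * table_cost m + 100 = N" "m \<le> table_cost m" by (auto simp: N_def size_bound_def table_cost_def)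
  have P: "1 \<le> P" by (simp add: P_def)
  define E where "E = N ^ (3 * q n + k + 19) * P"
  have mN: "m \<le> N" using N by linarith
  then have "n * m \<le> n * N" by (rule mult_le_mono2)
  moreover have "(n + 1) * N = n * N + N" by simp
  ultimately have "n * m + 1 \<le> (n + 1) * N" using N by linarith
  also have "\<dots> \<le> N * N" using N by (intro mult_le_mono1) linarith
  finally have "n * m + 1 \<le> N ^ 2" by (simp add: power2_eq_square)
  then have "(n * m + 1) * N ^ (3 * (q n + 1)) * (P * N ^ (k + 14)) \<le> N ^ 2 * N ^ (3 * (q n + 1)) * (P * N ^ (k + 14))"
    by (intro mult_le_mono1)
  also have "\<dots> = N ^ (2 + 3 * (q n + 1) + (k + 14)) * P" by (simp only: power_add) simp
  also have "2 + 3 * (q n + 1) + (k + 14) = 3 * q n + k + 19" by simp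
  finally have 1: "(n * m + 1) * N ^ (3 * (q n + 1)) * (P * N ^ (k + 14)) \<le> E" unfolding E_def .
  have "N ^ 8 + 2 \<le> N ^ 8 + N ^ 8" using N power_increasing[of 1 8 N] by simp
  also have "\<dots> = 2 * N ^ 8" by simp
  also have "\<dots> \<le> N * N ^ 8" using N by (intro mult_le_mono1) linarith
  also have "\<dots> = N ^ 9 * 1" by (simp add: power_Suc[symmetric])
  also have "\<dots> \<le> E" unfolding E_def using N P by (intro mult_le_mono power_increasing) auto
  finally have 2: "N ^ 8 + 2 \<le> E" .
  have "time_bound n + 2 \<le> 2 * E" using 1 2 unfolding time_bound_def N_def[symmetric] P_def[symmetric] q_def by linarith
  also have "\<dots> \<le> N * E" using N by (intro mult_le_mono1) linarith
  also have "\<dots> = N ^ Suc (3 * q n + k + 19) * P" unfolding E_def by (simp only: power_Suc mult.assoc)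
  also have "Suc (3 * q n + k + 19) = 3 * q n + k + 20" by simp
  finally show ?thesis unfolding N_def P_def .
qed

text \<open>Let x = n ln n and y = x ^ (1 / (k + 2)). The threshold lies between y and 5 y, so q
  \<le> 2 m n / y and q ln n \<le> 2 m x / y = 2 m y ^ (k + 1), while the ball contributes (5 y) ^
  (k + 1) ln (m + 1). For these n the size bound is at most n ^ 2, which doubles the logarithm;
  hence 12 = 3 * 2 * 2.\<close>

lemma ln_time_bound:
  assumes n: "10 * table_cost m + 100 \<le> n"
  shows "ln (real (time_bound n + 2)) \<le>
    (12 * real m + 2 * (real k + 20) + 5 ^ (k + 1) * ln (real (m + 1))) *
    (real n * ln (real n)) powr (real (k + 1) / real (k + 2))"
proof -
  define x where "x = real n * ln (real n)"
  define y where "y = x powr (1 / real (k + 2))"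
  define e where "e = threshold n"
  define d where "d = (e + 1) div 2"
  define q where "q = (n * m) div d"
  define N where "N = size_bound n"
  have n3: "3 \<le> n" using n by linarith
  note h = halvings_bounds[OF n3]
  have n_pos: "0 < real n" "1 \<le> real n" using n3 by auto
  have x1: "1 \<le> x" unfolding x_def using mult_mono[of 1 "real n" 1 "ln (real n)"] n_pos h(3) by simp
  have y1: "1 \<le> y" unfolding y_def using x1 by (simp add: ge_one_powr_ge_zero)
  have yk2: "y ^ (k + 2) = x"
  proof -
    have "y ^ (k + 2) = y powr real (k + 2)" using y1 by (subst powr_realpow) auto
    also have "\<dots> = x powr (1 / real (k + 2) * real (k + 2))" unfolding y_def by (rule powr_powr)
    also have "\<dots> = x" using x1 by simp
    finally show ?thesis .
  qed
  have yk1: "y ^ (k + 1) = x powr (real (k + 1) / real (k + 2))"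
  proof -
    have "y ^ (k + 1) = y powr real (k + 1)" using y1 by (subst powr_realpow) auto
    also have "\<dots> = x powr (1 / real (k + 2) * real (k + 1))" unfolding y_def by (rule powr_powr)
    finally show ?thesis by simp
  qed
  have xy: "x / y = y ^ (k + 1)" using yk2 y1 by (simp add: field_simps)
  have w: "x \<le> real (n * halvings n)" "real (n * halvings n) \<le> 4 * x"
    unfolding x_def using h n_pos by (auto simp: mult_left_mono)
  have w0: "0 < n * halvings n" using w(1) x1 by (metis gr0I not_one_le_zero of_nat_0 order_trans)
  note thr = threshold_bounds[OF w0, folded e_def]
  have "y ^ (k + 2) \<le> real e ^ (k + 2)"
    unfolding yk2 using w(1) thr(1) by (metis of_nat_le_iff of_nat_power order_trans)
  then have ye: "y \<le> real e" using y1 by (subst (asm) power_mono_iff) auto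
  have "real (e - 1) ^ (k + 2) < (4 * y) ^ (k + 2)"
  proof -
    have "real (e - 1) ^ (k + 2) < real (n * halvings n)" using thr(2) by (metis of_nat_less_iff of_nat_power)
    also have "\<dots> \<le> 4 * x" by (rule w(2))
    also have "\<dots> \<le> 4 ^ (k + 2) * x" using x1 by (intro mult_right_mono self_le_power) auto
    also have "\<dots> = (4 * y) ^ (k + 2)" by (simp only: power_mult_distrib yk2)
    finally show ?thesis .
  qed
  then have "real (e - 1) < 4 * y" by (rule power_less_imp_less_base) (use y1 in simp)
  \<comment> \<open>The 4 comes from the estimate of \<open>halvings\<close>, and 1 \<le> y pays for
    rounding the root up.\<close>
  then have e5: "real e \<le> 5 * y" using y1 thr(3) by linarith
  have "e \<le> 2 * d" unfolding d_def by linarith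
  then have d: "y / 2 \<le> real d" using ye by linarith
  have d_pos: "0 < real d" using d y1 by linarith
  have "real q \<le> real (n * m) / real d" unfolding q_def by (rule of_nat_div_le_of_nat)
  also have "\<dots> \<le> real (n * m) / (y / 2)" using d y1 by (intro divide_left_mono) auto
  finally have q: "real q \<le> 2 * real m * real n / y" by (simp add: algebra_simps)
  have "y ^ (k + 2) \<le> real n ^ (k + 2)"
  proof -
    have "ln (real n) \<le> real n" using ln_le_minus_one[OF n_pos(1)] by linarith
    then have "x \<le> real n * real n" unfolding x_def using n_pos by (intro mult_left_mono) auto
    also have "\<dots> = real n ^ 2" by (simp add: power2_eq_square)
    also have "\<dots> \<le> real n ^ (k + 2)" using n_pos by (intro power_increasing) auto
    finally show ?thesis unfolding yk2 .
  qed
  then have yn: "y \<le> real n" using y1 by (subst (asm) power_mono_iff) auto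
  \<comment> \<open>Polynomial factors stay below the main term: y \<le> n gives x / n \<le> x / y =
    y ^ (k + 1).\<close>
  have "ln (real n) = x / real n" using n_pos by (simp add: x_def)
  also have "\<dots> \<le> x / y" using yn y1 x1 by (intro divide_left_mono) auto
  finally have lny: "ln (real n) \<le> y ^ (k + 1)" unfolding xy .
  have "N \<le> 2 * n" unfolding N_def size_bound_def using n by linarith
  also have "\<dots> \<le> n * n" using n3 by (intro mult_le_mono1) simp
  finally have "real N \<le> real n ^ 2" by (metis of_nat_le_iff of_nat_power power2_eq_square)
  moreover have N_pos: "0 < real N" unfolding N_def size_bound_def by simp
  ultimately have "ln (real N) \<le> ln (real n ^ 2)" using n_pos by simp
  then have lnN: "ln (real N) \<le> 2 * ln (real n)" using n_pos by (simp add: ln_realpow)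
  have "real (time_bound n + 2) \<le> real N ^ (3 * q + k + 20) * real (m + 1) ^ (e ^ (k + 1))"
    using time_bound_le[of n] unfolding N_def q_def d_def e_def
    by (metis of_nat_le_iff of_nat_mult of_nat_power)
  then have "ln (real (time_bound n + 2)) \<le> ln (real N ^ (3 * q + k + 20) * real (m + 1) ^ (e ^ (k + 1)))"
    by (intro ln_mono) auto
  also have "\<dots> = real (3 * q + k + 20) * ln (real N) + real (e ^ (k + 1)) * ln (real (m + 1))"
    using N_pos by (simp add: ln_mult ln_realpow)
  also have "\<dots> \<le> real (3 * q + k + 20) * (2 * ln (real n)) + (5 * y) ^ (k + 1) * ln (real (m + 1))"
  proof (intro add_mono mult_left_mono mult_right_mono lnN)
    show "real (e ^ (k + 1)) \<le> (5 * y) ^ (k + 1)"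
      unfolding of_nat_power by (intro power_mono e5) simp
  qed auto
  also have "real (3 * q + k + 20) * (2 * ln (real n)) = 6 * (real q * ln (real n)) + 2 * (real k + 20) * ln (real n)"
    by (simp add: algebra_simps)
  also have "real q * ln (real n) \<le> 2 * real m * y ^ (k + 1)"
  proof -
    have "real q * ln (real n) \<le> 2 * real m * real n / y * ln (real n)"
      using q h(3) by (intro mult_right_mono) auto
    also have "\<dots> = 2 * real m * (x / y)" by (simp add: x_def)
    finally show ?thesis unfolding xy .
  qed
  also have "2 * (real k + 20) * ln (real n) \<le> 2 * (real k + 20) * y ^ (k + 1)"
    using lny by (intro mult_left_mono) auto
  finally show ?thesis
    unfolding x_def[symmetric] yk1[symmetric] by (simp add: algebra_simps power_mult_distrib)
qed

end

theorem theorem2: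
  fixes k :: nat
  assumes "k \<ge> 2"
  shows "\<exists>p. \<exists>g :: nat \<Rightarrow> real.
           g \<in> O(\<lambda>n. (real n * ln (real n)) powr (real (k + 1) / real (k + 2))) \<and>
           solves_LHom_in_time p (cycle_graph (2 * k + 1))
             (\<lambda>G. graph_diameter G \<le> enat (k + 2)) (\<lambda>n. exp (g n))"
proof -
  interpret odd_cycle k using assms by unfold_locales
  \<comment> \<open>As the logarithm of the exact bound, \<open>g\<close> makes
    \<open>exp (g n)\<close> a valid running time for every \<open>n\<close>, small ones included;
    only its growth is estimated asymptotically.\<close>
  define g where "g n = ln (real (time_bound n + 2))" for n
  have "g \<in> O(\<lambda>n. (real n * ln (real n)) powr (real (k + 1) / real (k + 2)))"
  proof (rule bigoI)
    show "\<forall>\<^sub>F n in sequentially. norm (g n) \<le>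
        (12 * real m + 2 * (real k + 20) + 5 ^ (k + 1) * ln (real (m + 1))) *
        norm ((real n * ln (real n)) powr (real (k + 1) / real (k + 2)))"
      using eventually_ge_at_top[of "10 * table_cost m + 100"]
    proof eventually_elim
      case (elim n)
      have "0 \<le> g n" by (simp add: g_def)
      then show ?case using ln_time_bound[OF elim] by (simp add: g_def)
    qed
  qed
  moreover have "exp (g n) = real (time_bound n + 2)" for n by (simp add: g_def)
  then have "solves_LHom_in_time prog (cycle_graph (2 * k + 1))
      (\<lambda>G. graph_diameter G \<le> enat (k + 2)) (\<lambda>n. exp (g n))"
    using prog_solves by simp
  ultimately show ?thesis by blast
qed

end
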